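(* Consider the repeated game data $(K,I,J,C,D,g,q)$ described in the context. Assume that there exist maps $\hat k:C\to K$ and $\hat d:C\to D$ such that, with $E=\{(k,c,d)\in K\times C\times D:\ \hat k(c)=k,\ \hat d(c)=d\}$, one has $q(k,i,j)(E)=1$ for all $(k,i,j)\in K\times I\times J$, and that for every $(k,i)$ the marginal of $q(k,i,j)$ on $K\times D$ does not depend on $j\in J$. Let $\Delta^E=\{\pi\in\Delta(K\times C\times D):\pi(E)=1\}$. Then for every $\pi\in\Delta^E$ the game $\Gamma(\pi)$ has a uniform value $v^*(\pi)$, and $$v^*(\pi)=\inf_{n\ge1}\sup_{m\ge0}v_{m,n}(\pi)=\sup_{m\ge0}\inf_{n\ge1}v_{m,n}(\pi)=\inf_{n\ge1}\sup_{m\ge0}w_{m,n}(\pi)=\sup_{m\ge0}\inf_{n\ge1}w_{m,n}(\pi).$$ Moreover, $(v_n)_n$ converges uniformly to $v^*$ on $\Delta^E$, where $v_n=v_{0,n}$.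
   Context: Repeated game. $K$ (states), $I$ (actions of player 1), $J$ (actions of player 2), $C$ (signals of player 1), $D$ (signals of player 2) are nonempty finite sets; $\Delta(S)$ denotes the set of probability distributions on a finite set $S$; $g:K\times I\times J\to[0,1]$ is the payoff of player 1 and $q:K\times I\times J\to\Delta(K\times C\times D)$ the transition. For $\pi\in\Delta(K\times C\times D)$ the zero-sum game $\Gamma(\pi)$ is played as follows: $(k_1,c_1,d_1)$ is drawn from $\pi$. At each stage $t\ge1$, player 1 learns $c_t$ and player 2 learns $d_t$; simultaneously player 1 chooses $i_t\in I$ and player 2 chooses $j_t\in J$; the stage payoff is $g(k_t,i_t,j_t)$ for player 1 and its opposite for player 2; then $(k_{t+1},c_{t+1},d_{t+1})$ is drawn from $q(k_t,i_t,j_t)$. A (behavior) strategy of player 1 is a sequence $\sigma=(\sigma_t)_{t\ge1}$ of maps $\sigma_t:(C\times I)^{t-1}\times C\to\Delta(I)$; a strategy of player 2 is a sequence $\tau=(\tau_t)_{t\ge1}$ of maps $\tau_t:(D\times J)^{t-1}\times D\to\Delta(J)$. The sets of strategies are $\Sigma$ and $\mathcal T$; $\mathbb P_{\pi,\sigma,\tau}$ is the induced probability on plays. For a finitely supported probability $\theta=\sum_{t\ge1}\theta_t\delta_t$ on the positive integers, $\Gamma_{[\theta]}(\pi)$ is the zero-sum game with strategy sets $\Sigma,\mathcal T$ and payoff $\gamma_{[\theta]}^\pi(\sigma,\tau)=\mathbb E_{\mathbb P_{\pi,\sigma,\tau}}\big(\sum_{t\ge1}\theta_tg(k_t,i_t,j_t)\big)$;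 it is the mixed extension of a finite game (Kuhn's theorem), so it has a value $v_{[\theta]}(\pi)$. For $m\ge0,n\ge1$, $v_{m,n}(\pi)$ is the value $v_{[\theta]}(\pi)$ with $\theta=\frac1n\sum_{t=m+1}^{m+n}\delta_t$. For $\theta\in\Delta(\{1,\dots,n\})$ define $\theta^{m,n}\in\Delta(\{1,\dots,m+n\})$ by $\theta^{m,n}_s=0$ if $s\le m$ and $\theta^{m,n}_s=\sum_{t=s-m}^n\theta_t/t$ if $m<s\le m+n$; set $w_{m,n}(\pi)=\inf_{\theta\in\Delta(\{1,\dots,n\})}v_{[\theta^{m,n}]}(\pi)$. Uniform value: with $\gamma_n^\pi(\sigma,\tau)=\mathbb E_{\mathbb P_{\pi,\sigma,\tau}}\big(\frac1n\sum_{t=1}^ng(k_t,i_t,j_t)\big)$, let $\underline v(\pi)=\sup_\sigma\liminf_n(\inf_\tau\gamma_n^\pi(\sigma,\tau))$ and $\overline v(\pi)=\inf_\tau\limsup_n(\sup_\sigma\gamma_n^\pi(\sigma,\tau))$; $\Gamma(\pi)$ has a uniform value if they coincide, and the uniform value is the common quantity. *)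

theory Defs
  imports "HOL-Probability.Probability"
begin

text \<open>A map on lists of past (signal, action) pairs (in chronological order) together with the
  current signal encodes the whole sequence of maps indexed by the stages: the stage is the length
  of the list plus one.\<close>

type_synonym ('s, 'a) strategy = "('s \<times> 'a) list \<Rightarrow> 's \<Rightarrow> 'a pmf"

type_synonym ('k, 'i, 'j, 'c, 'd) stage = "'k \<times> 'c \<times> 'd \<times> 'i \<times> 'j"

definition obs1 :: "('k, 'i, 'j, 'c, 'd) stage list \<Rightarrow> ('c \<times> 'i) list" where
  "obs1 = map (\<lambda>(k, c, d, i, j). (c, i))"

definition obs2 :: "('k, 'i, 'j, 'c, 'd) stage list \<Rightarrow> ('d \<times> 'j) list" where
  "obs2 = map (\<lambda>(k, c, d, i, j). (d, j))"

definition next_state ::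
  "('k \<Rightarrow> 'i \<Rightarrow> 'j \<Rightarrow> ('k \<times> 'c \<times> 'd) pmf) \<Rightarrow> ('k \<times> 'c \<times> 'd) pmf
    \<Rightarrow> ('k, 'i, 'j, 'c, 'd) stage list \<Rightarrow> ('k \<times> 'c \<times> 'd) pmf" where
  "next_state q \<pi> h = (if h = [] then \<pi> else (case last h of (k, c, d, i, j) \<Rightarrow> q k i j))"

text \<open>Law of the first \<open>t\<close> stages of the play under \<open>\<sigma>\<close> and \<open>\<tau>\<close>, that is, the marginal on
  these stages of the probability on infinite plays. Every payoff below depends on finitely many
  stages only. Stage \<open>s\<close> (counted from 1) is the list entry with index \<open>s - 1\<close>.\<close>

fun play_law ::
  "('k \<Rightarrow> 'i \<Rightarrow> 'j \<Rightarrow> ('k \<times> 'c \<times> 'd) pmf) \<Rightarrow> ('k \<times> 'c \<times> 'd) pmf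
    \<Rightarrow> ('c, 'i) strategy \<Rightarrow> ('d, 'j) strategy \<Rightarrow> nat \<Rightarrow> ('k, 'i, 'j, 'c, 'd) stage list pmf" where
  "play_law q \<pi> \<sigma> \<tau> 0 = return_pmf []"
| "play_law q \<pi> \<sigma> \<tau> (Suc t) =
    bind_pmf (play_law q \<pi> \<sigma> \<tau> t) (\<lambda>h.
    bind_pmf (next_state q \<pi> h) (\<lambda>(k, c, d).
    bind_pmf (\<sigma> (obs1 h) c) (\<lambda>i.
    bind_pmf (\<tau> (obs2 h) d) (\<lambda>j.
    return_pmf (h @ [(k, c, d, i, j)])))))"

definition stage_payoff ::
  "('k \<Rightarrow> 'i \<Rightarrow> 'j \<Rightarrow> real) \<Rightarrow> ('k, 'i, 'j, 'c, 'd) stage \<Rightarrow> real" where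
  "stage_payoff g x = (case x of (k, c, d, i, j) \<Rightarrow> g k i j)"

text \<open>Distributions of stages are given by their weights \<open>\<theta>\<close>. They are finitely supported, so the
  horizon is the largest stage of positive weight.\<close>

definition payoff ::
  "('k \<Rightarrow> 'i \<Rightarrow> 'j \<Rightarrow> real) \<Rightarrow> ('k \<Rightarrow> 'i \<Rightarrow> 'j \<Rightarrow> ('k \<times> 'c \<times> 'd) pmf)
    \<Rightarrow> (nat \<Rightarrow> real) \<Rightarrow> ('k \<times> 'c \<times> 'd) pmf
    \<Rightarrow> ('c, 'i) strategy \<Rightarrow> ('d, 'j) strategy \<Rightarrow> real" where
  "payoff g q \<theta> \<pi> \<sigma> \<tau> =
    (let T = Max {t. \<theta> t \<noteq> 0}
     in measure_pmf.expectation (play_law q \<pi> \<sigma> \<tau> T)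
          (\<lambda>h. \<Sum>t = 1..T. \<theta> t * stage_payoff g (h ! (t - 1))))"

definition is_value :: "('s \<Rightarrow> 't \<Rightarrow> real) \<Rightarrow> real \<Rightarrow> bool" where
  "is_value \<gamma> v \<longleftrightarrow> (SUP \<sigma>. INF \<tau>. \<gamma> \<sigma> \<tau>) = v \<and> (INF \<tau>. SUP \<sigma>. \<gamma> \<sigma> \<tau>) = v"

definition game_value ::
  "('k \<Rightarrow> 'i \<Rightarrow> 'j \<Rightarrow> real) \<Rightarrow> ('k \<Rightarrow> 'i \<Rightarrow> 'j \<Rightarrow> ('k \<times> 'c \<times> 'd) pmf)
    \<Rightarrow> (nat \<Rightarrow> real) \<Rightarrow> ('k \<times> 'c \<times> 'd) pmf \<Rightarrow> real" where
  "game_value g q \<theta> \<pi> = (THE v. is_value (payoff g q \<theta> \<pi>) v)"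

definition unif_weights :: "nat \<Rightarrow> nat \<Rightarrow> nat \<Rightarrow> real" where
  "unif_weights m n t = (if m + 1 \<le> t \<and> t \<le> m + n then 1 / real n else 0)"

definition v_mn ::
  "('k \<Rightarrow> 'i \<Rightarrow> 'j \<Rightarrow> real) \<Rightarrow> ('k \<Rightarrow> 'i \<Rightarrow> 'j \<Rightarrow> ('k \<times> 'c \<times> 'd) pmf)
    \<Rightarrow> nat \<Rightarrow> nat \<Rightarrow> ('k \<times> 'c \<times> 'd) pmf \<Rightarrow> real" where
  "v_mn g q m n \<pi> = game_value g q (unif_weights m n) \<pi>"

definition prob_weights :: "nat \<Rightarrow> (nat \<Rightarrow> real) set" where
  "prob_weights n =
    {\<theta>. (\<forall>t. 0 \<le> \<theta> t) \<and> (\<forall>t. t \<notin> {1..n} \<longrightarrow> \<theta> t = 0) \<and> (\<Sum>t = 1..n. \<theta> t) = 1}"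

definition shift_weights :: "nat \<Rightarrow> nat \<Rightarrow> (nat \<Rightarrow> real) \<Rightarrow> nat \<Rightarrow> real" where
  "shift_weights m n \<theta> s =
    (if m < s \<and> s \<le> m + n then (\<Sum>t = s - m..n. \<theta> t / real t) else 0)"

definition w_mn ::
  "('k \<Rightarrow> 'i \<Rightarrow> 'j \<Rightarrow> real) \<Rightarrow> ('k \<Rightarrow> 'i \<Rightarrow> 'j \<Rightarrow> ('k \<times> 'c \<times> 'd) pmf)
    \<Rightarrow> nat \<Rightarrow> nat \<Rightarrow> ('k \<times> 'c \<times> 'd) pmf \<Rightarrow> real" where
  "w_mn g q m n \<pi> = (INF \<theta>\<in>prob_weights n. game_value g q (shift_weights m n \<theta>) \<pi>)"

definition avg_payoff ::
  "('k \<Rightarrow> 'i \<Rightarrow> 'j \<Rightarrow> real) \<Rightarrow> ('k \<Rightarrow> 'i \<Rightarrow> 'j \<Rightarrow> ('k \<times> 'c \<times> 'd) pmf)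
    \<Rightarrow> nat \<Rightarrow> ('k \<times> 'c \<times> 'd) pmf \<Rightarrow> ('c, 'i) strategy \<Rightarrow> ('d, 'j) strategy \<Rightarrow> real" where
  "avg_payoff g q n \<pi> \<sigma> \<tau> =
    measure_pmf.expectation (play_law q \<pi> \<sigma> \<tau> n)
      (\<lambda>h. (1 / real n) * (\<Sum>t = 1..n. stage_payoff g (h ! (t - 1))))"

definition lower_unif_value ::
  "('k \<Rightarrow> 'i \<Rightarrow> 'j \<Rightarrow> real) \<Rightarrow> ('k \<Rightarrow> 'i \<Rightarrow> 'j \<Rightarrow> ('k \<times> 'c \<times> 'd) pmf)
    \<Rightarrow> ('k \<times> 'c \<times> 'd) pmf \<Rightarrow> ereal" where
  "lower_unif_value g q \<pi> = (SUP \<sigma>. liminf (\<lambda>n. ereal (INF \<tau>. avg_payoff g q n \<pi> \<sigma> \<tau>)))"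

definition upper_unif_value ::
  "('k \<Rightarrow> 'i \<Rightarrow> 'j \<Rightarrow> real) \<Rightarrow> ('k \<Rightarrow> 'i \<Rightarrow> 'j \<Rightarrow> ('k \<times> 'c \<times> 'd) pmf)
    \<Rightarrow> ('k \<times> 'c \<times> 'd) pmf \<Rightarrow> ereal" where
  "upper_unif_value g q \<pi> = (INF \<tau>. limsup (\<lambda>n. ereal (SUP \<sigma>. avg_payoff g q n \<pi> \<sigma> \<tau>)))"

definition has_uniform_value ::
  "('k \<Rightarrow> 'i \<Rightarrow> 'j \<Rightarrow> real) \<Rightarrow> ('k \<Rightarrow> 'i \<Rightarrow> 'j \<Rightarrow> ('k \<times> 'c \<times> 'd) pmf)
    \<Rightarrow> ('k \<times> 'c \<times> 'd) pmf \<Rightarrow> real \<Rightarrow> bool" where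
  "has_uniform_value g q \<pi> v \<longleftrightarrow>
    lower_unif_value g q \<pi> = ereal v \<and> upper_unif_value g q \<pi> = ereal v"

definition info_set :: "('c \<Rightarrow> 'k) \<Rightarrow> ('c \<Rightarrow> 'd) \<Rightarrow> ('k \<times> 'c \<times> 'd) set" where
  "info_set khat dhat = {(k, c, d). khat c = k \<and> dhat c = d}"

definition Delta_E :: "('c \<Rightarrow> 'k) \<Rightarrow> ('c \<Rightarrow> 'd) \<Rightarrow> ('k \<times> 'c \<times> 'd) pmf set" where
  "Delta_E khat dhat = {\<pi>. measure_pmf.prob \<pi> (info_set khat dhat) = 1}"

end

theory Submission
  imports Defs
begin

text \<open>Player 2 does not influence the joint law of the states and of his own signals. Hence the payoff
  of any weighted game depends on the strategy of player 1 only through the laws of (signals of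
  player 2 up to stage \<open>t\<close>, state \<open>k\<^sub>t\<close>, action \<open>i\<^sub>t\<close>), and these laws are exactly the nonnegative solutions
  of linear flow equations, a convex compact set. A best reply of player 2 is myopic, so the game
  becomes a dynamic programming problem for player 1 over the set of flows; a finite minimax theorem
  shows that its value is the value of the game and that \<open>w\<^sub>m\<^sub>,\<^sub>n\<close> is the largest \<open>min\<^sub>t\<^sub>\<le>\<^sub>n\<close> of the
  averages over the stages \<open>m + 1, \<dots>, m + t\<close>.

  As functions of the unnormalised belief of player 2 the values are positively homogeneous and
  1-Lipschitz, so up to \<open>\<epsilon>\<close> they are all determined by one of finitely many quantised histograms of
  beliefs. Therefore some reachable state guarantees averages of at least \<open>v\<^sup>* - \<epsilon>\<close> up to every
  horizon, where \<open>v\<^sup>* = inf\<^sub>n sup\<^sub>m w\<^sub>m\<^sub>,\<^sub>n\<close>, and compactness of the set of flows gives one strategy that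
  does so for all horizons at once. Conversely player 2 plays optimally block by block, which
  guarantees him \<open>inf\<^sub>n sup\<^sub>m v\<^sub>m\<^sub>,\<^sub>n\<close>, and this is \<open>v\<^sup>*\<close> because a long interval with a high average
  contains a position from which all short averages are high.\<close>

section \<open>A finite minimax theorem\<close>

text \<open>The two structural hypotheses act in opposite directions. \<open>control\<close> makes
  the law of the next state and signal of player 2 a function \<open>Q\<close> of the state and of
  the action of player 1, so every pair of strategies produces a flow. \<open>informed\<close> lets
  player 1 recompute from his own signals the state and everything player 2 was told, so every flow
  can be played. The obstacle is that good play for long horizons may become good only from a date
  that drifts with the horizon. One long average does not survive a limit of horizons, whereas
  having all averages up to \<open>n\<close> at least \<open>c\<close> passes to shorter horizons
  and is a closed condition; hence minima of averages carry the argument. The states reached at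
  different dates live on history sets of different sizes, so no fixed finite-dimensional compact
  set contains them all. They become comparable because a value is a sum over histories of one
  function of the belief, so that only the distribution of beliefs matters. Beliefs stay
  unnormalised: the flow equations remain linear and null histories need no conditioning.\<close>

text \<open>Separation in the plane: the points \<open>(f x, h x)\<close> are closed under mixing up
  to domination and avoid the open positive quadrant, so a line with nonnegative weights keeps them
  below 0. Its slope is the infimum \<alpha> of \<open>- h x / f x\<close> over the points with
  \<open>f x > 0\<close>, normalised to the weight \<open>\<alpha> / (1 + \<alpha>)\<close>.\<close>

lemma two_function_alternative:
  fixes f h :: "'x \<Rightarrow> real"
  assumes conv: "\<And>x y s. x \<in> X \<Longrightarrow> y \<in> X \<Longrightarrow> 0 \<le> s \<Longrightarrow> s \<le> 1 \<Longrightarrow>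
      \<exists>z\<in>X. s * f x + (1 - s) * f y \<le> f z \<and> s * h x + (1 - s) * h y \<le> h z"
    and alt: "\<And>x. x \<in> X \<Longrightarrow> f x \<le> 0 \<or> h x \<le> 0"
  shows "\<exists>s. 0 \<le> s \<and> s \<le> 1 \<and> (\<forall>x\<in>X. s * f x + (1 - s) * h x \<le> 0)"
proof (cases "\<exists>x\<in>X. f x > 0")
  case False
  then show ?thesis by (intro exI[of _ 1]) (auto simp: not_less)
next
  case True
  define X' where "X' = {x\<in>X. f x > 0}"
  have ne: "X' \<noteq> {}" using True by (auto simp: X'_def)
  have hneg: "h x \<le> 0" if "x \<in> X'" for x using alt[of x] that by (auto simp: X'_def)
  define \<alpha> where "\<alpha> = (INF x\<in>X'. - h x / f x)"
  have bdd: "bdd_below ((\<lambda>x. - h x / f x) ` X')"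
  proof (rule bdd_belowI2)
    show "0 \<le> - h x / f x" if "x \<in> X'" for x
      using hneg[OF that] that by (auto simp: X'_def divide_nonpos_pos)
  qed
  have \<alpha>0: "\<alpha> \<ge> 0" unfolding \<alpha>_def
    by (rule cINF_greatest[OF ne]) (use hneg in \<open>auto simp: X'_def divide_nonpos_pos\<close>)
  have key: "\<alpha> * f x + h x \<le> 0" if x: "x \<in> X" for x
  proof (cases "f x > 0")
    case True
    then have "\<alpha> \<le> - h x / f x" unfolding \<alpha>_def using x by (intro cINF_lower[OF bdd]) (auto simp: X'_def)
    then show ?thesis using True by (simp add: field_simps)
  next
    case False
    show ?thesis
    proof (cases "h x \<le> 0")
      case True
      then show ?thesis using False \<alpha>0 by (simp add: mult_nonneg_nonpos add_nonpos_nonpos)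
    next
      case hx: False
      have cross: "f u * h x \<le> h u * f x" if u: "u \<in> X'" for u
      proof (rule ccontr)
        assume n: "\<not> ?thesis"
        define a b c e where "a = f u" and "b = - f x" and "c = - h u" and "e = h x"
        have pos: "a > 0" "b \<ge> 0" "c \<ge> 0" "e > 0" "b * c < a * e"
          using n u hneg[OF u] False hx by (auto simp: a_def b_def c_def e_def X'_def algebra_simps)
        \<comment> \<open>This weight makes both coordinates of the mixture equal, to
          \<open>(a * e - b * c) / (a + b + c + e)\<close>. If \<open>cross\<close> failed, this
          number would be positive and the mixture would lie in the open positive quadrant.\<close>
        define s where "s = (b + e) / (a + b + c + e)"
        have s: "0 \<le> s" "s \<le> 1" "1 - s = (a + c) / (a + b + c + e)"
          using pos by (auto simp: s_def field_simps)
        obtain z where z0: "z \<in> X" "s * f u + (1 - s) * f x \<le> f z" "s * h u + (1 - s) * h x \<le> h z"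
          using conv[of u x s] u x s(1,2) by (auto simp: X'_def)
        then have z: "z \<in> X" "s * a - (1 - s) * b \<le> f z" "(1 - s) * e - s * c \<le> h z"
          by (simp_all add: a_def b_def c_def e_def)
        have D: "a + b + c + e > 0" using pos by auto
        have "s * a - (1 - s) * b = (a * e - b * c) / (a + b + c + e)"
          unfolding s(3) unfolding s_def by (simp add: algebra_simps flip: add_divide_distrib diff_divide_distrib)
        then have "s * a - (1 - s) * b > 0" using pos D by simp
        moreover have "(1 - s) * e - s * c = (a * e - b * c) / (a + b + c + e)"
          unfolding s(3) unfolding s_def by (simp add: algebra_simps flip: add_divide_distrib diff_divide_distrib)
        then have "(1 - s) * e - s * c > 0" using pos D by simp
        ultimately show False using z alt[of z] by auto
      qed
      obtain u where u: "u \<in> X'" using ne by auto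
      have "0 < f u * h x" using u hx by (auto simp: X'_def)
      then have fx: "f x < 0" using cross[OF u] False by (cases "f x = 0") auto
      have "h x / - f x \<le> \<alpha>" unfolding \<alpha>_def
      proof (rule cINF_greatest[OF ne])
        fix u assume u: "u \<in> X'"
        then show "h x / - f x \<le> - h u / f u"
          using cross[OF u] fx by (auto simp: X'_def field_simps)
      qed
      then show ?thesis using fx by (simp add: field_simps)
    qed
  qed
  show ?thesis
  proof (intro exI[of _ "\<alpha> / (1 + \<alpha>)"] conjI ballI)
    fix x assume "x \<in> X"
    have "\<alpha> / (1 + \<alpha>) * f x + (1 - \<alpha> / (1 + \<alpha>)) * h x = (\<alpha> * f x + h x) / (1 + \<alpha>)"
    proof -
      have "1 - \<alpha> / (1 + \<alpha>) = 1 / (1 + \<alpha>)" using \<alpha>0 by (simp add: field_simps)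
      then show ?thesis by (simp add: add_divide_distrib)
    qed
    also have "\<dots> \<le> 0" using key[OF \<open>x \<in> X\<close>] \<alpha>0 by (simp add: divide_nonpos_pos)
    finally show "\<alpha> / (1 + \<alpha>) * f x + (1 - \<alpha> / (1 + \<alpha>)) * h x \<le> 0" .
  qed (use \<alpha>0 in auto)
qed

text \<open>Induction on the number of functions. Points where the new function \<open>f b\<close>
  is already at most \<open>v\<close> are discarded; on the others, again closed under mixing, the
  hypothesis merges the remaining functions into a single \<open>h\<close>, and the planar case
  combines \<open>f b\<close> with \<open>h\<close>. Mixing is only required up to domination, so
  the concave functions arising from best replies are covered.\<close>

lemma finite_minimax:
  fixes f :: "'a \<Rightarrow> 'x \<Rightarrow> real"
  assumes "finite A" "A \<noteq> {}"
    and "\<And>x y s. x \<in> X \<Longrightarrow> y \<in> X \<Longrightarrow> 0 \<le> s \<Longrightarrow> s \<le> 1 \<Longrightarrow>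
      \<exists>z\<in>X. \<forall>a\<in>A. s * f a x + (1 - s) * f a y \<le> f a z"
    and "\<And>x. x \<in> X \<Longrightarrow> \<exists>a\<in>A. f a x \<le> v"
  shows "\<exists>w. (\<forall>a\<in>A. 0 \<le> w a) \<and> sum w A = 1 \<and> (\<forall>x\<in>X. (\<Sum>a\<in>A. w a * f a x) \<le> v)"
  using assms
proof (induction A arbitrary: X rule: finite_ne_induct)
  case (singleton a)
  then show ?case by (intro exI[of _ "\<lambda>_. 1"]) auto
next
  case (insert b A X)
  define X' where "X' = {x\<in>X. f b x > v}"
  have "\<exists>w. (\<forall>a\<in>A. 0 \<le> w a) \<and> sum w A = 1 \<and> (\<forall>x\<in>X'. (\<Sum>a\<in>A. w a * f a x) \<le> v)"
  proof (rule insert.IH)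
    fix x y and s :: real assume *: "x \<in> X'" "y \<in> X'" "0 \<le> s" "s \<le> 1"
    then obtain z where z: "z \<in> X" "\<forall>a\<in>insert b A. s * f a x + (1 - s) * f a y \<le> f a z"
      using insert.prems(1)[of x y s] by (auto simp: X'_def)
    have "v < s * f b x + (1 - s) * f b y"
      using convex_bound_lt[of "- f b x" "- v" "- f b y" s "1 - s"] * by (auto simp: X'_def)
    then have "z \<in> X'" using z by (auto simp: X'_def)
    then show "\<exists>z\<in>X'. \<forall>a\<in>A. s * f a x + (1 - s) * f a y \<le> f a z" using z by auto
  next
    fix x assume "x \<in> X'"
    then show "\<exists>a\<in>A. f a x \<le> v" using insert.prems(2)[of x] by (auto simp: X'_def)
  qed
  then obtain w where w: "\<And>a. a \<in> A \<Longrightarrow> 0 \<le> w a" "sum w A = 1"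
      "\<And>x. x \<in> X' \<Longrightarrow> (\<Sum>a\<in>A. w a * f a x) \<le> v" by auto
  define h where "h x = (\<Sum>a\<in>A. w a * f a x)" for x
  have "\<exists>s. 0 \<le> s \<and> s \<le> 1 \<and> (\<forall>x\<in>X. s * (f b x - v) + (1 - s) * (h x - v) \<le> 0)"
  proof (rule two_function_alternative)
    fix x y and s :: real assume *: "x \<in> X" "y \<in> X" "0 \<le> s" "s \<le> 1"
    then obtain z where z: "z \<in> X" "\<And>a. a \<in> insert b A \<Longrightarrow> s * f a x + (1 - s) * f a y \<le> f a z"
      using insert.prems(1)[of x y s] by auto
    have "s * h x + (1 - s) * h y = (\<Sum>a\<in>A. w a * (s * f a x + (1 - s) * f a y))"
      unfolding h_def sum_distrib_left sum.distrib[symmetric]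
      by (intro sum.cong refl) (simp add: algebra_simps)
    also have "\<dots> \<le> h z" unfolding h_def using z w by (intro sum_mono mult_left_mono) auto
    finally have "s * h x + (1 - s) * h y \<le> h z" .
    then show "\<exists>z\<in>X. s * (f b x - v) + (1 - s) * (f b y - v) \<le> f b z - v
        \<and> s * (h x - v) + (1 - s) * (h y - v) \<le> h z - v"
      using z(1) z(2)[of b] by (intro bexI[of _ z]) (auto simp: algebra_simps)
  next
    fix x assume "x \<in> X"
    then show "f b x - v \<le> 0 \<or> h x - v \<le> 0"
      using w(3)[of x] by (cases "f b x > v") (auto simp: X'_def h_def)
  qed
  then obtain s where s: "0 \<le> s" "s \<le> 1"
      "\<And>x. x \<in> X \<Longrightarrow> s * (f b x - v) + (1 - s) * (h x - v) \<le> 0" by auto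
  define w' where "w' a = (if a = b then s else (1 - s) * w a)" for a
  have eq: "(\<Sum>a\<in>A. w' a * c a) = (1 - s) * (\<Sum>a\<in>A. w a * c a)" for c
    unfolding sum_distrib_left using insert.hyps by (intro sum.cong) (auto simp: w'_def)
  show ?case
  proof (intro exI[of _ w'] conjI ballI)
    show "0 \<le> w' a" if "a \<in> insert b A" for a using that s w(1) by (auto simp: w'_def)
    show "sum w' (insert b A) = 1"
      using eq[of "\<lambda>_. 1"] w(2) insert.hyps by (simp add: w'_def)
    fix x assume "x \<in> X"
    have "(\<Sum>a\<in>insert b A. w' a * f a x) = s * f b x + (1 - s) * h x"
      using eq[of "\<lambda>a. f a x"] insert.hyps by (simp add: w'_def h_def)
    then show "(\<Sum>a\<in>insert b A. w' a * f a x) \<le> v"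
      using s(3)[OF \<open>x \<in> X\<close>] by (simp add: algebra_simps)
  qed
qed

section \<open>Cutting an interval into blocks of low average\<close>

lemma sum_lessThan_add:
  fixes f :: "nat \<Rightarrow> real"
  shows "(\<Sum>u<m + n. f u) = (\<Sum>u<m. f u) + (\<Sum>u<n. f (m + u))"
  by (induction n) auto

text \<open>Greedy cutting: from the current position remove a block of length at most
  \<open>n\<close> whose average is at most \<alpha>; the last piece, of length at most
  \<open>n\<close>, costs at most \<open>n\<close>. Read contrapositively, an interval with a high
  average contains a position from which all averages of length up to \<open>n\<close> exceed
  \<alpha>.\<close>

lemma sum_le_of_short_low_blocks:
  fixes a :: "nat \<Rightarrow> real"
  assumes a1: "\<And>t. a t \<le> 1" and "0 \<le> \<alpha>"
    and short: "\<And>s. m \<le> s \<Longrightarrow> \<exists>t\<in>{1..n}. (\<Sum>u<t. a (s + u)) \<le> real t * \<alpha>"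
  shows "(\<Sum>u<N. a (m + u)) \<le> real N * \<alpha> + real n"
  using short
proof (induction N arbitrary: m rule: less_induct)
  case (less N)
  show ?case
  proof (cases "N \<le> n")
    case True
    have "(\<Sum>u<N. a (m + u)) \<le> (\<Sum>u<N. 1)" by (intro sum_mono a1)
    then show ?thesis using True \<open>0 \<le> \<alpha>\<close> by (simp add: add_increasing)
  next
    case False
    obtain t where t: "t \<in> {1..n}" "(\<Sum>u<t. a (m + u)) \<le> real t * \<alpha>" using less.prems[of m] by auto
    have "(\<Sum>u<N-t. a (m + t + u)) \<le> real (N - t) * \<alpha> + real n"
    proof (rule less.IH)
      show "\<exists>t\<in>{1..n}. (\<Sum>u<t. a (s + u)) \<le> real t * \<alpha>" if "m + t \<le> s" for s
        using that by (intro less.prems) simp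
    qed (use t False in auto)
    moreover have "(\<Sum>u<N. a (m + u)) = (\<Sum>u<t. a (m + u)) + (\<Sum>u<N-t. a (m + t + u))"
      using sum_lessThan_add[of "\<lambda>u. a (m + u)" t "N - t"] t False by (simp add: add.assoc)
    ultimately show ?thesis using t False by (simp add: of_nat_diff algebra_simps)
  qed
qed

section \<open>Flows\<close>

definition words :: "nat \<Rightarrow> 'd list set" where
  "words n = {ds. length ds = n}"

lemma finite_words [simp]: "finite (words n :: 'd::finite list set)"
  using finite_lists_length_eq[of "UNIV :: 'd set" n] by (simp add: words_def)

lemma in_words [simp]: "ds \<in> words n \<longleftrightarrow> length ds = n"
  by (simp add: words_def)

lemma words_0 [simp]: "words 0 = {[]}"
  by (auto simp: words_def)

text \<open>Histories list the most recent signal first, so the later signals \<open>e\<close> stand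
  in front of the earlier history \<open>ds\<close>.\<close>

lemma sum_words_add:
  fixes f :: "'d::finite list \<Rightarrow> real"
  shows "sum f (words (l + t)) = (\<Sum>ds\<in>words l. \<Sum>e\<in>words t. f (e @ ds))"
proof -
  have "(\<Sum>ds\<in>words l. \<Sum>e\<in>words t. f (e @ ds))
      = (\<Sum>(ds, e)\<in>words l \<times> words t. f (e @ ds))"
    by (simp add: sum.cartesian_product)
  also have "\<dots> = sum f (words (l + t))"
    by (rule sum.reindex_bij_witness[where i = "\<lambda>xs. (drop t xs, take t xs)" and j = "\<lambda>(ds, e). e @ ds"])
       auto
  finally show ?thesis by simp
qed

lemma sum_words_Suc:
  fixes f :: "'d::finite list \<Rightarrow> real"
  shows "sum f (words (Suc l)) = (\<Sum>ds\<in>words l. \<Sum>d\<in>UNIV. f (d # ds))"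
proof -
  have "(\<Sum>ds\<in>words l. \<Sum>d\<in>UNIV. f (d # ds)) = (\<Sum>(ds, d)\<in>words l \<times> UNIV. f (d # ds))"
    by (simp add: sum.cartesian_product)
  also have "\<dots> = sum f (words (Suc l))"
    by (rule sum.reindex_bij_witness[where i = "\<lambda>xs. (tl xs, hd xs)" and j = "\<lambda>(ds, d). d # ds"])
       (auto simp: length_Suc_conv)
  finally show ?thesis by simp
qed

lemma ex_pmf_eq:
  fixes f :: "'a::finite \<Rightarrow> real"
  assumes "\<And>x. 0 \<le> f x" "sum f UNIV = 1"
  shows "\<exists>p. pmf p = f"
proof -
  have "(\<integral>\<^sup>+x. ennreal (f x) \<partial>count_space UNIV) = 1"
    using assms by (simp add: nn_integral_count_space_finite sum_ennreal)
  then show ?thesis using pmf_embed_pmf[of f] assms by (intro exI[of _ "embed_pmf f"]) auto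
qed

lemma sum_pmf_UNIV [simp]: "sum (pmf (p :: 'a::finite pmf)) UNIV = 1"
  by (rule sum_pmf_eq_1) auto

text \<open>What remains of the dynamics once player 2 has no influence on them:
  \<open>Q k i k' d\<close> is the probability that the next state is \<open>k'\<close> and the next
  signal of player 2 is \<open>d\<close>.\<close>

locale controlled_flow =
  fixes g :: "'k::finite \<Rightarrow> 'i::finite \<Rightarrow> 'j::finite \<Rightarrow> real"
    and Q :: "'k \<Rightarrow> 'i \<Rightarrow> 'k \<Rightarrow> 'd::finite \<Rightarrow> real"
  assumes g_nonneg: "0 \<le> g k i j" and g_le_1: "g k i j \<le> 1"
    and Q_nonneg: "0 \<le> Q k i k' d" and Q_sum: "(\<Sum>k'\<in>UNIV. \<Sum>d\<in>UNIV. Q k i k' d) = 1"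
begin

text \<open>Here \<open>m\<close> is the unnormalised law of the state and the action of player 1 at
  one history of player 2. Its total mass is the probability of that history, so payoffs can be
  added over histories.\<close>

definition pay :: "('k \<Rightarrow> 'i \<Rightarrow> real) \<Rightarrow> 'j \<Rightarrow> real" where
  "pay m j = (\<Sum>k\<in>UNIV. \<Sum>i\<in>UNIV. m k i * g k i j)"

definition best :: "('k \<Rightarrow> 'i \<Rightarrow> real) \<Rightarrow> real" where
  "best m = Min (range (pay m))"

lemma best_le: "best m \<le> pay m j"
  unfolding best_def by (rule Min_le) auto

lemma best_attained: "\<exists>j. best m = pay m j"
proof -
  have "best m \<in> range (pay m)" unfolding best_def by (rule Min_in) auto
  then show ?thesis by auto
qed

lemma best_greatest: "(\<And>j. c \<le> pay m j) \<Longrightarrow> c \<le> best m"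
  using best_attained[of m] by auto

lemma pay_diff_le: "pay m j - pay m' j \<le> (\<Sum>k\<in>UNIV. \<Sum>i\<in>UNIV. \<bar>m k i - m' k i\<bar>)"
proof -
  have "pay m j - pay m' j = (\<Sum>k\<in>UNIV. \<Sum>i\<in>UNIV. (m k i - m' k i) * g k i j)"
    by (simp add: pay_def algebra_simps sum_subtractf)
  also have "\<dots> \<le> (\<Sum>k\<in>UNIV. \<Sum>i\<in>UNIV. \<bar>m k i - m' k i\<bar>)"
  proof (intro sum_mono)
    fix k i
    have "(m k i - m' k i) * g k i j \<le> \<bar>m k i - m' k i\<bar> * g k i j"
      by (intro mult_right_mono g_nonneg) auto
    also have "\<dots> \<le> \<bar>m k i - m' k i\<bar>" using g_le_1 by (intro mult_left_le) auto
    finally show "(m k i - m' k i) * g k i j \<le> \<bar>m k i - m' k i\<bar>" .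
  qed
  finally show ?thesis .
qed

lemma best_diff_le: "best m - best m' \<le> (\<Sum>k\<in>UNIV. \<Sum>i\<in>UNIV. \<bar>m k i - m' k i\<bar>)"
proof -
  obtain j where "best m' = pay m' j" using best_attained by blast
  then show ?thesis using best_le[of m j] pay_diff_le[of m j m'] by linarith
qed

lemma best_nonneg: "(\<And>k i. 0 \<le> m k i) \<Longrightarrow> 0 \<le> best m"
  by (intro best_greatest) (auto simp: pay_def intro!: sum_nonneg mult_nonneg_nonneg g_nonneg)

lemma best_zero [simp]: "best (\<lambda>k i. 0) = 0"
  using best_attained[of "\<lambda>k i. 0"] by (auto simp: pay_def)

lemma best_le_mass: "(\<And>k i. 0 \<le> m k i) \<Longrightarrow> best m \<le> (\<Sum>k\<in>UNIV. \<Sum>i\<in>UNIV. m k i)"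
  using best_diff_le[of m "\<lambda>k i. 0"] by simp

lemma pay_add: "pay (\<lambda>k i. s * m k i + s' * m' k i) j = s * pay m j + s' * pay m' j"
  by (simp add: pay_def sum_distrib_left sum.distrib algebra_simps)

lemma pay_scale: "pay (\<lambda>k i. s * m k i) j = s * pay m j"
  using pay_add[of s m 0 m] by simp

text \<open>A minimum of linear functions is superadditive. The resulting concavity of the payoff in
  the flow is what makes the minimax theorem applicable.\<close>

lemma best_superadd:
  assumes "0 \<le> s" "0 \<le> s'"
  shows "s * best m + s' * best m' \<le> best (\<lambda>k i. s * m k i + s' * m' k i)"
  by (rule best_greatest) (auto simp: pay_add intro!: add_mono mult_left_mono best_le assms)

lemma best_scale:
  assumes "0 \<le> s"
  shows "best (\<lambda>k i. s * m k i) = s * best m"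
proof (rule antisym)
  show "s * best m \<le> best (\<lambda>k i. s * m k i)"
    by (rule best_greatest) (auto simp: pay_scale intro!: mult_left_mono best_le assms)
  show "best (\<lambda>k i. s * m k i) \<le> s * best m"
    using best_attained[of m] best_le[of "\<lambda>k i. s * m k i"] by (auto simp: pay_scale)
qed

text \<open>\<open>M ds k i\<close> is the probability that player 2 has received the signals \<open>ds\<close> (the most recent
  one first), that the current state is \<open>k\<close> and that player 1 plays \<open>i\<close>. The flow starts at histories
  of length \<open>l\<close> from the unnormalised beliefs \<open>z\<close>; its values at shorter histories are junk.\<close>

definition flows :: "nat \<Rightarrow> ('d list \<Rightarrow> 'k \<Rightarrow> real) \<Rightarrow> ('d list \<Rightarrow> 'k \<Rightarrow> 'i \<Rightarrow> real) set" where
  "flows l z = {M. \<forall>ds. l \<le> length ds \<longrightarrow>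
      (\<forall>k i. 0 \<le> M ds k i) \<and>
      (length ds = l \<longrightarrow> (\<forall>k. (\<Sum>i\<in>UNIV. M ds k i) = z ds k)) \<and>
      (\<forall>d k'. (\<Sum>i\<in>UNIV. M (d # ds) k' i) = (\<Sum>k\<in>UNIV. \<Sum>i\<in>UNIV. M ds k i * Q k i k' d))}"

text \<open>The payoff at the stage of the histories of length \<open>t\<close> when player 2 replies optimally given his
  signals. His actions do not influence the future, so replying myopically is optimal for him.\<close>

definition R :: "('d list \<Rightarrow> 'k \<Rightarrow> 'i \<Rightarrow> real) \<Rightarrow> nat \<Rightarrow> real" where
  "R M t = (\<Sum>ds\<in>words t. best (M ds))"

definition mass :: "nat \<Rightarrow> ('d list \<Rightarrow> 'k \<Rightarrow> real) \<Rightarrow> real" where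
  "mass l z = (\<Sum>ds\<in>words l. \<Sum>k\<in>UNIV. z ds k)"

lemma flows_nonneg: "M \<in> flows l z \<Longrightarrow> l \<le> length ds \<Longrightarrow> 0 \<le> M ds k i"
  by (auto simp: flows_def)

lemma flows_start: "M \<in> flows l z \<Longrightarrow> length ds = l \<Longrightarrow> (\<Sum>i\<in>UNIV. M ds k i) = z ds k"
  by (auto simp: flows_def)

lemma flows_step: "M \<in> flows l z \<Longrightarrow> l \<le> length ds \<Longrightarrow>
    (\<Sum>i\<in>UNIV. M (d # ds) k' i) = (\<Sum>k\<in>UNIV. \<Sum>i\<in>UNIV. M ds k i * Q k i k' d)"
  by (auto simp: flows_def)

lemma sum_Q: "(\<Sum>d\<in>UNIV. \<Sum>k'\<in>UNIV. \<Sum>k\<in>UNIV. \<Sum>i\<in>UNIV. m k i * Q k i k' d) = (\<Sum>k\<in>UNIV. \<Sum>i\<in>UNIV. m k i)"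
proof -
  have "(\<Sum>d\<in>UNIV. \<Sum>k'\<in>UNIV. \<Sum>k\<in>UNIV. \<Sum>i\<in>UNIV. m k i * Q k i k' d)
     = (\<Sum>k'\<in>UNIV. \<Sum>d\<in>UNIV. \<Sum>k\<in>UNIV. \<Sum>i\<in>UNIV. m k i * Q k i k' d)" by (rule sum.swap)
  also have "\<dots> = (\<Sum>k'\<in>UNIV. \<Sum>k\<in>UNIV. \<Sum>d\<in>UNIV. \<Sum>i\<in>UNIV. m k i * Q k i k' d)"
    by (intro sum.cong refl) (rule sum.swap)
  also have "\<dots> = (\<Sum>k\<in>UNIV. \<Sum>k'\<in>UNIV. \<Sum>d\<in>UNIV. \<Sum>i\<in>UNIV. m k i * Q k i k' d)"
    by (rule sum.swap)
  also have "\<dots> = (\<Sum>k\<in>UNIV. \<Sum>k'\<in>UNIV. \<Sum>i\<in>UNIV. \<Sum>d\<in>UNIV. m k i * Q k i k' d)"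
    by (intro sum.cong refl) (rule sum.swap)
  also have "\<dots> = (\<Sum>k\<in>UNIV. \<Sum>i\<in>UNIV. \<Sum>k'\<in>UNIV. \<Sum>d\<in>UNIV. m k i * Q k i k' d)"
    by (intro sum.cong refl) (rule sum.swap)
  also have "\<dots> = (\<Sum>k\<in>UNIV. \<Sum>i\<in>UNIV. m k i)"
    by (simp add: Q_sum flip: sum_distrib_left)
  finally show ?thesis .
qed

lemma flow_mass:
  assumes M: "M \<in> flows l z"
  shows "(\<Sum>ds\<in>words (l + t). \<Sum>k\<in>UNIV. \<Sum>i\<in>UNIV. M ds k i) = mass l z"
proof (induction t)
  case 0
  show ?case by (auto simp: mass_def flows_start[OF M] intro!: sum.cong)
next
  case (Suc t)
  have "(\<Sum>ds\<in>words (l + Suc t). \<Sum>k\<in>UNIV. \<Sum>i\<in>UNIV. M ds k i)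
     = (\<Sum>ds\<in>words (l + t). \<Sum>d\<in>UNIV. \<Sum>k'\<in>UNIV. \<Sum>k\<in>UNIV. \<Sum>i\<in>UNIV. M ds k i * Q k i k' d)"
    by (auto simp: sum_words_Suc flows_step[OF M] intro!: sum.cong)
  then show ?case using Suc by (simp add: sum_Q)
qed

lemma R_nonneg: "M \<in> flows l z \<Longrightarrow> l \<le> t \<Longrightarrow> 0 \<le> R M t"
  unfolding R_def by (intro sum_nonneg best_nonneg) (auto intro: flows_nonneg)

lemma R_le_mass:
  assumes M: "M \<in> flows l z" and "l \<le> t"
  shows "R M t \<le> mass l z"
proof -
  have "R M t \<le> (\<Sum>ds\<in>words t. \<Sum>k\<in>UNIV. \<Sum>i\<in>UNIV. M ds k i)"
    unfolding R_def using assms by (intro sum_mono best_le_mass) (auto intro: flows_nonneg)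
  also have "\<dots> = mass l z" using flow_mass[OF M, of "t - l"] assms by simp
  finally show ?thesis .
qed

lemma flows_mix:
  assumes "M \<in> flows l z" "M' \<in> flows l z" "0 \<le> s" "s \<le> 1"
  shows "(\<lambda>ds k i. s * M ds k i + (1 - s) * M' ds k i) \<in> flows l z"
proof -
  have "s * a + (1 - s) * a = a" for a :: real by (simp add: algebra_simps)
  then show ?thesis using assms
    by (auto simp: flows_def sum.distrib distrib_right mult.assoc simp flip: sum_distrib_left)
qed

lemma R_mix:
  assumes "0 \<le> s" "s \<le> 1"
  shows "s * R M t + (1 - s) * R M' t \<le> R (\<lambda>ds k i. s * M ds k i + (1 - s) * M' ds k i) t"
  using assms by (auto simp: R_def sum_distrib_left simp flip: sum.distrib intro!: sum_mono best_superadd)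

lemma flows_scale: "M \<in> flows l z \<Longrightarrow> 0 \<le> s \<Longrightarrow> (\<lambda>ds k i. s * M ds k i) \<in> flows l (\<lambda>ds k. s * z ds k)"
  by (auto simp: flows_def mult.assoc simp flip: sum_distrib_left)

lemma R_scale: "0 \<le> s \<Longrightarrow> R (\<lambda>ds k i. s * M ds k i) t = s * R M t"
  by (simp add: R_def best_scale sum_distrib_left)

text \<open>Every flow is induced by a strategy \<open>\<rho>\<close> of player 1 that depends on the current state and on
  the signals of player 2 only.\<close>

primrec bel :: "('d list \<Rightarrow> 'k \<Rightarrow> 'i pmf) \<Rightarrow> nat \<Rightarrow> ('d list \<Rightarrow> 'k \<Rightarrow> real) \<Rightarrow> 'd list \<Rightarrow> 'k \<Rightarrow> real" where
  "bel \<rho> l z [] = z []"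
| "bel \<rho> l z (d # ds) = (if length ds < l then z (d # ds)
     else (\<lambda>k'. \<Sum>k\<in>UNIV. \<Sum>i\<in>UNIV. bel \<rho> l z ds k * pmf (\<rho> ds k) i * Q k i k' d))"

definition occ :: "('d list \<Rightarrow> 'k \<Rightarrow> 'i pmf) \<Rightarrow> nat \<Rightarrow> ('d list \<Rightarrow> 'k \<Rightarrow> real) \<Rightarrow> 'd list \<Rightarrow> 'k \<Rightarrow> 'i \<Rightarrow> real" where
  "occ \<rho> l z ds k i = bel \<rho> l z ds k * pmf (\<rho> ds k) i"

lemma sum_occ: "(\<Sum>i\<in>UNIV. occ \<rho> l z ds k i) = bel \<rho> l z ds k"
  by (simp add: occ_def flip: sum_distrib_left)

lemma bel_start: "length ds = l \<Longrightarrow> bel \<rho> l z ds = z ds"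
  by (cases ds) auto

lemma bel_nonneg:
  assumes "\<And>ds k. length ds = l \<Longrightarrow> 0 \<le> z ds k" "l \<le> length ds"
  shows "0 \<le> bel \<rho> l z ds k"
  using assms(2)
proof (induction ds arbitrary: k)
  case Nil
  then show ?case using assms(1)[of "[]"] by auto
next
  case (Cons d ds)
  then show ?case using assms(1)[of "d # ds"]
    by (auto intro!: sum_nonneg mult_nonneg_nonneg Q_nonneg)
qed

lemma occ_flow:
  assumes "\<And>ds k. length ds = l \<Longrightarrow> 0 \<le> z ds k"
  shows "occ \<rho> l z \<in> flows l z"
  unfolding flows_def
proof (intro CollectI allI impI conjI)
  fix ds :: "'d list" assume ds: "l \<le> length ds"
  show "0 \<le> occ \<rho> l z ds k i" for k i
    unfolding occ_def using bel_nonneg[OF assms ds] by simp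
  show "(\<Sum>i\<in>UNIV. occ \<rho> l z ds k i) = z ds k" if "length ds = l" for k
    by (simp add: sum_occ bel_start that)
  show "(\<Sum>i\<in>UNIV. occ \<rho> l z (d # ds) k' i) = (\<Sum>k\<in>UNIV. \<Sum>i\<in>UNIV. occ \<rho> l z ds k i * Q k i k' d)" for d k'
    using ds by (simp add: sum_occ) (simp add: occ_def)
qed

text \<open>Disintegration: \<rho> is \<open>M ds k\<close> divided by its mass
  \<open>b ds k\<close>. Where this mass vanishes, nonnegativity forces \<open>M ds k i = 0\<close>,
  so any law of actions fits. The flow equations then identify \<open>b\<close> with
  \<open>bel\<close> by induction on the history.\<close>

lemma flow_eq_occ:
  assumes M: "M \<in> flows l z"
  shows "\<exists>\<rho>. \<forall>ds. l \<le> length ds \<longrightarrow> M ds = occ \<rho> l z ds"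
proof -
  define b where "b ds k = (\<Sum>i\<in>UNIV. M ds k i)" for ds k
  have "\<exists>p. l \<le> length ds \<longrightarrow> (\<forall>i. M ds k i = b ds k * pmf p i)" for ds k
  proof (cases "l \<le> length ds \<and> b ds k \<noteq> 0")
    case True
    then have nn: "0 \<le> M ds k i" for i using flows_nonneg[OF M] by auto
    have "\<exists>p. pmf p = (\<lambda>i. M ds k i / b ds k)"
    proof (rule ex_pmf_eq)
      show "0 \<le> M ds k i / b ds k" for i using nn by (auto simp: b_def intro!: divide_nonneg_nonneg sum_nonneg)
      show "(\<Sum>i\<in>UNIV. M ds k i / b ds k) = 1" using True by (simp add: b_def flip: sum_divide_distrib)
    qed
    then obtain p where "pmf p = (\<lambda>i. M ds k i / b ds k)" ..
    then show ?thesis using True by (intro exI[of _ p]) auto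
  next
    case False
    have "M ds k i = 0" if "l \<le> length ds" for i
    proof -
      have "b ds k = 0" using False that by auto
      then have "\<forall>i\<in>UNIV. M ds k i = 0" unfolding b_def
        using flows_nonneg[OF M that] by (subst (asm) sum_nonneg_eq_0_iff) auto
      then show ?thesis by simp
    qed
    then show ?thesis using False by auto
  qed
  then obtain \<rho> where \<rho>: "\<And>ds k i. l \<le> length ds \<Longrightarrow> M ds k i = b ds k * pmf (\<rho> ds k) i" by metis
  have b: "b ds = bel \<rho> l z ds" if "l \<le> length ds" for ds
    using that
  proof (induction ds)
    case Nil
    then show ?case by (auto simp: b_def flows_start[OF M])
  next
    case (Cons d ds)
    show ?case
    proof (cases "length ds < l")
      case True
      then have "length (d # ds) = l" using Cons.prems by simp
      then show ?thesis using True by (auto simp: b_def flows_start[OF M])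
    next
      case False
      then have "l \<le> length ds" by simp
      then have "b (d # ds) k' = (\<Sum>k\<in>UNIV. \<Sum>i\<in>UNIV. bel \<rho> l z ds k * pmf (\<rho> ds k) i * Q k i k' d)" for k'
        unfolding b_def[of "d # ds"] flows_step[OF M \<open>l \<le> length ds\<close>] \<rho>[OF \<open>l \<le> length ds\<close>]
        by (simp add: Cons.IH)
      then show ?thesis using False by (simp add: fun_eq_iff)
    qed
  qed
  show ?thesis using \<rho> b by (intro exI[of _ \<rho>]) (auto simp: occ_def fun_eq_iff)
qed

text \<open>With the same \<rho> from two families of beliefs, the difference evolves through a
  stochastic kernel, which does not increase the l1 norm; attaching the action law preserves it
  exactly.\<close>

lemma occ_diff_le:
  "(\<Sum>ds\<in>words (l + t). \<Sum>k\<in>UNIV. \<Sum>i\<in>UNIV. \<bar>occ \<rho> l z ds k i - occ \<rho> l z' ds k i\<bar>)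
     \<le> (\<Sum>ds\<in>words l. \<Sum>k\<in>UNIV. \<bar>z ds k - z' ds k\<bar>)"
proof -
  have eq: "(\<Sum>i\<in>UNIV. \<bar>occ \<rho> l z ds k i - occ \<rho> l z' ds k i\<bar>) = \<bar>bel \<rho> l z ds k - bel \<rho> l z' ds k\<bar>" for ds k
    by (simp add: occ_def abs_mult flip: left_diff_distrib sum_distrib_left)
  have "(\<Sum>ds\<in>words (l + t). \<Sum>k\<in>UNIV. \<bar>bel \<rho> l z ds k - bel \<rho> l z' ds k\<bar>)
     \<le> (\<Sum>ds\<in>words l. \<Sum>k\<in>UNIV. \<bar>z ds k - z' ds k\<bar>)"
  proof (induction t)
    case 0
    show ?case by (simp add: bel_start)
  next
    case (Suc t)
    have "(\<Sum>ds\<in>words (l + Suc t). \<Sum>k\<in>UNIV. \<bar>bel \<rho> l z ds k - bel \<rho> l z' ds k\<bar>)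
      = (\<Sum>ds\<in>words (l + t). \<Sum>d\<in>UNIV. \<Sum>k'\<in>UNIV. \<bar>\<Sum>k\<in>UNIV. \<Sum>i\<in>UNIV. (occ \<rho> l z ds k i - occ \<rho> l z' ds k i) * Q k i k' d\<bar>)"
      by (auto simp: sum_words_Suc occ_def sum_subtractf left_diff_distrib intro!: sum.cong)
    also have "\<dots> \<le> (\<Sum>ds\<in>words (l + t). \<Sum>d\<in>UNIV. \<Sum>k'\<in>UNIV. \<Sum>k\<in>UNIV. \<Sum>i\<in>UNIV. \<bar>occ \<rho> l z ds k i - occ \<rho> l z' ds k i\<bar> * Q k i k' d)"
    proof (intro sum_mono)
      fix ds d k'
      have "\<bar>\<Sum>k\<in>UNIV. \<Sum>i\<in>UNIV. (occ \<rho> l z ds k i - occ \<rho> l z' ds k i) * Q k i k' d\<bar>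
         \<le> (\<Sum>k\<in>UNIV. \<bar>\<Sum>i\<in>UNIV. (occ \<rho> l z ds k i - occ \<rho> l z' ds k i) * Q k i k' d\<bar>)" by (rule sum_abs)
      also have "\<dots> \<le> (\<Sum>k\<in>UNIV. \<Sum>i\<in>UNIV. \<bar>(occ \<rho> l z ds k i - occ \<rho> l z' ds k i) * Q k i k' d\<bar>)"
        by (intro sum_mono sum_abs)
      finally show "\<bar>\<Sum>k\<in>UNIV. \<Sum>i\<in>UNIV. (occ \<rho> l z ds k i - occ \<rho> l z' ds k i) * Q k i k' d\<bar>
         \<le> (\<Sum>k\<in>UNIV. \<Sum>i\<in>UNIV. \<bar>occ \<rho> l z ds k i - occ \<rho> l z' ds k i\<bar> * Q k i k' d)"
        by (simp add: abs_mult Q_nonneg)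
    qed
    also have "\<dots> = (\<Sum>ds\<in>words (l + t). \<Sum>k\<in>UNIV. \<bar>bel \<rho> l z ds k - bel \<rho> l z' ds k\<bar>)"
      by (simp add: sum_Q eq)
    finally show ?case using Suc by simp
  qed
  then show ?thesis by (simp add: eq)
qed

text \<open>Flow counterpart of a weighted game starting at histories of length \<open>l\<close>.
  The date \<open>l\<close> stays explicit because states reached at different dates are compared
  later.\<close>

definition U :: "nat \<Rightarrow> (nat \<Rightarrow> real) \<Rightarrow> nat \<Rightarrow> ('d list \<Rightarrow> 'k \<Rightarrow> real) \<Rightarrow> real" where
  "U N \<theta> l z = (SUP M\<in>flows l z. \<Sum>t<N. \<theta> t * R M (l + t))"

definition nonneg_at :: "nat \<Rightarrow> ('d list \<Rightarrow> 'k \<Rightarrow> real) \<Rightarrow> bool" where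
  "nonneg_at l z \<longleftrightarrow> (\<forall>ds k. length ds = l \<longrightarrow> 0 \<le> z ds k)"

lemma flows_nonempty: "nonneg_at l z \<Longrightarrow> flows l z \<noteq> {}"
  using occ_flow[of l z] by (auto simp: nonneg_at_def)

lemma mass_nonneg: "nonneg_at l z \<Longrightarrow> 0 \<le> mass l z"
  unfolding mass_def by (intro sum_nonneg) (auto simp: nonneg_at_def)

definition subprob :: "nat \<Rightarrow> (nat \<Rightarrow> real) \<Rightarrow> bool" where
  "subprob N \<theta> \<longleftrightarrow> (\<forall>t<N. 0 \<le> \<theta> t) \<and> sum \<theta> {..<N} \<le> 1"

lemma weighted_sum_le:
  assumes "subprob N \<theta>" "\<And>t. t < N \<Longrightarrow> a t \<le> b t + c" "0 \<le> c"
  shows "(\<Sum>t<N. \<theta> t * a t) \<le> (\<Sum>t<N. \<theta> t * b t) + c"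
proof -
  have "(\<Sum>t<N. \<theta> t * a t) \<le> (\<Sum>t<N. \<theta> t * (b t + c))"
    using assms by (intro sum_mono mult_left_mono) (auto simp: subprob_def)
  also have "\<dots> = (\<Sum>t<N. \<theta> t * b t) + sum \<theta> {..<N} * c"
    by (simp add: distrib_left sum.distrib sum_distrib_right)
  also have "\<dots> \<le> (\<Sum>t<N. \<theta> t * b t) + c"
    using assms mult_right_mono[of "sum \<theta> {..<N}" 1 c] by (auto simp: subprob_def)
  finally show ?thesis .
qed

lemma payoff_bounds:
  assumes "M \<in> flows l z" "subprob N \<theta>" "nonneg_at l z"
  shows "0 \<le> (\<Sum>t<N. \<theta> t * R M (l + t))" "(\<Sum>t<N. \<theta> t * R M (l + t)) \<le> mass l z"
proof -
  show "0 \<le> (\<Sum>t<N. \<theta> t * R M (l + t))"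
    using assms R_nonneg[OF assms(1)] by (intro sum_nonneg mult_nonneg_nonneg) (auto simp: subprob_def)
  show "(\<Sum>t<N. \<theta> t * R M (l + t)) \<le> mass l z"
    using weighted_sum_le[OF assms(2), of "\<lambda>t. R M (l + t)" "\<lambda>_. 0" "mass l z"]
      R_le_mass[OF assms(1)] mass_nonneg[OF assms(3)] by simp
qed

lemma U_upper:
  assumes "M \<in> flows l z" "subprob N \<theta>" "nonneg_at l z"
  shows "(\<Sum>t<N. \<theta> t * R M (l + t)) \<le> U N \<theta> l z"
  unfolding U_def
  by (rule cSUP_upper[OF assms(1)]) (use payoff_bounds(2)[OF _ assms(2,3)] in \<open>auto intro!: bdd_aboveI2\<close>)

lemma U_least:
  assumes "nonneg_at l z" "\<And>M. M \<in> flows l z \<Longrightarrow> (\<Sum>t<N. \<theta> t * R M (l + t)) \<le> c"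
  shows "U N \<theta> l z \<le> c"
  unfolding U_def by (rule cSUP_least) (use assms flows_nonempty in auto)

lemma U_bounds:
  assumes "subprob N \<theta>" "nonneg_at l z"
  shows "0 \<le> U N \<theta> l z" "U N \<theta> l z \<le> mass l z"
proof -
  obtain M where "M \<in> flows l z" using flows_nonempty[OF assms(2)] by auto
  then show "0 \<le> U N \<theta> l z"
    using U_upper[of M l z N \<theta>] payoff_bounds(1)[of M l z N \<theta>] assms by auto
  show "U N \<theta> l z \<le> mass l z" using assms by (intro U_least payoff_bounds(2))
qed

text \<open>Imitation: the strategy inducing a flow from \<open>z\<close> is played from
  \<open>z'\<close>. Each stage payoff changes by at most the l1 distance, and weights of total at
  most 1 preserve this bound.\<close>

lemma U_lipschitz:
  assumes \<theta>: "subprob N \<theta>" and z: "nonneg_at l z" "nonneg_at l z'"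
  shows "U N \<theta> l z \<le> U N \<theta> l z' + (\<Sum>ds\<in>words l. \<Sum>k\<in>UNIV. \<bar>z ds k - z' ds k\<bar>)"
proof (rule U_least[OF z(1)])
  fix M assume M: "M \<in> flows l z"
  obtain \<rho> where \<rho>: "\<And>ds. l \<le> length ds \<Longrightarrow> M ds = occ \<rho> l z ds" using flow_eq_occ[OF M] by auto
  let ?c = "\<Sum>ds\<in>words l. \<Sum>k\<in>UNIV. \<bar>z ds k - z' ds k\<bar>"
  have "R M (l + t) \<le> R (occ \<rho> l z') (l + t) + ?c" for t
  proof -
    have "R M (l + t) - R (occ \<rho> l z') (l + t) = (\<Sum>ds\<in>words (l + t). best (occ \<rho> l z ds) - best (occ \<rho> l z' ds))"
      by (simp add: R_def \<rho> sum_subtractf)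
    also have "\<dots> \<le> (\<Sum>ds\<in>words (l + t). \<Sum>k\<in>UNIV. \<Sum>i\<in>UNIV. \<bar>occ \<rho> l z ds k i - occ \<rho> l z' ds k i\<bar>)"
      by (intro sum_mono best_diff_le)
    also have "\<dots> \<le> ?c" by (rule occ_diff_le)
    finally show ?thesis by simp
  qed
  then have "(\<Sum>t<N. \<theta> t * R M (l + t)) \<le> (\<Sum>t<N. \<theta> t * R (occ \<rho> l z') (l + t)) + ?c"
    by (intro weighted_sum_le[OF \<theta>]) (auto intro!: sum_nonneg)
  also have "(\<Sum>t<N. \<theta> t * R (occ \<rho> l z') (l + t)) \<le> U N \<theta> l z'"
    using z by (intro U_upper \<theta> occ_flow) (auto simp: nonneg_at_def)
  finally show "(\<Sum>t<N. \<theta> t * R M (l + t)) \<le> U N \<theta> l z' + ?c" by simp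
qed

lemma U_scale:
  assumes \<theta>: "subprob N \<theta>" and z: "nonneg_at l z" and s: "0 \<le> s"
  shows "U N \<theta> l (\<lambda>ds k. s * z ds k) = s * U N \<theta> l z"
proof -
  have le: "s * U N \<theta> l z \<le> U N \<theta> l (\<lambda>ds k. s * z ds k)" if z: "nonneg_at l z" and s: "0 < s" for s z
  proof -
    have "U N \<theta> l z \<le> U N \<theta> l (\<lambda>ds k. s * z ds k) / s"
    proof (rule U_least[OF z])
      fix M assume M: "M \<in> flows l z"
      have "s * (\<Sum>t<N. \<theta> t * R M (l + t)) = (\<Sum>t<N. \<theta> t * R (\<lambda>ds k i. s * M ds k i) (l + t))"
        using s by (simp add: R_scale sum_distrib_left mult.left_commute)
      also have "\<dots> \<le> U N \<theta> l (\<lambda>ds k. s * z ds k)"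
        using M z s by (intro U_upper \<theta> flows_scale) (auto simp: nonneg_at_def)
      finally show "(\<Sum>t<N. \<theta> t * R M (l + t)) \<le> U N \<theta> l (\<lambda>ds k. s * z ds k) / s"
        using s by (simp add: field_simps)
    qed
    then show ?thesis using s by (simp add: field_simps)
  qed
  show ?thesis
  proof (cases "s = 0")
    case True
    have "nonneg_at l (\<lambda>ds k. 0)" by (simp add: nonneg_at_def)
    then show ?thesis using True U_bounds[OF \<theta>, of l "\<lambda>ds k. 0"] by (simp add: mass_def)
  next
    case False
    then have s: "0 < s" using s by simp
    \<comment> \<open>The converse inequality is \<open>le\<close> for the factor
      \<open>1 / s\<close>, applied to the scaled beliefs.\<close>
    have "(1 / s) * U N \<theta> l (\<lambda>ds k. s * z ds k) \<le> U N \<theta> l (\<lambda>ds k. (1 / s) * (s * z ds k))"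
      using z s by (intro le) (auto simp: nonneg_at_def)
    then have "U N \<theta> l (\<lambda>ds k. s * z ds k) \<le> s * U N \<theta> l z" using s by (simp add: field_simps)
    then show ?thesis using le[OF z s] by simp
  qed
qed

section \<open>Decomposition along the initial histories\<close>

lemma R_append:
  "R M (l + t) = (\<Sum>ds\<in>words l. R (\<lambda>e. M (e @ ds)) t)"
  by (simp add: R_def sum_words_add)

lemma flows_suffix:
  assumes "M \<in> flows l z" "length ds = l"
  shows "(\<lambda>e. M (e @ ds)) \<in> flows 0 (\<lambda>_. z ds)"
  using assms flows_step[OF assms(1), of "_ @ ds"] by (auto simp: flows_def)

text \<open>The last \<open>l\<close> entries of \<open>xs\<close> are the initial history and the
  others are the later signals. The flow equations never link two initial histories, so each may be
  given its own flow.\<close>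

lemma flows_join:
  assumes "\<And>ds. length ds = l \<Longrightarrow> H ds \<in> flows 0 (\<lambda>_. z ds)"
  shows "(\<lambda>xs. H (drop (length xs - l) xs) (take (length xs - l) xs)) \<in> flows l z"
  unfolding flows_def
proof (intro CollectI allI impI conjI)
  fix xs :: "'d list" assume xs: "l \<le> length xs"
  let ?ds = "drop (length xs - l) xs" and ?e = "take (length xs - l) xs"
  have len: "length ?ds = l" using xs by simp
  note H = assms[OF len]
  show "0 \<le> H ?ds ?e k i" for k i using flows_nonneg[OF H] by simp
  show "(\<Sum>i\<in>UNIV. H ?ds ?e k i) = z xs k" if "length xs = l" for k
    using flows_start[OF H, of "[]"] that by simp
  fix d k'
  show "(\<Sum>i\<in>UNIV. H (drop (length (d # xs) - l) (d # xs)) (take (length (d # xs) - l) (d # xs)) k' i)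
      = (\<Sum>k\<in>UNIV. \<Sum>i\<in>UNIV. H ?ds ?e k i * Q k i k' d)"
    using flows_step[OF H, of ?e d k'] xs by (simp add: Suc_diff_le)
qed

text \<open>A flow is an independent choice of one flow per initial history, and the payoff is the
  sum of theirs. Hence the value depends on \<open>z\<close> only through the collection of beliefs
  \<open>z ds\<close>, whatever the length of the histories.\<close>

lemma U_additive:
  assumes \<theta>: "subprob N \<theta>" and z: "nonneg_at l z"
  shows "U N \<theta> l z = (\<Sum>ds\<in>words l. U N \<theta> 0 (\<lambda>_. z ds))"
proof (rule antisym)
  have z0: "nonneg_at 0 (\<lambda>_. z ds)" if "length ds = l" for ds using z that by (auto simp: nonneg_at_def)
  have swap: "(\<Sum>t<N. \<theta> t * R M (l + t)) = (\<Sum>ds\<in>words l. \<Sum>t<N. \<theta> t * R (\<lambda>e. M (e @ ds)) t)" for M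
    unfolding R_append sum_distrib_left by (rule sum.swap)
  show "U N \<theta> l z \<le> (\<Sum>ds\<in>words l. U N \<theta> 0 (\<lambda>_. z ds))"
  proof (rule U_least[OF z])
    fix M assume M: "M \<in> flows l z"
    show "(\<Sum>t<N. \<theta> t * R M (l + t)) \<le> (\<Sum>ds\<in>words l. U N \<theta> 0 (\<lambda>_. z ds))"
      unfolding swap
      using U_upper[OF flows_suffix[OF M] \<theta> z0] by (intro sum_mono) auto
  qed
  show "(\<Sum>ds\<in>words l. U N \<theta> 0 (\<lambda>_. z ds)) \<le> U N \<theta> l z"
  proof (rule field_le_epsilon)
    fix e :: real assume e: "0 < e"
    \<comment> \<open>The error is shared among the finitely many initial histories, since the
      suprema are only approached; adding 1 keeps the denominator positive.\<close>
    define e' where "e' = e / (real (card (words l :: 'd list set)) + 1)"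
    have e': "0 < e'" using e by (simp add: e'_def add_nonneg_pos)
    have "\<exists>H. H \<in> flows 0 (\<lambda>_. z ds) \<and> U N \<theta> 0 (\<lambda>_. z ds) - e' < (\<Sum>t<N. \<theta> t * R H (0 + t))"
      if "length ds = l" for ds
    proof (rule ccontr)
      assume "\<not> ?thesis"
      then have "U N \<theta> 0 (\<lambda>_. z ds) \<le> U N \<theta> 0 (\<lambda>_. z ds) - e'"
        by (intro U_least z0[OF that]) (auto simp: not_less)
      then show False using e' by simp
    qed
    then have "\<forall>ds\<in>words l. \<exists>H. H \<in> flows 0 (\<lambda>_. z ds) \<and> U N \<theta> 0 (\<lambda>_. z ds) - e' < (\<Sum>t<N. \<theta> t * R H t)"
      by simp
    then obtain H where "\<forall>ds\<in>words l. H ds \<in> flows 0 (\<lambda>_. z ds) \<and> U N \<theta> 0 (\<lambda>_. z ds) - e' < (\<Sum>t<N. \<theta> t * R (H ds) t)"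
      unfolding bchoice_iff by blast
    then have H: "\<And>ds. length ds = l \<Longrightarrow> H ds \<in> flows 0 (\<lambda>_. z ds)"
        "\<And>ds. length ds = l \<Longrightarrow> U N \<theta> 0 (\<lambda>_. z ds) - e' < (\<Sum>t<N. \<theta> t * R (H ds) t)"
      by auto
    define M where "M xs = H (drop (length xs - l) xs) (take (length xs - l) xs)" for xs
    have M: "M \<in> flows l z" unfolding M_def by (rule flows_join) (use H in auto)
    have "(\<Sum>ds\<in>words l. U N \<theta> 0 (\<lambda>_. z ds)) \<le> (\<Sum>ds\<in>words l. (\<Sum>t<N. \<theta> t * R (H ds) t) + e')"
      using H(2) by (intro sum_mono) (auto intro: less_imp_le simp: algebra_simps dest: less_diff_eq[THEN iffD1])
    also have "\<dots> = (\<Sum>t<N. \<theta> t * R M (l + t)) + real (card (words l :: 'd list set)) * e'"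
    proof -
      have "(\<lambda>e. M (e @ ds)) = H ds" if "length ds = l" for ds
        using that by (auto simp: M_def)
      then have "(\<Sum>ds\<in>words l. \<Sum>t<N. \<theta> t * R (H ds) t) = (\<Sum>ds\<in>words l. \<Sum>t<N. \<theta> t * R (\<lambda>e. M (e @ ds)) t)"
        by (intro sum.cong) auto
      then show ?thesis unfolding swap by (simp add: sum.distrib)
    qed
    also have "\<dots> \<le> U N \<theta> l z + e"
    proof (rule add_mono)
      show "(\<Sum>t<N. \<theta> t * R M (l + t)) \<le> U N \<theta> l z" by (rule U_upper[OF M \<theta> z])
      show "real (card (words l :: 'd list set)) * e' \<le> e" using e by (simp add: e'_def field_simps)
    qed
    finally show "(\<Sum>ds\<in>words l. U N \<theta> 0 (\<lambda>_. z ds)) \<le> U N \<theta> l z + e" .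
  qed
qed

end

section \<open>Total boundedness and compactness\<close>

text \<open>Tychonoff for a whole function type. It is applied once per argument of a flow, the
  history type being infinite.\<close>

lemma compact_functions_into:
  fixes K :: "'y::topological_space set"
  assumes "compact K"
  shows "compact {f :: 'x \<Rightarrow> 'y. \<forall>x. f x \<in> K}"
proof -
  have "compactin (product_topology (\<lambda>i. euclidean) UNIV) (PiE (UNIV :: 'x set) (\<lambda>_. K))"
    using assms by (subst compactin_PiE) auto
  moreover have "PiE (UNIV :: 'x set) (\<lambda>_. K) = {f. \<forall>x. f x \<in> K}"
    by (auto simp: PiE_def extensional_def)
  ultimately show ?thesis by (simp add: euclidean_product_topology)
qed

lemma abs_diff_le_of_nat_floor_eq:
  fixes x y b :: real
  assumes "0 \<le> x" "0 \<le> y" "0 < b" "nat \<lfloor>b * x\<rfloor> = nat \<lfloor>b * y\<rfloor>"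
  shows "\<bar>x - y\<bar> \<le> 1 / b"
proof -
  have "\<lfloor>b * x\<rfloor> = \<lfloor>b * y\<rfloor>" using assms by (simp add: eq_nat_nat_iff)
  then have "\<bar>b * x - b * y\<bar> \<le> 1" by linarith
  then have "b * \<bar>x - y\<bar> \<le> 1" using assms(3) by (simp add: abs_mult flip: right_diff_distrib)
  then show ?thesis using assms(3) by (simp add: field_simps)
qed

context controlled_flow
begin

definition valid :: "nat \<Rightarrow> ('d list \<Rightarrow> 'k \<Rightarrow> real) \<Rightarrow> bool" where
  "valid l z \<longleftrightarrow> nonneg_at l z \<and> mass l z \<le> 1"

text \<open>The grid cell of the belief obtained by normalising \<open>p\<close> (the cell 0 if \<open>p = 0\<close>).\<close>

definition cell :: "nat \<Rightarrow> ('k \<Rightarrow> real) \<Rightarrow> 'k \<Rightarrow> nat" where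
  "cell A p k = nat \<lfloor>real A * p k / sum p UNIV\<rfloor>"

text \<open>One fixed normalised belief per cell. For a cell that no normalised belief meets the
  choice is arbitrary, but the histogram of a valid state has weight 0 there.\<close>

definition representative :: "nat \<Rightarrow> ('k \<Rightarrow> nat) \<Rightarrow> 'k \<Rightarrow> real" where
  "representative A c = (SOME p. (\<forall>k. 0 \<le> p k) \<and> sum p UNIV = 1 \<and> cell A p = c)"

text \<open>The law of the normalised belief, weighted by the mass of the histories and rounded to
  cells. Neither \<open>l\<close> nor the histories can be read off from it, so it can match states
  at different dates.\<close>

definition histogram :: "nat \<Rightarrow> nat \<Rightarrow> ('d list \<Rightarrow> 'k \<Rightarrow> real) \<Rightarrow> ('k \<Rightarrow> nat) \<Rightarrow> real" where
  "histogram A l z c = (\<Sum>ds | ds \<in> words l \<and> cell A (z ds) = c. sum (z ds) UNIV)"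

definition cells :: "nat \<Rightarrow> ('k \<Rightarrow> nat) set" where
  "cells A = {c. \<forall>k. c k \<le> A}"

lemma finite_cells: "finite (cells A)"
proof -
  have "cells A = PiE UNIV (\<lambda>_. {..A})" by (auto simp: cells_def PiE_def extensional_def)
  then show ?thesis by (simp add: finite_PiE)
qed

lemma cell_in_cells:
  assumes "\<And>k. 0 \<le> p k"
  shows "cell A p \<in> cells A"
  unfolding cells_def
proof (intro CollectI allI)
  fix k
  have "p k \<le> sum p UNIV" using assms by (intro member_le_sum) auto
  then have "p k / sum p UNIV \<le> 1" using sum_nonneg[of UNIV p] assms by (auto simp: divide_le_eq_1)
  then have "real A * (p k / sum p UNIV) \<le> real A" by (intro mult_left_le) auto
  then show "cell A p k \<le> A" unfolding cell_def by (simp add: floor_le_iff nat_le_iff)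
qed

lemma dist_le_of_same_cell:
  assumes "\<And>k. 0 \<le> p k" "\<And>k. 0 \<le> p' k" "sum p UNIV = 1" "sum p' UNIV = 1" "cell A p = cell A p'" "0 < A"
  shows "(\<Sum>k\<in>UNIV. \<bar>p k - p' k\<bar>) \<le> real CARD('k) / real A"
proof -
  have "\<bar>p k - p' k\<bar> \<le> 1 / real A" for k
  proof (rule abs_diff_le_of_nat_floor_eq)
    have "cell A p k = cell A p' k" using assms(5) by simp
    then show "nat \<lfloor>real A * p k\<rfloor> = nat \<lfloor>real A * p' k\<rfloor>" by (simp add: cell_def assms(3,4))
  qed (use assms in auto)
  then have "(\<Sum>k\<in>UNIV. \<bar>p k - p' k\<bar>) \<le> (\<Sum>k\<in>(UNIV :: 'k set). 1 / real A)" by (intro sum_mono)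
  then show ?thesis by simp
qed

text \<open>By homogeneity the belief may be normalised. Two normalised beliefs in one cell differ
  by at most \<open>1 / A\<close> in each of the \<open>CARD('k)\<close> coordinates, and the value
  is 1-Lipschitz.\<close>

lemma U_near_representative:
  assumes \<theta>: "subprob N \<theta>" and p: "\<And>k. 0 \<le> p k" and A: "0 < A"
  shows "\<bar>U N \<theta> 0 (\<lambda>_. p) - sum p UNIV * U N \<theta> 0 (\<lambda>_. representative A (cell A p))\<bar>
     \<le> sum p UNIV * (real CARD('k) / real A)"
proof -
  define s where "s = sum p UNIV"
  have s0: "0 \<le> s" using p by (simp add: s_def sum_nonneg)
  show ?thesis
  proof (cases "s = 0")
    case True
    have "nonneg_at 0 (\<lambda>_. p)" using p by (simp add: nonneg_at_def)
    from U_bounds[OF \<theta> this] show ?thesis using True by (simp add: mass_def s_def)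
  next
    case False
    define q where "q k = p k / s" for k
    define r where "r = representative A (cell A p)"
    have q: "0 \<le> q k" "p = (\<lambda>k. s * q k)" for k using p s0 False by (auto simp: q_def)
    have q1: "sum q UNIV = 1" using False by (simp add: q_def s_def flip: sum_divide_distrib)
    have cq: "cell A q = cell A p" by (simp add: cell_def fun_eq_iff q1) (simp add: q_def s_def)
    have "(\<forall>k. 0 \<le> r k) \<and> sum r UNIV = 1 \<and> cell A r = cell A p"
      unfolding r_def representative_def by (rule someI[of _ q]) (use q q1 cq in auto)
    then have r: "\<And>k. 0 \<le> r k" "sum r UNIV = 1" "cell A q = cell A r" using cq by auto
    have d: "(\<Sum>k\<in>UNIV. \<bar>q k - r k\<bar>) \<le> real CARD('k) / real A"
      by (rule dist_le_of_same_cell) (use q r q1 A in auto)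
    have d': "(\<Sum>k\<in>UNIV. \<bar>r k - q k\<bar>) = (\<Sum>k\<in>UNIV. \<bar>q k - r k\<bar>)" by (simp add: abs_minus_commute)
    have nn: "nonneg_at 0 (\<lambda>_. q)" "nonneg_at 0 (\<lambda>_. r)" using q r by (auto simp: nonneg_at_def)
    have "\<bar>U N \<theta> 0 (\<lambda>_. q) - U N \<theta> 0 (\<lambda>_. r)\<bar> \<le> real CARD('k) / real A"
      using U_lipschitz[OF \<theta> nn] U_lipschitz[OF \<theta> nn(2,1)] d d' by simp
    moreover have "U N \<theta> 0 (\<lambda>_. p) = s * U N \<theta> 0 (\<lambda>_. q)"
      by (subst q(2)) (rule U_scale[OF \<theta> nn(1) s0])
    ultimately show ?thesis using s0
      by (simp add: abs_mult mult_left_mono flip: s_def r_def right_diff_distrib times_divide_eq_right)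
  qed
qed

lemma U_near_histogram:
  assumes \<theta>: "subprob N \<theta>" and z: "valid l z" and A: "0 < A"
  shows "\<bar>U N \<theta> l z - (\<Sum>c\<in>cells A. histogram A l z c * U N \<theta> 0 (\<lambda>_. representative A c))\<bar>
     \<le> real CARD('k) / real A"
proof -
  let ?u = "\<lambda>c. U N \<theta> 0 (\<lambda>_. representative A c)"
  have z0: "nonneg_at l z" and zm: "mass l z \<le> 1" and zn: "\<And>ds k. length ds = l \<Longrightarrow> 0 \<le> z ds k"
    using z by (auto simp: valid_def nonneg_at_def)
  have "(\<Sum>c\<in>cells A. histogram A l z c * ?u c)
      = (\<Sum>c\<in>cells A. \<Sum>ds | ds \<in> words l \<and> cell A (z ds) = c. sum (z ds) UNIV * ?u (cell A (z ds)))"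
    by (auto simp: histogram_def sum_distrib_right intro!: sum.cong)
  also have "\<dots> = (\<Sum>ds\<in>words l. sum (z ds) UNIV * ?u (cell A (z ds)))"
    by (rule sum.group) (use zn finite_cells cell_in_cells in auto)
  finally have eq: "U N \<theta> l z - (\<Sum>c\<in>cells A. histogram A l z c * ?u c)
     = (\<Sum>ds\<in>words l. U N \<theta> 0 (\<lambda>_. z ds) - sum (z ds) UNIV * ?u (cell A (z ds)))"
    by (simp add: U_additive[OF \<theta> z0] sum_subtractf)
  have "\<bar>U N \<theta> l z - (\<Sum>c\<in>cells A. histogram A l z c * ?u c)\<bar> \<le> (\<Sum>ds\<in>words l. \<bar>U N \<theta> 0 (\<lambda>_. z ds) - sum (z ds) UNIV * ?u (cell A (z ds))\<bar>)"
    unfolding eq by (rule sum_abs)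
  also have "\<dots> \<le> (\<Sum>ds\<in>words l. sum (z ds) UNIV * (real CARD('k) / real A))"
    by (rule sum_mono, rule U_near_representative[OF \<theta> _ A]) (simp add: zn)
  also have "\<dots> = mass l z * (real CARD('k) / real A)" unfolding mass_def by (rule sum_distrib_right[symmetric])
  also have "\<dots> \<le> real CARD('k) / real A" using zm mult_right_mono[OF zm, of "real CARD('k) / real A"] by simp
  finally show ?thesis .
qed

lemma histogram_bounds:
  assumes z: "valid l z"
  shows "0 \<le> histogram A l z c" "histogram A l z c \<le> 1"
proof -
  have zn: "\<And>ds k. length ds = l \<Longrightarrow> 0 \<le> z ds k" using z by (auto simp: valid_def nonneg_at_def)
  show "0 \<le> histogram A l z c" unfolding histogram_def using zn by (intro sum_nonneg) auto
  have "histogram A l z c \<le> mass l z" unfolding histogram_def mass_def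
    using zn by (intro sum_mono2) (auto intro!: sum_nonneg)
  then show "histogram A l z c \<le> 1" using z by (auto simp: valid_def)
qed

text \<open>Total boundedness of the state space for the pseudometric given by all the values: finitely
  many quantised histograms of beliefs determine all the values up to \<open>\<epsilon>\<close>.\<close>

lemma finite_code:
  assumes "0 < \<epsilon>"
  shows "\<exists>(code :: nat \<Rightarrow> ('d list \<Rightarrow> 'k \<Rightarrow> real) \<Rightarrow> ('k \<Rightarrow> nat) \<Rightarrow> nat) S. finite S \<and>
     (\<forall>l z. valid l z \<longrightarrow> code l z \<in> S) \<and>
     (\<forall>l z l' z' N \<theta>. valid l z \<longrightarrow> valid l' z' \<longrightarrow> code l z = code l' z' \<longrightarrow> subprob N \<theta> \<longrightarrow>
        U N \<theta> l z \<le> U N \<theta> l' z' + \<epsilon>)"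
proof -
  \<comment> \<open>The error is split in three: \<epsilon>/3 for replacing each of the two values
    by its histogram sum on the grid of step \<open>1 / A\<close>, and \<epsilon>/3 for rounding the
    weights of all the cells with step \<open>1 / B\<close>.\<close>
  obtain A :: nat where A: "real CARD('k) * 3 / \<epsilon> < real A" using reals_Archimedean2 by blast
  have A0: "0 < A" using A assms by (cases A) (auto simp: field_simps zero_less_mult_iff)
  have A1: "real CARD('k) / real A \<le> \<epsilon> / 3" using A A0 assms by (simp add: field_simps)
  obtain B :: nat where B: "real (card (cells A)) * 3 / \<epsilon> < real B" using reals_Archimedean2 by blast
  have B0: "0 < B" using B assms by (cases B) (auto simp: field_simps zero_less_mult_iff)
  have B1: "real (card (cells A)) / real B \<le> \<epsilon> / 3" using B B0 assms by (simp add: field_simps)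
  define code where "code l z = restrict (\<lambda>c. nat \<lfloor>real B * histogram A l z c\<rfloor>) (cells A)" for l z
  show ?thesis
  proof (intro exI[of _ code] exI[of _ "PiE (cells A) (\<lambda>_. {..B})"] conjI allI impI)
    show "finite (PiE (cells A) (\<lambda>_. {..B}))" by (intro finite_PiE finite_cells) auto
    show "code l z \<in> PiE (cells A) (\<lambda>_. {..B})" if "valid l z" for l z
    proof -
      have "real B * histogram A l z c < real B + 1" for c
        using histogram_bounds[OF that] mult_left_le[of "histogram A l z c" "real B"] by (simp add: less_add_one le_less_trans)
      then show ?thesis by (auto simp: code_def floor_le_iff nat_le_iff)
    qed
    fix l z l' z' N \<theta>
    assume v: "valid l z" "valid l' z'" and eq: "code l z = code l' z'" and \<theta>: "subprob N \<theta>"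
    let ?u = "\<lambda>c. U N \<theta> 0 (\<lambda>_. representative A c)"
    have h: "(histogram A l z c - histogram A l' z' c) * ?u c \<le> 1 / real B" if c: "c \<in> cells A" for c
    proof (cases "\<exists>p. (\<forall>k. 0 \<le> p k) \<and> sum p UNIV = 1 \<and> cell A p = c")
      case True
      then have "(\<forall>k. 0 \<le> representative A c k) \<and> sum (representative A c) UNIV = 1 \<and> cell A (representative A c) = c"
        unfolding representative_def by (rule someI_ex)
      then have nn: "nonneg_at 0 (\<lambda>_. representative A c)" and m: "mass 0 (\<lambda>_. representative A c) = 1"
        by (auto simp: nonneg_at_def mass_def)
      have "\<bar>histogram A l z c - histogram A l' z' c\<bar> \<le> 1 / real B"
        using fun_cong[OF eq, of c] c B0 histogram_bounds v
        by (intro abs_diff_le_of_nat_floor_eq) (auto simp: code_def)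
      then have "\<bar>histogram A l z c - histogram A l' z' c\<bar> * \<bar>?u c\<bar> \<le> 1 / real B * 1"
        using U_bounds[OF \<theta> nn] m by (intro mult_mono) auto
      then show ?thesis using abs_ge_self[of "(histogram A l z c - histogram A l' z' c) * ?u c"]
        by (simp add: abs_mult)
    next
      case False
      \<comment> \<open>The representative of this cell is unspecified and its value cannot be
        bounded. Only null histories can fall into the cell, since the normalisation of any other
        belief would meet it.\<close>
      have "histogram A l z c = 0" if "valid l z" for l z
        unfolding histogram_def
      proof (rule sum.neutral, safe)
        fix ds assume ds: "ds \<in> words l" "c = cell A (z ds)"
        have zn: "0 \<le> z ds k" for k using ds that by (auto simp: valid_def nonneg_at_def)
        show "sum (z ds) UNIV = 0"
        proof (rule ccontr)
          assume n: "sum (z ds) UNIV \<noteq> 0"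
          define p where "p k = z ds k / sum (z ds) UNIV" for k
          have p1: "sum p UNIV = 1" using n by (simp add: p_def flip: sum_divide_distrib)
          have "cell A p = c" unfolding ds(2) by (simp add: cell_def fun_eq_iff p1) (simp add: p_def)
          moreover have "0 \<le> p k" for k using zn by (auto simp: p_def intro!: divide_nonneg_nonneg sum_nonneg)
          ultimately show False using False p1 by auto
        qed
      qed
      then show ?thesis using v by simp
    qed
    have "(\<Sum>c\<in>cells A. histogram A l z c * ?u c) - (\<Sum>c\<in>cells A. histogram A l' z' c * ?u c)
        = (\<Sum>c\<in>cells A. (histogram A l z c - histogram A l' z' c) * ?u c)"
      by (simp add: sum_subtractf left_diff_distrib)
    also have "\<dots> \<le> (\<Sum>c\<in>cells A. 1 / real B)" by (intro sum_mono h)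
    also have "\<dots> \<le> \<epsilon> / 3" using B1 by simp
    finally show "U N \<theta> l z \<le> U N \<theta> l' z' + \<epsilon>"
      using U_near_histogram[OF \<theta> v(1) A0] U_near_histogram[OF \<theta> v(2) A0] A1 by linarith
  qed
qed

section \<open>Restriction, concatenation and limits of flows\<close>

lemma flows_le_mass:
  assumes M: "M \<in> flows l z" and ds: "l \<le> length ds"
  shows "M ds k i \<le> mass l z"
proof -
  have "M ds k i \<le> (\<Sum>i\<in>UNIV. M ds k i)"
    using flows_nonneg[OF M ds] by (rule member_le_sum[OF UNIV_I]) auto
  also have "\<dots> \<le> (\<Sum>k\<in>UNIV. \<Sum>i\<in>UNIV. M ds k i)"
    using flows_nonneg[OF M ds] by (intro member_le_sum[where f = "\<lambda>k. \<Sum>i\<in>UNIV. M ds k i"] sum_nonneg) auto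
  also have "\<dots> \<le> (\<Sum>ds\<in>words (length ds). \<Sum>k\<in>UNIV. \<Sum>i\<in>UNIV. M ds k i)"
    using flows_nonneg[OF M] ds
    by (intro member_le_sum[where f = "\<lambda>ds. \<Sum>k\<in>UNIV. \<Sum>i\<in>UNIV. M ds k i"] sum_nonneg) auto
  also have "\<dots> = mass l z" using flow_mass[OF M, of "length ds - l"] ds by simp
  finally show ?thesis .
qed

lemma flows_restrict:
  assumes "M \<in> flows l z" "l \<le> l'"
  shows "M \<in> flows l' (\<lambda>ds k. \<Sum>i\<in>UNIV. M ds k i)"
  using assms by (auto simp: flows_def)

lemma valid_restrict:
  assumes "M \<in> flows l z" "l \<le> l'" "valid l z"
  shows "valid l' (\<lambda>ds k. \<Sum>i\<in>UNIV. M ds k i)"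
  using assms flow_mass[OF assms(1), of "l' - l"] flows_nonneg[OF assms(1)]
  by (auto simp: valid_def nonneg_at_def mass_def intro!: sum_nonneg)

text \<open>The equation for \<open>d # ds\<close> constrains only the sum over the actions at
  \<open>d # ds\<close>. A flow may therefore be replaced from length \<open>l'\<close> on by any
  flow with the same state masses there.\<close>

lemma flows_concat:
  assumes M: "M \<in> flows l z" and l: "l \<le> l'" and M': "M' \<in> flows l' (\<lambda>ds k. \<Sum>i\<in>UNIV. M ds k i)"
  shows "(\<lambda>ds. if length ds < l' then M ds else M' ds) \<in> flows l z"
  unfolding flows_def
proof (intro CollectI allI impI conjI)
  fix ds :: "'d list" assume ds: "l \<le> length ds"
  show "0 \<le> (if length ds < l' then M ds else M' ds) k i" for k i
    using flows_nonneg[OF M ds] flows_nonneg[OF M', of ds] by auto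
  show "(\<Sum>i\<in>UNIV. (if length ds < l' then M ds else M' ds) k i) = z ds k" if "length ds = l" for k
    using flows_start[OF M that] flows_start[OF M', of ds] that l by auto
  show "(\<Sum>i\<in>UNIV. (if length (d # ds) < l' then M (d # ds) else M' (d # ds)) k' i) =
      (\<Sum>k\<in>UNIV. \<Sum>i\<in>UNIV. (if length ds < l' then M ds else M' ds) k i * Q k i k' d)" for d k'
    using flows_step[OF M ds, of d k'] flows_step[OF M', of ds d k'] flows_start[OF M', of "d # ds" k']
    by (cases "length (d # ds) < l'"; cases "length ds < l'") auto
qed

lemma R_le_pay: "R M t \<le> (\<Sum>ds\<in>words t. pay (M ds) (\<eta> ds))"
  unfolding R_def by (intro sum_mono best_le)

text \<open>A history determines its stage, so one map \<eta> is a best reply at all stages at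
  once.\<close>

lemma R_attained: "\<exists>\<eta>. \<forall>t. R M t = (\<Sum>ds\<in>words t. pay (M ds) (\<eta> ds))"
proof -
  have "\<forall>ds. \<exists>j. best (M ds) = pay (M ds) j" using best_attained by blast
  then obtain \<eta> where "\<forall>ds. best (M ds) = pay (M ds) (\<eta> ds)" unfolding choice_iff by blast
  then show ?thesis by (auto simp: R_def)
qed

definition A :: "('d list \<Rightarrow> 'k \<Rightarrow> 'i \<Rightarrow> real) \<Rightarrow> nat \<Rightarrow> nat \<Rightarrow> real" where
  "A M l t = (\<Sum>s<t. R M (l + s)) / real t"

lemma A_bounds:
  assumes M: "M \<in> flows l0 z" and z: "valid l0 z" and l: "l0 \<le> l"
  shows "0 \<le> A M l t" "A M l t \<le> 1"
proof -
  have R: "0 \<le> R M (l + s)" "R M (l + s) \<le> 1" for s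
    using R_nonneg[OF M, of "l + s"] R_le_mass[OF M, of "l + s"] z l by (auto simp: valid_def)
  then show "0 \<le> A M l t" unfolding A_def by (intro divide_nonneg_nonneg sum_nonneg) auto
  have "(\<Sum>s<t. R M (l + s)) \<le> (\<Sum>s<t. 1)" using R by (intro sum_mono)
  then show "A M l t \<le> 1" unfolding A_def by (cases "t = 0") auto
qed

lemma closed_flows: "closed (flows l z)"
proof -
  have c: "continuous_on UNIV (\<lambda>M :: 'd list \<Rightarrow> 'k \<Rightarrow> 'i \<Rightarrow> real. M ds k i)" for ds k i
    by (rule continuous_on_product_then_coordinatewise[OF continuous_on_product_then_coordinatewise
          [OF continuous_on_product_coordinates]])
  have imp: "closed {M. P \<longrightarrow> Q M}" if "P \<Longrightarrow> closed {M. Q M}" for P and Q :: "('d list \<Rightarrow> 'k \<Rightarrow> 'i \<Rightarrow> real) \<Rightarrow> bool"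
    using that by (cases P) auto
  show ?thesis unfolding flows_def
    by (intro closed_Collect_all imp closed_Collect_conj closed_Collect_le closed_Collect_eq
        continuous_on_sum continuous_on_mult continuous_on_const c)
qed

text \<open>The average is a minimum over reply maps \<eta>, so the set is an intersection over
  \<eta> of sets given by weak linear inequalities, each in finitely many coordinates of the
  flow.\<close>

lemma closed_average_ge: "closed {M. c \<le> A M l t}"
proof -
  have c: "continuous_on UNIV (\<lambda>M :: 'd list \<Rightarrow> 'k \<Rightarrow> 'i \<Rightarrow> real. M ds k i)" for ds k i
    by (rule continuous_on_product_then_coordinatewise[OF continuous_on_product_then_coordinatewise
          [OF continuous_on_product_coordinates]])
  have "c \<le> A M l t \<longleftrightarrow> (\<forall>\<eta>. c \<le> (\<Sum>s<t. \<Sum>ds\<in>words (l + s). pay (M ds) (\<eta> ds)) / real t)" for M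
  proof
    show "\<forall>\<eta>. c \<le> (\<Sum>s<t. \<Sum>ds\<in>words (l + s). pay (M ds) (\<eta> ds)) / real t" if "c \<le> A M l t"
    proof
      fix \<eta>
      have "A M l t \<le> (\<Sum>s<t. \<Sum>ds\<in>words (l + s). pay (M ds) (\<eta> ds)) / real t"
        unfolding A_def by (intro divide_right_mono sum_mono R_le_pay) auto
      then show "c \<le> (\<Sum>s<t. \<Sum>ds\<in>words (l + s). pay (M ds) (\<eta> ds)) / real t" using that by simp
    qed
    show "c \<le> A M l t" if "\<forall>\<eta>. c \<le> (\<Sum>s<t. \<Sum>ds\<in>words (l + s). pay (M ds) (\<eta> ds)) / real t"
    proof -
      obtain \<eta> where "\<forall>t. R M t = (\<Sum>ds\<in>words t. pay (M ds) (\<eta> ds))" using R_attained by blast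
      then show ?thesis using spec[OF that, of \<eta>] by (simp add: A_def)
    qed
  qed
  then have "{M. c \<le> A M l t} = {M. \<forall>\<eta>. c \<le> (\<Sum>s<t. \<Sum>ds\<in>words (l + s). pay (M ds) (\<eta> ds)) / real t}"
    by simp
  also have "closed \<dots>"
    unfolding pay_def divide_inverse
    by (intro closed_Collect_all closed_Collect_le continuous_on_sum continuous_on_mult continuous_on_const c)
  finally show ?thesis .
qed

lemma compact_box: "compact {M :: 'd list \<Rightarrow> 'k \<Rightarrow> 'i \<Rightarrow> real. \<forall>ds k i. M ds k i \<in> {0..1}}"
proof -
  have "compact {M :: 'd list \<Rightarrow> 'k \<Rightarrow> 'i \<Rightarrow> real.
      \<forall>ds. M ds \<in> {m. \<forall>k. m k \<in> {r. \<forall>i. r i \<in> {0..1}}}}"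
    by (intro compact_functions_into compact_Icc)
  then show ?thesis by simp
qed

text \<open>Compactness of the set of flows replaces a strategy for each horizon by a single one.\<close>

lemma flow_with_all_averages:
  assumes z: "valid l z" and n: "\<And>n. \<exists>M\<in>flows l z. \<forall>t\<in>{1..n}. c \<le> A M l t"
  shows "\<exists>M\<in>flows l z. \<forall>t\<ge>1. c \<le> A M l t"
proof -
  let ?box = "{M :: 'd list \<Rightarrow> 'k \<Rightarrow> 'i \<Rightarrow> real. \<forall>ds k i. M ds k i \<in> {0..1}}"
  define F where "F t = flows l z \<inter> {M. c \<le> A M l t}" for t
  have "?box \<inter> (\<Inter>t\<in>{1..}. F t) \<noteq> {}"
  proof (rule compact_imp_fip_image[OF compact_box])
    show "closed (F t)" for t unfolding F_def by (intro closed_Int closed_flows closed_average_ge)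
    fix I' :: "nat set" assume I': "finite I'" "I' \<subseteq> {1..}"
    obtain M where M: "M \<in> flows l z" "\<And>t. t \<in> {1..Max (insert 0 I')} \<Longrightarrow> c \<le> A M l t" using n by blast
    \<comment> \<open>Entries at histories shorter than \<open>l\<close> are unconstrained in a
      flow; they are set to 0 so that the flow lies in the compact box.\<close>
    define M' where "M' ds = (if length ds < l then (\<lambda>_ _. 0) else M ds)" for ds
    have M'f: "M' \<in> flows l z" using M(1) by (auto simp: flows_def M'_def)
    have "R M' (l + s) = R M (l + s)" for s by (auto simp: R_def M'_def intro!: sum.cong)
    then have AA: "A M' l t = A M l t" for t by (simp add: A_def)
    have "M' ds k i \<le> 1" for ds k i
      using flows_le_mass[OF M(1), of ds k i] z by (auto simp: M'_def valid_def)
    moreover have "0 \<le> M' ds k i" for ds k i using flows_nonneg[OF M(1)] by (auto simp: M'_def)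
    ultimately have "M' \<in> ?box" by auto
    moreover have "M' \<in> F t" if "t \<in> I'" for t
      using that I' M'f M(2)[of t] AA by (auto simp: F_def)
    ultimately show "?box \<inter> (\<Inter>t\<in>I'. F t) \<noteq> {}" by blast
  qed
  then show ?thesis unfolding F_def by auto
qed

end

section \<open>Uniform value of the flow problem\<close>

text \<open>Chain of inequalities: \<open>vs\<close> is at most sup inf \<open>w\<close>, which is
  at most sup inf \<open>v\<close>, at most inf sup \<open>v\<close>, at most \<open>vs\<close>. The
  first link is \<open>low\<close>; the last is \<open>up\<close> as \<open>N\<close> grows with
  \<open>n\<close> fixed.\<close>

lemma sup_inf_equalities:
  fixes v w :: "nat \<Rightarrow> nat \<Rightarrow> real"
  assumes w0: "\<And>m n. 1 \<le> n \<Longrightarrow> 0 \<le> w m n"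
    and wv: "\<And>m n. 1 \<le> n \<Longrightarrow> w m n \<le> v m n"
    and v1: "\<And>m n. 1 \<le> n \<Longrightarrow> v m n \<le> 1"
    and vs: "vs = (INF n\<in>{1..}. SUP m. w m n)"
    and up: "\<And>m n N. 1 \<le> n \<Longrightarrow> 1 \<le> N \<Longrightarrow> v m N \<le> (SUP m. w m n) + real n / real N"
    and low: "\<And>e. 0 < e \<Longrightarrow> \<exists>m. \<forall>n\<ge>1. vs - e \<le> w m n"
  shows "vs = (INF n\<in>{1..}. SUP m. v m n)" "vs = (SUP m. INF n\<in>{1..}. v m n)"
    "vs = (SUP m. INF n\<in>{1..}. w m n)"
proof -
  have bv: "bdd_above (range (\<lambda>m. v m n))" "bdd_above (range (\<lambda>m. w m n))" if "1 \<le> n" for n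
    using v1[OF that] wv[OF that] order_trans[OF wv[OF that] v1[OF that]] by (auto intro!: bdd_aboveI2)
  have bn: "bdd_below ((\<lambda>n. v m n) ` {1..})" "bdd_below ((\<lambda>n. w m n) ` {1..})" for m
    using w0 wv order_trans[OF w0 wv] by (auto intro!: bdd_belowI2)
  have INF_le1: "(INF n\<in>{1..}. f m n) \<le> 1" if "\<And>n. 1 \<le> n \<Longrightarrow> f m n \<le> 1" "bdd_below ((\<lambda>n. f m n) ` {1..})"
    for f :: "nat \<Rightarrow> nat \<Rightarrow> real" and m
    using cINF_lower[OF that(2), of 1] that(1)[of 1] by simp
  have bs: "bdd_above (range (\<lambda>m. INF n\<in>{1..}. v m n))" "bdd_above (range (\<lambda>m. INF n\<in>{1..}. w m n))"
    using INF_le1[OF v1 bn(1)] INF_le1[OF order_trans[OF wv v1] bn(2)] by (auto intro!: bdd_aboveI2)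
  have bi: "bdd_below ((\<lambda>n. SUP m. v m n) ` {1..})" "bdd_below ((\<lambda>n. SUP m. w m n) ` {1..})"
  proof -
    have "0 \<le> (SUP m. w m n)" "0 \<le> (SUP m. v m n)" if "1 \<le> n" for n
      using cSUP_upper2[OF bv(2)[OF that], of 0 0] cSUP_upper2[OF bv(1)[OF that], of 0 0] w0[OF that] wv[OF that]
        order_trans[OF w0[OF that] wv[OF that]] by auto
    then show "bdd_below ((\<lambda>n. SUP m. v m n) ` {1..})" "bdd_below ((\<lambda>n. SUP m. w m n) ` {1..})"
      by (auto intro!: bdd_belowI2)
  qed
  have a: "vs \<le> (SUP m. INF n\<in>{1..}. w m n)"
  proof (rule field_le_epsilon)
    fix e :: real assume "0 < e"
    then obtain m where m: "\<And>n. 1 \<le> n \<Longrightarrow> vs - e \<le> w m n" using low by blast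
    have "vs - e \<le> (INF n\<in>{1..}. w m n)" by (rule cINF_greatest) (use m in auto)
    also have "\<dots> \<le> (SUP m. INF n\<in>{1..}. w m n)" by (rule cSUP_upper[OF UNIV_I bs(2)])
    finally show "vs \<le> (SUP m. INF n\<in>{1..}. w m n) + e" by simp
  qed
  have b: "(SUP m. INF n\<in>{1..}. w m n) \<le> (SUP m. INF n\<in>{1..}. v m n)"
  proof (rule cSUP_mono[OF _ bs(1)])
    show "\<exists>m'\<in>UNIV. (INF n\<in>{1..}. w m n) \<le> (INF n\<in>{1..}. v m' n)" for m
      by (rule bexI[of _ m], rule cINF_mono[OF _ bn(2)]) (use wv in auto)
  qed auto
  have c: "(SUP m. INF n\<in>{1..}. v m n) \<le> (INF n\<in>{1..}. SUP m. v m n)"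
  proof (rule cSUP_least, simp, rule cINF_greatest, simp)
    fix m n :: nat assume n: "n \<in> {1..}"
    have "(INF n\<in>{1..}. v m n) \<le> v m n" by (rule cINF_lower[OF bn(1) n])
    also have "\<dots> \<le> (SUP m. v m n)" using n by (intro cSUP_upper bv) auto
    finally show "(INF n\<in>{1..}. v m n) \<le> (SUP m. v m n)" .
  qed
  have d: "(INF n\<in>{1..}. SUP m. v m n) \<le> vs"
    unfolding vs
  proof (rule cINF_greatest, simp)
    fix n :: nat assume n: "n \<in> {1..}"
    have "(INF n\<in>{1..}. SUP m. v m n) \<le> (SUP m. w m n) + real n / real (Suc N)" for N
    proof -
      have "(INF n\<in>{1..}. SUP m. v m n) \<le> (SUP m. v m (Suc N))" by (rule cINF_lower[OF bi(1)]) simp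
      also have "\<dots> \<le> (SUP m. w m n) + real n / real (Suc N)"
        using n by (intro cSUP_least up) auto
      finally show ?thesis .
    qed
    moreover have "(\<lambda>N. (SUP m. w m n) + real n / real (Suc N)) \<longlonglongrightarrow> (SUP m. w m n) + 0"
      by (intro tendsto_add tendsto_const LIMSEQ_Suc[OF lim_const_over_n])
    ultimately show "(INF n\<in>{1..}. SUP m. v m n) \<le> (SUP m. w m n)"
      using LIMSEQ_le_const[of _ _ "INF n\<in>{1..}. SUP m. v m n"] by auto
  qed
  show "vs = (INF n\<in>{1..}. SUP m. v m n)" "vs = (SUP m. INF n\<in>{1..}. v m n)"
    "vs = (SUP m. INF n\<in>{1..}. w m n)" using a b c d by linarith+
qed

text \<open>Drawing a length \<open>t\<close> from \<theta> and then a uniform stage among the first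
  \<open>t\<close> gives stage \<open>s\<close> (counted from 0) the weight
  \<open>\<Sum>t=Suc s..n. \<theta> t / real t\<close>. This is the origin of the weights in
  \<open>shift_weights\<close>.\<close>

lemma weighted_averages_swap:
  fixes a \<theta> :: "nat \<Rightarrow> real"
  shows "(\<Sum>t=1..n. \<theta> t * ((\<Sum>s<t. a s) / real t)) = (\<Sum>s<n. (\<Sum>t=Suc s..n. \<theta> t / real t) * a s)"
proof -
  have "(\<Sum>t=1..n. \<theta> t * ((\<Sum>s<t. a s) / real t)) = (\<Sum>t=1..n. \<Sum>s | s \<in> {..<n} \<and> s < t. \<theta> t / real t * a s)"
  proof (rule sum.cong[OF refl])
    fix t assume t: "t \<in> {1..n}"
    then have "{s. s \<in> {..<n} \<and> s < t} = {..<t}" by auto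
    then show "\<theta> t * ((\<Sum>s<t. a s) / real t) = (\<Sum>s | s \<in> {..<n} \<and> s < t. \<theta> t / real t * a s)"
      by (simp add: sum_distrib_left sum_divide_distrib)
  qed
  also have "\<dots> = (\<Sum>s<n. \<Sum>t | t \<in> {1..n} \<and> s < t. \<theta> t / real t * a s)"
    by (rule sum.swap_restrict) auto
  also have "\<dots> = (\<Sum>s<n. (\<Sum>t=Suc s..n. \<theta> t / real t) * a s)"
  proof (rule sum.cong[OF refl])
    fix s
    have "{t. t \<in> {1..n} \<and> s < t} = {Suc s..n}" by auto
    then show "(\<Sum>t | t \<in> {1..n} \<and> s < t. \<theta> t / real t * a s) = (\<Sum>t=Suc s..n. \<theta> t / real t) * a s"
      by (simp add: sum_distrib_right)
  qed
  finally show ?thesis .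
qed

context controlled_flow
begin

section \<open>Minimal averages and their dual weights\<close>

definition minavg :: "('d list \<Rightarrow> 'k \<Rightarrow> 'i \<Rightarrow> real) \<Rightarrow> nat \<Rightarrow> nat \<Rightarrow> real" where
  "minavg M l n = Min (A M l ` {1..n})"

lemma minavg_le: "t \<in> {1..n} \<Longrightarrow> minavg M l n \<le> A M l t"
  unfolding minavg_def by (rule Min_le) auto

lemma minavg_attained: "1 \<le> n \<Longrightarrow> \<exists>t\<in>{1..n}. minavg M l n = A M l t"
proof -
  assume n: "1 \<le> n"
  have "minavg M l n \<in> A M l ` {1..n}" unfolding minavg_def by (rule Min_in) (use n in auto)
  then show ?thesis by blast
qed

lemma subprob_tails:
  assumes "\<theta> \<in> prob_weights n"
  shows "subprob n (\<lambda>s. \<Sum>t=Suc s..n. \<theta> t / real t)"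
proof -
  have "(\<Sum>s<n. \<Sum>t=Suc s..n. \<theta> t / real t) = (\<Sum>t=1..n. \<theta> t * ((\<Sum>s<t. 1) / real t))"
    using weighted_averages_swap[of \<theta> "\<lambda>_. 1" n] by simp
  also have "\<dots> = (\<Sum>t=1..n. \<theta> t)" by (intro sum.cong) auto
  finally show ?thesis using assms by (auto simp: subprob_def prob_weights_def intro!: sum_nonneg)
qed

lemma weighted_average_eq:
  "(\<Sum>t=1..n. \<theta> t * A M l t) = (\<Sum>s<n. (\<Sum>t=Suc s..n. \<theta> t / real t) * R M (l + s))"
  unfolding A_def by (rule weighted_averages_swap)

lemma A_mix:
  assumes "0 \<le> s" "s \<le> 1"
  shows "s * A M l t + (1 - s) * A M' l t \<le> A (\<lambda>ds k i. s * M ds k i + (1 - s) * M' ds k i) l t"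
proof -
  have "s * A M l t + (1 - s) * A M' l t = (\<Sum>u<t. s * R M (l + u) + (1 - s) * R M' (l + u)) / real t"
    by (simp add: A_def sum.distrib add_divide_distrib flip: sum_distrib_left)
  also have "\<dots> \<le> A (\<lambda>ds k i. s * M ds k i + (1 - s) * M' ds k i) l t"
    unfolding A_def by (intro divide_right_mono sum_mono R_mix assms) auto
  finally show ?thesis .
qed

text \<open>An adversary picks the length \<open>t\<close> of the average. The averages are concave
  in the flow, so he has a mixed length \<theta> that works against all flows
  simultaneously.\<close>

lemma minimax_averages:
  assumes n: "1 \<le> n" and v: "\<And>M. M \<in> flows l z \<Longrightarrow> minavg M l' n \<le> v"
  shows "\<exists>\<theta>\<in>prob_weights n. \<forall>M\<in>flows l z. (\<Sum>t=1..n. \<theta> t * A M l' t) \<le> v"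
proof -
  have "\<exists>\<theta>. (\<forall>t\<in>{1..n}. 0 \<le> \<theta> t) \<and> sum \<theta> {1..n} = 1 \<and> (\<forall>M\<in>flows l z. (\<Sum>t\<in>{1..n}. \<theta> t * A M l' t) \<le> v)"
  proof (rule finite_minimax)
    fix M M' and s :: real assume "M \<in> flows l z" "M' \<in> flows l z" "0 \<le> s" "s \<le> 1"
    then show "\<exists>H\<in>flows l z. \<forall>t\<in>{1..n}. s * A M l' t + (1 - s) * A M' l' t \<le> A H l' t"
      using flows_mix A_mix by blast
  next
    fix M assume "M \<in> flows l z"
    then show "\<exists>t\<in>{1..n}. A M l' t \<le> v" using v minavg_attained[OF n] by metis
  qed (use n in auto)
  then obtain \<theta> where \<theta>: "\<forall>t\<in>{1..n}. 0 \<le> \<theta> t" "sum \<theta> {1..n} = 1"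
      "\<forall>M\<in>flows l z. (\<Sum>t=1..n. \<theta> t * A M l' t) \<le> v" by blast
  define \<theta>' where "\<theta>' t = (if t \<in> {1..n} then \<theta> t else 0)" for t
  have eq: "(\<Sum>t=1..n. \<theta>' t * f t) = (\<Sum>t=1..n. \<theta> t * f t)" for f
    by (rule sum.cong) (auto simp: \<theta>'_def)
  have "\<theta>' \<in> prob_weights n" using \<theta>(1,2) eq[of "\<lambda>_. 1"] by (auto simp: prob_weights_def \<theta>'_def)
  then show ?thesis using \<theta>(3) by (intro bexI[of _ \<theta>']) (simp_all only: eq)
qed

text \<open>A minimum of averages is not a weighted payoff, so closeness of the values
  \<open>U\<close> does not apply to it directly. The dual weights \<theta> at \<open>z'\<close>
  bound it by a weighted payoff, which can be carried over from \<open>z\<close> to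
  \<open>z'\<close>.\<close>

lemma minavg_le_of_close:
  assumes z: "nonneg_at l z" "nonneg_at l' z'"
    and close: "\<And>N \<theta>. subprob N \<theta> \<Longrightarrow> U N \<theta> l z \<le> U N \<theta> l' z' + \<epsilon>"
    and n: "1 \<le> n" and v: "\<And>M. M \<in> flows l' z' \<Longrightarrow> minavg M l' n \<le> v" and M: "M \<in> flows l z"
  shows "minavg M l n \<le> v + \<epsilon>"
proof -
  obtain \<theta> where \<theta>: "\<theta> \<in> prob_weights n" "\<And>M. M \<in> flows l' z' \<Longrightarrow> (\<Sum>t=1..n. \<theta> t * A M l' t) \<le> v"
    using minimax_averages[OF n v, of l' z'] by auto
  let ?\<theta> = "\<lambda>s. \<Sum>t=Suc s..n. \<theta> t / real t"
  have "minavg M l n = (\<Sum>t=1..n. \<theta> t * minavg M l n)"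
    using \<theta>(1) by (simp add: prob_weights_def flip: sum_distrib_right)
  also have "\<dots> \<le> (\<Sum>t=1..n. \<theta> t * A M l t)"
    using \<theta>(1) by (intro sum_mono mult_left_mono minavg_le) (auto simp: prob_weights_def)
  also have "\<dots> \<le> U n ?\<theta> l z"
    unfolding weighted_average_eq by (rule U_upper[OF M subprob_tails[OF \<theta>(1)] z(1)])
  also have "\<dots> \<le> U n ?\<theta> l' z' + \<epsilon>" by (rule close[OF subprob_tails[OF \<theta>(1)]])
  also have "U n ?\<theta> l' z' \<le> v"
  proof (rule U_least[OF z(2)])
    show "(\<Sum>s<n. (\<Sum>t=Suc s..n. \<theta> t / real t) * R M (l' + s)) \<le> v" if "M \<in> flows l' z'" for M
      using \<theta>(2)[OF that] unfolding weighted_average_eq .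
  qed
  finally show ?thesis by simp
qed

text \<open>The state reached by the flow that is good for \<open>n\<close> stages may depend on \<open>n\<close>. By total boundedness
  one of these states is close to infinitely many of them, hence good for every horizon.\<close>

lemma flow_with_good_tail:
  assumes z: "valid l z" and \<epsilon>: "0 < \<epsilon>"
    and c: "\<And>n. 1 \<le> n \<Longrightarrow> \<exists>m. \<exists>M\<in>flows l z. c \<le> minavg M (l + m) n"
  shows "\<exists>m. \<exists>M\<in>flows l z. \<forall>t\<ge>1. c - \<epsilon> \<le> A M (l + m) t"
proof -
  have "\<exists>p. 1 \<le> n \<longrightarrow> snd p \<in> flows l z \<and> c \<le> minavg (snd p) (l + fst p) n" for n
  proof (cases "1 \<le> n")
    case True
    then obtain m M where "M \<in> flows l z" "c \<le> minavg M (l + m) n" using c by blast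
    then show ?thesis by (intro exI[of _ "(m, M)"]) simp
  qed simp
  then have "\<forall>n. \<exists>p. 1 \<le> n \<longrightarrow> snd p \<in> flows l z \<and> c \<le> minavg (snd p) (l + fst p) n" by blast
  then obtain p where p: "\<And>n. 1 \<le> n \<Longrightarrow> snd (p n) \<in> flows l z"
      "\<And>n. 1 \<le> n \<Longrightarrow> c \<le> minavg (snd (p n)) (l + fst (p n)) n"
    unfolding choice_iff by blast
  define L where "L n = l + fst (p n)" for n
  define M where "M n = snd (p n)" for n
  define Z where "Z n ds k = (\<Sum>i\<in>UNIV. M n ds k i)" for n ds k
  have M: "M n \<in> flows l z" "c \<le> minavg (M n) (L n) n" if "1 \<le> n" for n
    using p[OF that] by (auto simp: M_def L_def)
  have MZ: "M n \<in> flows (L n) (Z n)" and vZ: "valid (L n) (Z n)" if "1 \<le> n" for n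
    unfolding Z_def[abs_def] using M(1)[OF that] z
    by (auto simp: L_def intro!: flows_restrict[of _ l] valid_restrict[of _ l])
  have "0 < \<epsilon> / 2" using \<epsilon> by simp
  from finite_code[OF this] obtain code :: "nat \<Rightarrow> ('d list \<Rightarrow> 'k \<Rightarrow> real) \<Rightarrow> ('k \<Rightarrow> nat) \<Rightarrow> nat" and S
    where code0: "finite S \<and> (\<forall>l z. valid l z \<longrightarrow> code l z \<in> S) \<and>
     (\<forall>l z l' z' N \<theta>. valid l z \<longrightarrow> valid l' z' \<longrightarrow> code l z = code l' z' \<longrightarrow> subprob N \<theta> \<longrightarrow>
        U N \<theta> l z \<le> U N \<theta> l' z' + \<epsilon> / 2)" by (elim exE)
  have code: "finite S" "\<And>l z. valid l z \<Longrightarrow> code l z \<in> S"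
      "\<And>l z l' z' N \<theta>. valid l z \<Longrightarrow> valid l' z' \<Longrightarrow> code l z = code l' z' \<Longrightarrow> subprob N \<theta> \<Longrightarrow>
        U N \<theta> l z \<le> U N \<theta> l' z' + \<epsilon> / 2"
    using code0 by blast+
  define f where "f n = code (L n) (Z n)" for n
  have "finite (f ` {1..})" by (rule finite_subset[OF _ code(1)]) (auto simp: f_def intro!: code(2) vZ)
  then obtain n0 where n0: "n0 \<in> {1..}" "infinite {n \<in> {1..}. f n = f n0}"
    using pigeonhole_infinite[OF infinite_Ici] by blast
  then have n01: "1 \<le> n0" by simp
  have "\<exists>H\<in>flows (L n0) (Z n0). \<forall>t\<ge>1. c - \<epsilon> \<le> A H (L n0) t"
  proof (rule flow_with_all_averages[OF vZ[OF n01]])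
    fix n
    obtain n' where n': "n \<le> n'" "1 \<le> n'" "f n' = f n0"
      using n0(2) unfolding infinite_nat_iff_unbounded_le by auto
    \<comment> \<open>The states reached for \<open>n0\<close> and \<open>n'\<close> have the same
      code, hence values within \<open>\<epsilon> / 2\<close>. If every flow from the former fell
      below \<open>c - \<epsilon>\<close>, the minimal average of \<open>M n'\<close> would be at
      most \<open>c - \<epsilon> / 2\<close>, contradicting its choice.\<close>
    have "\<exists>H\<in>flows (L n0) (Z n0). c - \<epsilon> \<le> minavg H (L n0) n'"
    proof (rule ccontr)
      assume "\<not> ?thesis"
      then have "minavg (M n') (L n') n' \<le> c - \<epsilon> + \<epsilon> / 2"
        using vZ[OF n'(2)] vZ[OF n01] n'
        by (intro minavg_le_of_close[OF _ _ _ n'(2) _ MZ[OF n'(2)], of "L n0" "Z n0"] code(3))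
           (auto simp: valid_def f_def not_le intro: less_imp_le)
      then show False using M(2)[OF n'(2)] \<epsilon> by simp
    qed
    then show "\<exists>H\<in>flows (L n0) (Z n0). \<forall>t\<in>{1..n}. c - \<epsilon> \<le> A H (L n0) t"
      using n'(1) by (force intro: order_trans[OF _ minavg_le])
  qed
  then obtain H where H: "H \<in> flows (L n0) (Z n0)" "\<And>t. 1 \<le> t \<Longrightarrow> c - \<epsilon> \<le> A H (L n0) t" by blast
  let ?H = "\<lambda>ds. if length ds < L n0 then M n0 ds else H ds"
  have "?H \<in> flows l z"
    using H(1) unfolding Z_def[abs_def] by (intro flows_concat[OF M(1)[OF n01]]) (auto simp: L_def)
  moreover have "R ?H (L n0 + s) = R H (L n0 + s)" for s
    by (auto simp: R_def intro!: sum.cong)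
  then have "A ?H (L n0) t = A H (L n0) t" for t by (simp add: A_def)
  ultimately show ?thesis using H(2)
    by (intro exI[of _ "fst (p n0)"] bexI[of _ ?H]) (auto simp flip: L_def)
qed

text \<open>Counting the first \<open>m\<close> stages as 0 loses at most \<open>m\<close> in the
  sum, because \<open>c \<le> 1\<close> and the payoffs are nonnegative.\<close>

lemma average_from_start_ge:
  assumes M: "M \<in> flows l z" and z: "valid l z" and c: "c \<le> 1" "\<And>t. 1 \<le> t \<Longrightarrow> c \<le> A M (l + m) t"
    and N: "1 \<le> N"
  shows "c - real m / real N \<le> A M l N"
proof (cases "N \<le> m")
  case True
  then have "1 \<le> real m / real N" using N by simp
  then show ?thesis using A_bounds(1)[OF M z order_refl, of N] c(1) by linarith
next
  case False
  then have 1: "1 \<le> N - m" by simp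
  have "c * real (N - m) \<le> (\<Sum>s<N - m. R M (l + m + s))"
    using c(2)[OF 1] 1 by (simp add: A_def field_simps)
  also have "\<dots> = (\<Sum>s\<in>{m..<N}. R M (l + s))"
    using False by (intro sum.reindex_bij_witness[where i = "\<lambda>s. s - m" and j = "\<lambda>s. m + s"]) (auto simp: add_ac)
  also have "\<dots> \<le> (\<Sum>s<N. R M (l + s))"
    by (rule sum_mono2) (use R_nonneg[OF M] in auto)
  also have "\<dots> = A M l N * real N" using N by (simp add: A_def)
  finally have "c * real N - c * real m \<le> A M l N * real N" using False by (simp add: of_nat_diff algebra_simps)
  moreover have "c * real m \<le> real m" using c(1) mult_right_mono[of c 1 "real m"] by simp
  ultimately have "c * real N - real m \<le> A M l N * real N" by simp
  then show ?thesis using N by (simp add: field_simps)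
qed

definition v_flow :: "nat \<Rightarrow> nat \<Rightarrow> nat \<Rightarrow> ('d list \<Rightarrow> 'k \<Rightarrow> real) \<Rightarrow> real" where
  "v_flow m n l z = (SUP M\<in>flows l z. A M (l + m) n)"

definition w_flow :: "nat \<Rightarrow> nat \<Rightarrow> nat \<Rightarrow> ('d list \<Rightarrow> 'k \<Rightarrow> real) \<Rightarrow> real" where
  "w_flow m n l z = (SUP M\<in>flows l z. minavg M (l + m) n)"

definition v_star :: "nat \<Rightarrow> ('d list \<Rightarrow> 'k \<Rightarrow> real) \<Rightarrow> real" where
  "v_star l z = (INF n\<in>{1..}. SUP m. w_flow m n l z)"

section \<open>Relations between the values from a fixed initial state\<close>

context
  fixes l z
  assumes z: "valid l z"
begin

lemma A_le_v_flow: "M \<in> flows l z \<Longrightarrow> A M (l + m) n \<le> v_flow m n l z"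
  unfolding v_flow_def
  by (rule cSUP_upper) (auto intro!: bdd_aboveI2[of _ _ 1] A_bounds(2)[OF _ z])

lemma minavg_le_w_flow: "1 \<le> n \<Longrightarrow> M \<in> flows l z \<Longrightarrow> minavg M (l + m) n \<le> w_flow m n l z"
  unfolding w_flow_def
proof (rule cSUP_upper)
  assume n: "1 \<le> n"
  have "minavg M (l + m) n \<le> 1" if M: "M \<in> flows l z" for M
    using minavg_le[of 1 n M "l + m"] A_bounds(2)[OF M z, of "l + m" 1] n by simp
  then show "bdd_above ((\<lambda>M. minavg M (l + m) n) ` flows l z)" by (auto intro!: bdd_aboveI2)
qed

lemma flows_ne: "flows l z \<noteq> {}"
  using z flows_nonempty by (auto simp: valid_def)

lemma w_flow_nonneg:
  assumes n: "1 \<le> n"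
  shows "0 \<le> w_flow m n l z"
proof -
  obtain M where M: "M \<in> flows l z" using flows_ne by auto
  then have "0 \<le> minavg M (l + m) n"
    using minavg_attained[OF n, of M "l + m"] A_bounds(1)[OF M z, of "l + m"] by auto
  then show ?thesis using minavg_le_w_flow[OF n M, of m] by linarith
qed

lemma w_flow_le_v_flow:
  assumes n: "1 \<le> n"
  shows "w_flow m n l z \<le> v_flow m n l z"
  unfolding w_flow_def
proof (rule cSUP_least[OF flows_ne])
  fix M assume M: "M \<in> flows l z"
  have "minavg M (l + m) n \<le> A M (l + m) n" by (rule minavg_le) (use n in simp)
  also have "\<dots> \<le> v_flow m n l z" by (rule A_le_v_flow[OF M])
  finally show "minavg M (l + m) n \<le> v_flow m n l z" .
qed

lemma v_flow_le_1: "v_flow m n l z \<le> 1"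
  unfolding v_flow_def by (rule cSUP_least[OF flows_ne]) (rule A_bounds(2)[OF _ z], simp_all)

lemma w_flow_le_1: "1 \<le> n \<Longrightarrow> w_flow m n l z \<le> 1"
  by (rule order_trans[OF w_flow_le_v_flow v_flow_le_1])

lemma w_flow_le_SUP: "1 \<le> n \<Longrightarrow> w_flow m n l z \<le> (SUP m. w_flow m n l z)"
  by (rule cSUP_upper[OF UNIV_I], rule bdd_aboveI2[of _ _ 1], rule w_flow_le_1)

text \<open>Along any flow and from any date, some average of length at most \<open>n\<close> is
  bounded by the supremum of \<open>w_flow\<close>, so the greedy cutting applies to the whole
  interval of length \<open>N\<close>.\<close>

lemma v_flow_le_SUP_w_flow:
  assumes n: "1 \<le> n" and N: "1 \<le> N"
  shows "v_flow m N l z \<le> (SUP m. w_flow m n l z) + real n / real N"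
  unfolding v_flow_def
proof (rule cSUP_least[OF flows_ne])
  fix M assume M: "M \<in> flows l z"
  let ?\<alpha> = "SUP m. w_flow m n l z"
  have "(\<Sum>u<N. R M (l + (m + u))) \<le> real N * ?\<alpha> + real n"
  proof (rule sum_le_of_short_low_blocks[of "\<lambda>u. R M (l + u)"])
    have "R M (l + t) \<le> mass l z" for t by (rule R_le_mass[OF M]) simp
    then show "R M (l + t) \<le> 1" for t using z unfolding valid_def by (meson order_trans)
    show "0 \<le> ?\<alpha>" using w_flow_nonneg[OF n, of 0] w_flow_le_SUP[OF n, of 0] by linarith
    fix s
    obtain t where t: "t \<in> {1..n}" "minavg M (l + s) n = A M (l + s) t" using minavg_attained[OF n] by blast
    then have "A M (l + s) t \<le> ?\<alpha>" using minavg_le_w_flow[OF n M, of s] w_flow_le_SUP[OF n, of s] by linarith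
    then show "\<exists>t\<in>{1..n}. (\<Sum>u<t. R M (l + (s + u))) \<le> real t * ?\<alpha>"
      using t(1) by (intro bexI[of _ t]) (auto simp: A_def field_simps add.assoc)
  qed
  then show "A M (l + m) N \<le> ?\<alpha> + real n / real N" using N by (simp add: A_def field_simps add.assoc)
qed

lemma SUP_w_flow_bounds:
  assumes n: "1 \<le> n"
  shows "v_star l z \<le> (SUP m. w_flow m n l z)" "(SUP m. w_flow m n l z) \<le> 1"
proof -
  have "0 \<le> (SUP m. w_flow m n l z)" if "1 \<le> n" for n
    using w_flow_nonneg[OF that, of 0] w_flow_le_SUP[OF that, of 0] by linarith
  then have "bdd_below ((\<lambda>n. SUP m. w_flow m n l z) ` {1..})" by (auto intro!: bdd_belowI2)
  then show "v_star l z \<le> (SUP m. w_flow m n l z)" unfolding v_star_def using n by (intro cINF_lower) auto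
  show "(SUP m. w_flow m n l z) \<le> 1"
    by (rule cSUP_least) (simp_all only: UNIV_not_empty not_False_eq_True w_flow_le_1[OF n])
qed

lemma v_star_le_1: "v_star l z \<le> 1"
  using SUP_w_flow_bounds[of 1] by linarith

text \<open>One half of \<open>e\<close> is spent because the suprema in \<open>w_flow\<close> are
  only approached, the other because the good state must be made independent of the horizon.\<close>

lemma flow_near_v_star:
  assumes e: "0 < e"
  shows "\<exists>m. \<exists>M\<in>flows l z. \<forall>t\<ge>1. v_star l z - e \<le> A M (l + m) t"
proof -
  have "\<exists>m. \<exists>M\<in>flows l z. v_star l z - e / 2 \<le> minavg M (l + m) n" if n: "1 \<le> n" for n
  proof (rule ccontr)
    assume "\<not> ?thesis"
    then have "w_flow m n l z \<le> v_star l z - e / 2" for m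
      unfolding w_flow_def by (intro cSUP_least[OF flows_ne]) (auto simp: not_le intro: less_imp_le)
    then have "(SUP m. w_flow m n l z) \<le> v_star l z - e / 2" by (intro cSUP_least) auto
    then show False using SUP_w_flow_bounds(1)[OF n] e by linarith
  qed
  from flow_with_good_tail[OF z _ this, of "e / 2"] e show ?thesis by simp
qed

lemma w_flow_ge_v_star:
  assumes "0 < e"
  shows "\<exists>m. \<forall>n\<ge>1. v_star l z - e \<le> w_flow m n l z"
proof -
  obtain m M where M: "M \<in> flows l z" "\<And>t. 1 \<le> t \<Longrightarrow> v_star l z - e \<le> A M (l + m) t"
    using flow_near_v_star[OF assms] by blast
  have "v_star l z - e \<le> w_flow m n l z" if n: "1 \<le> n" for n
  proof -
    obtain t where "t \<in> {1..n}" "minavg M (l + m) n = A M (l + m) t" using minavg_attained[OF n] by blast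
    then show ?thesis using M(2)[of t] minavg_le_w_flow[OF n M(1), of m] by simp
  qed
  then show ?thesis by blast
qed

lemma v_star_eqs:
  "v_star l z = (INF n\<in>{1..}. SUP m. v_flow m n l z)"
  "v_star l z = (SUP m. INF n\<in>{1..}. v_flow m n l z)"
  "v_star l z = (SUP m. INF n\<in>{1..}. w_flow m n l z)"
  using sup_inf_equalities[of "\<lambda>m n. w_flow m n l z" "\<lambda>m n. v_flow m n l z" "v_star l z",
      OF w_flow_nonneg w_flow_le_v_flow v_flow_le_1 v_star_def v_flow_le_SUP_w_flow w_flow_ge_v_star]
  by simp_all

lemma v_flow_tendsto: "(\<lambda>n. v_flow 0 n l z) \<longlonglongrightarrow> v_star l z"
proof (rule LIMSEQ_I)
  fix e :: real assume e: "0 < e"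
  have "\<exists>n\<ge>1. (SUP m. w_flow m n l z) < v_star l z + e / 2"
  proof (rule ccontr)
    assume "\<not> ?thesis"
    then have "v_star l z + e / 2 \<le> (INF n\<in>{1..}. SUP m. w_flow m n l z)"
      by (intro cINF_greatest) (auto simp: not_less)
    then show False using e unfolding v_star_def[symmetric] by simp
  qed
  then obtain n where n: "1 \<le> n" "(SUP m. w_flow m n l z) < v_star l z + e / 2" by blast
  obtain m M where M: "M \<in> flows l z" "\<And>t. 1 \<le> t \<Longrightarrow> v_star l z - e / 2 \<le> A M (l + m) t"
    using flow_near_v_star[of "e / 2"] e by auto
  \<comment> \<open>\<open>N0\<close> makes both error terms smaller than \<open>e / 2\<close>:
    \<open>n / N\<close> from cutting into blocks of length at most \<open>n\<close>, and
    \<open>m / N\<close> from the delay before the good tail.\<close>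
  obtain N0 :: nat where N0: "real (n + m) * 2 / e < real N0" using reals_Archimedean2 by blast
  show "\<exists>no. \<forall>N\<ge>no. norm (v_flow 0 N l z - v_star l z) < e"
  proof (intro exI[of _ N0] allI impI)
    fix N assume N: "N0 \<le> N"
    have "0 < real N0" by (rule le_less_trans[OF _ N0]) (use e in auto)
    then have N1: "1 \<le> N" and pos: "0 < real N" using N by auto
    have "real (n + m) * 2 / e < real N" using N0 N by linarith
    then have "real (n + m) * 2 < e * real N" using e by (simp add: field_simps)
    then have small: "real n / real N < e / 2" "real m / real N < e / 2" using pos by (auto simp: field_simps)
    have "v_flow 0 N l z < v_star l z + e"
      using v_flow_le_SUP_w_flow[OF n(1) N1, of 0] n(2) small(1) by linarith
    moreover have "v_star l z - e / 2 - real m / real N \<le> v_flow 0 N l z"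
    proof -
      have "v_star l z - e / 2 \<le> 1" using v_star_le_1 e by linarith
      from average_from_start_ge[OF M(1) z this M(2) N1]
      show ?thesis using A_le_v_flow[OF M(1), of 0 N] by simp
    qed
    ultimately show "norm (v_flow 0 N l z - v_star l z) < e" using small by (simp add: abs_less_iff)
  qed
qed

end

end

context controlled_flow
begin

lemma v_flow_eq_U: "v_flow 0 n l z = U n (\<lambda>_. 1 / real n) l z"
  by (simp add: v_flow_def U_def A_def sum_divide_distrib)

text \<open>Convergence at one representative per code, of which there are finitely many, extends to
  all states: passing to the representative costs \<open>e / 3\<close> for \<open>v_flow\<close> and
  \<open>e / 3\<close> for its limit.\<close>

lemma v_flow_uniform:
  assumes e: "0 < e"
  shows "\<exists>N. \<forall>n\<ge>N. \<forall>z. valid l z \<longrightarrow> \<bar>v_flow 0 n l z - v_star l z\<bar> \<le> e"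
proof -
  have "0 < e / 3" using e by simp
  from finite_code[OF this] obtain code :: "nat \<Rightarrow> ('d list \<Rightarrow> 'k \<Rightarrow> real) \<Rightarrow> ('k \<Rightarrow> nat) \<Rightarrow> nat" and S
    where code0: "finite S \<and> (\<forall>l z. valid l z \<longrightarrow> code l z \<in> S) \<and>
     (\<forall>l z l' z' N \<theta>. valid l z \<longrightarrow> valid l' z' \<longrightarrow> code l z = code l' z' \<longrightarrow> subprob N \<theta> \<longrightarrow>
        U N \<theta> l z \<le> U N \<theta> l' z' + e / 3)" by (elim exE)
  define C where "C = code l ` {z. valid l z}"
  have "finite C" by (rule finite_subset[of _ S]) (use code0 in \<open>auto simp: C_def\<close>)
  define rep where "rep c = (SOME z. valid l z \<and> code l z = c)" for c
  have rep: "valid l (rep (code l z))" "code l (rep (code l z)) = code l z" if "valid l z" for z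
    using someI[of "\<lambda>z'. valid l z' \<and> code l z' = code l z" z] that by (auto simp: rep_def)
  have close: "v_flow 0 n l z \<le> v_flow 0 n l z' + e / 3"
    if "valid l z" "valid l z'" "code l z = code l z'" "1 \<le> n" for z z' n
  proof -
    have "subprob n (\<lambda>_. 1 / real n)" using that by (simp add: subprob_def)
    then show ?thesis using code0 that by (simp add: v_flow_eq_U)
  qed
  have star_close: "v_star l z \<le> v_star l z' + e / 3"
    if "valid l z" "valid l z'" "code l z = code l z'" for z z'
  proof (rule LIMSEQ_le[OF v_flow_tendsto[OF that(1)]])
    show "(\<lambda>n. v_flow 0 n l z' + e / 3) \<longlonglongrightarrow> v_star l z' + e / 3"
      by (intro tendsto_add v_flow_tendsto that tendsto_const)
    show "\<exists>N. \<forall>n\<ge>N. v_flow 0 n l z \<le> v_flow 0 n l z' + e / 3" using close[OF that] by blast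
  qed
  have "\<exists>N. \<forall>n\<ge>N. norm (v_flow 0 n l (rep c) - v_star l (rep c)) < e / 3" if "c \<in> C" for c
    using that rep e by (intro LIMSEQ_D[OF v_flow_tendsto]) (auto simp: C_def)
  then obtain N where N: "\<And>c n. c \<in> C \<Longrightarrow> N c \<le> n \<Longrightarrow> \<bar>v_flow 0 n l (rep c) - v_star l (rep c)\<bar> < e / 3"
    unfolding real_norm_def by metis
  show ?thesis
  proof (intro exI[of _ "Max (insert 1 (N ` C))"] allI impI)
    fix n z assume n: "Max (insert 1 (N ` C)) \<le> n" and z: "valid l z"
    let ?z = "rep (code l z)"
    have c: "code l z \<in> C" using z by (auto simp: C_def)
    have n: "N (code l z) \<le> n" "1 \<le> n" using n c \<open>finite C\<close> by auto
    have "\<bar>v_flow 0 n l ?z - v_star l ?z\<bar> < e / 3" by (rule N[OF c n(1)])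
    moreover have "v_flow 0 n l z \<le> v_flow 0 n l ?z + e / 3" "v_flow 0 n l ?z \<le> v_flow 0 n l z + e / 3"
      "v_star l z \<le> v_star l ?z + e / 3" "v_star l ?z \<le> v_star l z + e / 3"
      using z rep[OF z] n(2) by (auto intro!: close star_close)
    ultimately show "\<bar>v_flow 0 n l z - v_star l z\<bar> \<le> e" unfolding abs_less_iff abs_le_iff by argo
  qed
qed

text \<open>Optimal weights on the pure plans of player 2, maps on the finite set \<open>W\<close>
  of histories, come from the minimax theorem. His actions do not change the flow and the payoff is
  additive over histories, so only the marginal at each history matters and a signal-based behaviour
  \<eta> suffices.\<close>

lemma minimax_actions:
  assumes \<theta>: "\<And>t. 0 \<le> \<theta> t" and v: "\<And>M. M \<in> flows l z \<Longrightarrow> (\<Sum>t=1..T. \<theta> t * R M t) \<le> v"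
  shows "\<exists>\<eta> :: 'd list \<Rightarrow> 'j pmf. \<forall>M\<in>flows l z.
    (\<Sum>t=1..T. \<theta> t * (\<Sum>ds\<in>words t. \<Sum>j\<in>UNIV. pmf (\<eta> ds) j * pay (M ds) j)) \<le> v"
proof -
  define W :: "'d list set" where "W = (\<Union>t\<in>{1..T}. words t)"
  define P :: "('d list \<Rightarrow> 'j) set" where "P = PiE W (\<lambda>_. UNIV)"
  have W: "finite W" by (simp add: W_def)
  have P: "finite P" "P \<noteq> {}" using W by (auto simp: P_def PiE_eq_empty_iff intro: finite_PiE)
  define F where "F y M = (\<Sum>t=1..T. \<theta> t * (\<Sum>ds\<in>words t. pay (M ds) (y ds)))" for y :: "'d list \<Rightarrow> 'j" and M
  have "\<exists>w. (\<forall>y\<in>P. 0 \<le> w y) \<and> sum w P = 1 \<and> (\<forall>M\<in>flows l z. (\<Sum>y\<in>P. w y * F y M) \<le> v)"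
  proof (rule finite_minimax[OF P])
    fix M M' and s :: real assume *: "M \<in> flows l z" "M' \<in> flows l z" "0 \<le> s" "s \<le> 1"
    show "\<exists>H\<in>flows l z. \<forall>y\<in>P. s * F y M + (1 - s) * F y M' \<le> F y H"
    proof (intro bexI ballI)
      show "(\<lambda>ds k i. s * M ds k i + (1 - s) * M' ds k i) \<in> flows l z" by (rule flows_mix) (use * in auto)
      fix y
      have "F y (\<lambda>ds k i. s * M ds k i + (1 - s) * M' ds k i) = s * F y M + (1 - s) * F y M'"
        unfolding F_def pay_add by (simp add: sum.distrib distrib_left sum_distrib_left mult.left_commute)
      then show "s * F y M + (1 - s) * F y M' \<le> F y (\<lambda>ds k i. s * M ds k i + (1 - s) * M' ds k i)" by simp
    qed
  next
    fix M assume M: "M \<in> flows l z"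
    obtain y where y: "\<And>t. R M t = (\<Sum>ds\<in>words t. pay (M ds) (y ds))" using R_attained by blast
    have "F (restrict y W) M = (\<Sum>t=1..T. \<theta> t * R M t)"
      unfolding F_def y by (intro sum.cong refl arg_cong2[where f = "(*)"]) (auto simp: W_def)
    then show "\<exists>y\<in>P. F y M \<le> v" using v[OF M] by (intro bexI[of _ "restrict y W"]) (auto simp: P_def)
  qed
  then obtain w where w: "\<And>y. y \<in> P \<Longrightarrow> 0 \<le> w y" "sum w P = 1"
      "\<And>M. M \<in> flows l z \<Longrightarrow> (\<Sum>y\<in>P. w y * F y M) \<le> v" by blast
  have "\<exists>p. pmf p = (\<lambda>j. \<Sum>y | y \<in> P \<and> y ds = j. w y)" for ds
  proof (rule ex_pmf_eq)
    show "0 \<le> (\<Sum>y | y \<in> P \<and> y ds = j. w y)" for j using w(1) by (intro sum_nonneg) auto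
    show "(\<Sum>j\<in>UNIV. \<Sum>y | y \<in> P \<and> y ds = j. w y) = 1"
      using sum.group[OF P(1), of UNIV "\<lambda>y. y ds" w] w(2) by simp
  qed
  then obtain \<eta> where \<eta>: "\<And>ds. pmf (\<eta> ds) = (\<lambda>j. \<Sum>y | y \<in> P \<and> y ds = j. w y)" by metis
  have avg: "(\<Sum>j\<in>UNIV. pmf (\<eta> ds) j * f j) = (\<Sum>y\<in>P. w y * f (y ds))" for ds and f :: "'j \<Rightarrow> real"
  proof -
    have "(\<Sum>j\<in>UNIV. pmf (\<eta> ds) j * f j) = (\<Sum>j\<in>UNIV. \<Sum>y | y \<in> P \<and> y ds = j. w y * f (y ds))"
      by (auto simp: \<eta> sum_distrib_right intro!: sum.cong)
    also have "\<dots> = (\<Sum>y\<in>P. w y * f (y ds))" by (rule sum.group) (use P in auto)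
    finally show ?thesis .
  qed
  have "(\<Sum>t=1..T. \<theta> t * (\<Sum>ds\<in>words t. \<Sum>j\<in>UNIV. pmf (\<eta> ds) j * pay (M ds) j)) = (\<Sum>y\<in>P. w y * F y M)" for M
  proof -
    have "(\<Sum>y\<in>P. w y * F y M) = (\<Sum>y\<in>P. \<Sum>t=1..T. \<Sum>ds\<in>words t. \<theta> t * (w y * pay (M ds) (y ds)))"
      by (simp add: F_def sum_distrib_left mult.left_commute)
    also have "\<dots> = (\<Sum>t=1..T. \<Sum>y\<in>P. \<Sum>ds\<in>words t. \<theta> t * (w y * pay (M ds) (y ds)))"
      by (rule sum.swap)
    also have "\<dots> = (\<Sum>t=1..T. \<Sum>ds\<in>words t. \<Sum>y\<in>P. \<theta> t * (w y * pay (M ds) (y ds)))"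
      by (intro sum.cong refl) (rule sum.swap)
    finally show ?thesis by (simp add: avg sum_distrib_left)
  qed
  then show ?thesis using w(3) by (intro exI[of _ \<eta>]) simp
qed

end

section \<open>Strategies and flows\<close>

lemma expectation_bind_finite:
  fixes \<phi> :: "'b \<Rightarrow> real"
  assumes "finite (set_pmf p)" "\<And>x. finite (set_pmf (f x))"
  shows "measure_pmf.expectation (bind_pmf p f) \<phi> = measure_pmf.expectation p (\<lambda>x. measure_pmf.expectation (f x) \<phi>)"
  using assms by (subst pmf_expectation_bind[of "set_pmf p"]) (auto simp: integral_measure_pmf[of "set_pmf p"])

lemma expectation_finite:
  fixes \<phi> :: "'b::finite \<Rightarrow> real"
  shows "measure_pmf.expectation p \<phi> = (\<Sum>x\<in>UNIV. pmf p x * \<phi> x)"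
  by (subst integral_measure_pmf[of UNIV]) auto

lemma sum_UNIV_prod:
  fixes f :: "'a::finite \<times> 'b::finite \<Rightarrow> real"
  shows "(\<Sum>x\<in>UNIV. f x) = (\<Sum>a\<in>UNIV. \<Sum>b\<in>UNIV. f (a, b))"
  by (simp add: sum.cartesian_product flip: UNIV_Times_UNIV)

lemma sum_of_bool_eq:
  "finite S \<Longrightarrow> a \<in> S \<Longrightarrow> (\<Sum>x\<in>S. of_bool (a = x) * f x) = (f a :: real)"
  by (simp add: of_bool_def if_distrib[of "\<lambda>b. b * _"] cong: if_cong)

lemma pmf_map_eq_expectation:
  "pmf (map_pmf f p) x = measure_pmf.expectation p (\<lambda>y. of_bool (f y = x))"
proof -
  have "(\<lambda>y. of_bool (f y = x)) = (indicator (f -` {x}) :: _ \<Rightarrow> real)" by (auto simp: indicator_def)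
  then show ?thesis by (simp add: pmf_map)
qed

definition state_signal2 :: "'k \<times> 'c \<times> 'd \<Rightarrow> 'k \<times> 'd" where
  "state_signal2 = (\<lambda>(k, c, d). (k, d))"

text \<open>Reversed to agree with flows; the observations \<open>obs1\<close> and
  \<open>obs2\<close> are chronological.\<close>

definition dsig :: "('k, 'i, 'j, 'c, 'd) stage list \<Rightarrow> 'd list" where
  "dsig h = rev (map (\<lambda>(k, c, d, i, j). d) h)"

definition last_k :: "('k, 'i, 'j, 'c, 'd) stage list \<Rightarrow> 'k" where
  "last_k h = (case last h of (k, c, d, i, j) \<Rightarrow> k)"

definition last_i :: "('k, 'i, 'j, 'c, 'd) stage list \<Rightarrow> 'i" where
  "last_i h = (case last h of (k, c, d, i, j) \<Rightarrow> i)"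

definition last_j :: "('k, 'i, 'j, 'c, 'd) stage list \<Rightarrow> 'j" where
  "last_j h = (case last h of (k, c, d, i, j) \<Rightarrow> j)"

lemma stage_simps [simp]:
  "dsig [] = []"
  "dsig (h @ [(k, c, d, i, j)]) = d # dsig h"
  "last_k (h @ [(k, c, d, i, j)]) = k"
  "last_i (h @ [(k, c, d, i, j)]) = i"
  "last_j (h @ [(k, c, d, i, j)]) = j"
  "obs2 (h @ [(k, c, d, i, j)]) = obs2 h @ [(d, j)]"
  "obs1 (h @ [(k, c, d, i, j)]) = obs1 h @ [(c, i)]"
  "obs2 [] = []" "obs1 [] = []"
  by (auto simp: dsig_def last_k_def last_i_def last_j_def obs2_def obs1_def)

lemma length_dsig [simp]: "length (dsig h) = length h"
  by (simp add: dsig_def)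

lemma map_fst_obs2: "map fst (obs2 h) = rev (dsig h)"
  by (auto simp: obs2_def dsig_def)

locale informed_controller_game =
  fixes g :: "'k::finite \<Rightarrow> 'i::finite \<Rightarrow> 'j::finite \<Rightarrow> real"
    and q :: "'k \<Rightarrow> 'i \<Rightarrow> 'j \<Rightarrow> ('k \<times> 'c::finite \<times> 'd::finite) pmf"
    and khat :: "'c \<Rightarrow> 'k" and dhat :: "'c \<Rightarrow> 'd"
  assumes g_range: "\<And>k i j. 0 \<le> g k i j \<and> g k i j \<le> 1"
    and informed: "\<And>k i j. measure_pmf.prob (q k i j) (info_set khat dhat) = 1"
    and control: "\<And>k i j j'. map_pmf (\<lambda>(k', c, d). (k', d)) (q k i j)
                             = map_pmf (\<lambda>(k', c, d). (k', d)) (q k i j')"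
begin

text \<open>The action of player 2 is frozen at an arbitrary value; \<open>control\<close> shows
  that all values give the same marginal.\<close>

definition Q :: "'k \<Rightarrow> 'i \<Rightarrow> 'k \<Rightarrow> 'd \<Rightarrow> real" where
  "Q k i k' d = pmf (map_pmf state_signal2 (q k i undefined)) (k', d)"

lemma Q_eq: "pmf (map_pmf state_signal2 (q k i j)) (k', d) = Q k i k' d"
  using control[of k i j undefined] by (simp add: Q_def state_signal2_def)

lemma sum_marginal: "(\<Sum>k\<in>UNIV. \<Sum>d\<in>UNIV. pmf (p :: ('k \<times> 'd) pmf) (k, d)) = 1"
  using sum_pmf_UNIV[of p] by (subst (asm) sum_UNIV_prod)

sublocale controlled_flow g Q
  by unfold_locales (use g_range in \<open>auto simp: Q_def sum_marginal\<close>)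

text \<open>Player 2 receives a signal before the first action, so flows of the game start at length
  1 and \<open>hd ds\<close> is that signal. With this shift, histories of length \<open>t\<close>
  belong to stage \<open>t\<close>.\<close>

definition start :: "('k \<times> 'c \<times> 'd) pmf \<Rightarrow> 'd list \<Rightarrow> 'k \<Rightarrow> real" where
  "start \<pi> ds k = pmf (map_pmf state_signal2 \<pi>) (k, hd ds)"

lemma valid_start: "valid 1 (start \<pi>)"
proof -
  have "mass 1 (start \<pi>) = (\<Sum>d\<in>UNIV. \<Sum>k\<in>UNIV. pmf (map_pmf state_signal2 \<pi>) (k, d))"
    unfolding mass_def One_nat_def sum_words_Suc by (simp add: start_def)
  also have "\<dots> = 1" using sum_marginal by (subst sum.swap)
  finally show ?thesis by (auto simp: valid_def nonneg_at_def start_def)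
qed

section \<open>The law of the play for a given pair of strategies\<close>

context
  fixes \<pi> :: "('k \<times> 'c \<times> 'd) pmf" and \<sigma> :: "('c, 'i) strategy" and \<tau> :: "('d, 'j) strategy"
begin

abbreviation E :: "nat \<Rightarrow> (('k, 'i, 'j, 'c, 'd) stage list \<Rightarrow> real) \<Rightarrow> real" where
  "E t \<equiv> measure_pmf.expectation (play_law q \<pi> \<sigma> \<tau> t)"

lemma finite_play: "finite (set_pmf (play_law q \<pi> \<sigma> \<tau> t))"
  by (induction t) (auto simp: split_beta)

lemma length_play: "h \<in> set_pmf (play_law q \<pi> \<sigma> \<tau> t) \<Longrightarrow> length h = t"
  by (induction t arbitrary: h) (auto simp: split_beta)

lemma integrable_play [simp]: "integrable (measure_pmf (play_law q \<pi> \<sigma> \<tau> t)) (f :: _ \<Rightarrow> real)"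
  by (rule integrable_measure_pmf_finite[OF finite_play])

lemma E_cong:
  assumes "\<And>h. h \<in> set_pmf (play_law q \<pi> \<sigma> \<tau> t) \<Longrightarrow> f h = f' h"
  shows "E t f = E t f'"
  by (rule integral_cong_AE) (use assms in \<open>auto simp: AE_measure_pmf_iff\<close>)

lemma E_Suc:
  "E (Suc t) \<phi> = E t (\<lambda>h. measure_pmf.expectation (next_state q \<pi> h) (\<lambda>(k, c, d).
     \<Sum>i\<in>UNIV. pmf (\<sigma> (obs1 h) c) i * (\<Sum>j\<in>UNIV. pmf (\<tau> (obs2 h) d) j * \<phi> (h @ [(k, c, d, i, j)]))))"
  by (simp add: expectation_bind_finite finite_play case_prod_unfold) (simp add: expectation_finite)

lemma E_Suc_signal:
  "E (Suc t) (\<lambda>h. \<psi> (dsig h) (last_k h) (last_i h))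
     = E t (\<lambda>h. measure_pmf.expectation (next_state q \<pi> h)
         (\<lambda>(k, c, d). \<Sum>i\<in>UNIV. pmf (\<sigma> (obs1 h) c) i * \<psi> (d # dsig h) k i))"
  unfolding E_Suc by (simp add: case_prod_unfold flip: sum_distrib_right)

lemma E_Suc_const:
  assumes "\<And>h x. h \<in> set_pmf (play_law q \<pi> \<sigma> \<tau> t) \<Longrightarrow> \<phi> (h @ [x]) = \<psi> h"
  shows "E (Suc t) \<phi> = E t \<psi>"
  unfolding E_Suc by (rule E_cong) (simp add: assms case_prod_unfold flip: sum_distrib_right)

lemma E_coordinate:
  assumes "1 \<le> t" "t \<le> T"
  shows "E T (\<lambda>h. f (h ! (t - 1))) = E t (\<lambda>h. f (last h) :: real)"
  using assms(2)
proof (induction T rule: dec_induct)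
  case base
  show ?case
  proof (rule E_cong)
    fix h assume "h \<in> set_pmf (play_law q \<pi> \<sigma> \<tau> t)"
    then have "length h = t" by (rule length_play)
    then show "f (h ! (t - 1)) = f (last h)" using assms(1) by (subst last_conv_nth) auto
  qed
next
  case (step T)
  have "E (Suc T) (\<lambda>h. f (h ! (t - 1))) = E T (\<lambda>h. f (h ! (t - 1)))"
  proof (rule E_Suc_const)
    fix h x assume "h \<in> set_pmf (play_law q \<pi> \<sigma> \<tau> T)"
    then have "length h = T" by (rule length_play)
    moreover have "t - 1 < T" using step.hyps assms(1) by linarith
    ultimately show "f ((h @ [x]) ! (t - 1)) = f (h ! (t - 1))" by (simp add: nth_append)
  qed
  then show ?case using step by simp
qed

definition stage_mean :: "nat \<Rightarrow> real" where
  "stage_mean t = E t (\<lambda>h. stage_payoff g (last h))"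

lemma E_weighted:
  "E T (\<lambda>h. \<Sum>t=1..T. \<theta> t * stage_payoff g (h ! (t - 1))) = (\<Sum>t=1..T. \<theta> t * stage_mean t)"
proof -
  have "E T (\<lambda>h. \<Sum>t=1..T. \<theta> t * stage_payoff g (h ! (t - 1))) = (\<Sum>t=1..T. \<theta> t * E T (\<lambda>h. stage_payoff g (h ! (t - 1))))"
    by (simp add: Bochner_Integration.integral_sum)
  also have "\<dots> = (\<Sum>t=1..T. \<theta> t * stage_mean t)"
    unfolding stage_mean_def by (intro sum.cong refl arg_cong2[where f = "(*)"] E_coordinate) auto
  finally show ?thesis .
qed

lemma stage_mean_bounds: "0 \<le> stage_mean t" "stage_mean t \<le> 1"
proof -
  have b: "0 \<le> stage_payoff g x" "stage_payoff g x \<le> 1" for x :: "('k, 'i, 'j, 'c, 'd) stage"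
    using g_range by (auto simp: stage_payoff_def split_beta)
  show "0 \<le> stage_mean t" unfolding stage_mean_def by (simp add: b)
  have "stage_mean t \<le> E t (\<lambda>_. 1)" unfolding stage_mean_def by (intro integral_mono) (auto simp: b)
  then show "stage_mean t \<le> 1" by simp
qed

text \<open>The record \<open>\<kappa>\<close> kept of player 2 is a parameter: \<open>dsig\<close>
  yields a flow, while \<open>key2\<close> also remembers his actions. The stage is the length of
  \<open>xs\<close>.\<close>

definition law :: "(('k, 'i, 'j, 'c, 'd) stage list \<Rightarrow> 'x list) \<Rightarrow> 'x list \<Rightarrow> 'k \<Rightarrow> 'i \<Rightarrow> real" where
  "law \<kappa> xs k i = E (length xs) (\<lambda>h. of_bool (\<kappa> h = xs \<and> last_k h = k \<and> last_i h = i))"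

lemma E_law:
  fixes \<kappa> :: "('k, 'i, 'j, 'c, 'd) stage list \<Rightarrow> 'x::finite list"
  assumes \<kappa>: "\<And>h. length (\<kappa> h) = length h"
  shows "E t (\<lambda>h. \<psi> (\<kappa> h) (last_k h) (last_i h))
     = (\<Sum>xs\<in>words t. \<Sum>k\<in>UNIV. \<Sum>i\<in>UNIV. law \<kappa> xs k i * \<psi> xs k i)"
proof -
  have "E t (\<lambda>h. \<psi> (\<kappa> h) (last_k h) (last_i h)) = E t (\<lambda>h. \<Sum>xs\<in>words t. \<Sum>k\<in>UNIV. \<Sum>i\<in>UNIV.
      of_bool (\<kappa> h = xs \<and> last_k h = k \<and> last_i h = i) * \<psi> xs k i)"
  proof (rule E_cong)
    fix h assume "h \<in> set_pmf (play_law q \<pi> \<sigma> \<tau> t)"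
    then have h: "\<kappa> h \<in> words t" by (simp add: length_play \<kappa>)
    have "(\<Sum>xs\<in>words t. \<Sum>k\<in>UNIV. \<Sum>i\<in>UNIV. of_bool (\<kappa> h = xs \<and> last_k h = k \<and> last_i h = i) * \<psi> xs k i)
       = (\<Sum>xs\<in>words t. of_bool (\<kappa> h = xs) * (\<Sum>k\<in>UNIV. of_bool (last_k h = k) * (\<Sum>i\<in>UNIV. of_bool (last_i h = i) * \<psi> xs k i)))"
      unfolding of_bool_conj sum_distrib_left mult.assoc by (rule refl)
    also have "\<dots> = \<psi> (\<kappa> h) (last_k h) (last_i h)"
      unfolding sum_of_bool_eq[OF finite_words h] sum_of_bool_eq[OF finite_class.finite_UNIV UNIV_I] by (rule refl)
    finally show "\<psi> (\<kappa> h) (last_k h) (last_i h) = (\<Sum>xs\<in>words t. \<Sum>k\<in>UNIV. \<Sum>i\<in>UNIV.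
      of_bool (\<kappa> h = xs \<and> last_k h = k \<and> last_i h = i) * \<psi> xs k i)" by simp
  qed
  also have "\<dots> = (\<Sum>xs\<in>words t. \<Sum>k\<in>UNIV. \<Sum>i\<in>UNIV.
      E t (\<lambda>h. of_bool (\<kappa> h = xs \<and> last_k h = k \<and> last_i h = i) * \<psi> xs k i))"
    by (simp only: Bochner_Integration.integral_sum Bochner_Integration.integrable_sum integrable_play)
  also have "\<dots> = (\<Sum>xs\<in>words t. \<Sum>k\<in>UNIV. \<Sum>i\<in>UNIV. law \<kappa> xs k i * \<psi> xs k i)"
    by (intro sum.cong refl) (simp only: in_words law_def integral_mult_left_zero)
  finally show ?thesis .
qed

text \<open>After a nonempty play the next draw comes from \<open>q\<close>, and its marginal
  \<open>Q\<close> depends only on the last state and the last action of player 1. Hence only their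
  joint law with the record enters.\<close>

lemma E_law_next:
  fixes \<kappa> :: "('k, 'i, 'j, 'c, 'd) stage list \<Rightarrow> 'x::finite list"
  assumes \<kappa>: "\<And>h. length (\<kappa> h) = length h" and xs: "xs \<noteq> []"
  shows "E (length xs) (\<lambda>h. of_bool (\<kappa> h = xs) * pmf (map_pmf state_signal2 (next_state q \<pi> h)) (k', d))
     = (\<Sum>k\<in>UNIV. \<Sum>i\<in>UNIV. law \<kappa> xs k i * Q k i k' d)"
proof -
  have "E (length xs) (\<lambda>h. of_bool (\<kappa> h = xs) * pmf (map_pmf state_signal2 (next_state q \<pi> h)) (k', d))
     = E (length xs) (\<lambda>h. of_bool (\<kappa> h = xs) * Q (last_k h) (last_i h) k' d)"
  proof (rule E_cong)
    fix h assume "h \<in> set_pmf (play_law q \<pi> \<sigma> \<tau> (length xs))"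
    then have "h \<noteq> []" using length_play xs by fastforce
    then have "next_state q \<pi> h = q (last_k h) (last_i h) (last_j h)"
      by (simp add: next_state_def last_k_def last_i_def last_j_def split_beta)
    then show "of_bool (\<kappa> h = xs) * pmf (map_pmf state_signal2 (next_state q \<pi> h)) (k', d)
       = of_bool (\<kappa> h = xs) * Q (last_k h) (last_i h) k' d" by (simp add: Q_eq)
  qed
  also have "\<dots> = (\<Sum>ys\<in>words (length xs). \<Sum>k\<in>UNIV. \<Sum>i\<in>UNIV. law \<kappa> ys k i * (of_bool (ys = xs) * Q k i k' d))"
    by (rule E_law[OF \<kappa>])
  also have "\<dots> = (\<Sum>ys\<in>words (length xs). of_bool (xs = ys) * (\<Sum>k\<in>UNIV. \<Sum>i\<in>UNIV. law \<kappa> ys k i * Q k i k' d))"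
    by (auto simp: sum_distrib_left of_bool_def intro!: sum.cong)
  also have "\<dots> = (\<Sum>k\<in>UNIV. \<Sum>i\<in>UNIV. law \<kappa> xs k i * Q k i k' d)"
    by (rule sum_of_bool_eq) auto
  finally show ?thesis .
qed

text \<open>Summing over the action of player 1 erases \<sigma> and leaves the probability of the
  next draw. With \<open>ds = []\<close> this is the initial condition of a flow, otherwise the flow
  equation.\<close>

lemma law_step:
  "(\<Sum>i\<in>UNIV. law dsig (d # ds) k' i)
     = E (length ds) (\<lambda>h. of_bool (dsig h = ds) * pmf (map_pmf state_signal2 (next_state q \<pi> h)) (k', d))"
proof -
  have "(\<Sum>i\<in>UNIV. law dsig (d # ds) k' i)
     = E (Suc (length ds)) (\<lambda>h. \<Sum>i\<in>UNIV. of_bool (dsig h = d # ds \<and> last_k h = k' \<and> last_i h = i))"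
    by (simp only: law_def list.size(4) add_Suc_right add_0_right Bochner_Integration.integral_sum integrable_play)
  also have "\<dots> = E (Suc (length ds)) (\<lambda>h. of_bool (dsig h = d # ds \<and> last_k h = k'))"
  proof (rule E_cong)
    fix h :: "('k, 'i, 'j, 'c, 'd) stage list"
    show "(\<Sum>i\<in>UNIV. of_bool (dsig h = d # ds \<and> last_k h = k' \<and> last_i h = i)) = (of_bool (dsig h = d # ds \<and> last_k h = k') :: real)"
      using sum_of_bool_eq[OF finite_class.finite_UNIV UNIV_I, of "last_i h" "\<lambda>_. 1"]
      by (simp only: of_bool_conj conj_assoc[symmetric] sum_distrib_left[symmetric] mult_1_right)
  qed
  also have "\<dots> = E (length ds) (\<lambda>h. measure_pmf.expectation (next_state q \<pi> h) (\<lambda>(k, c, d').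
      \<Sum>i\<in>UNIV. pmf (\<sigma> (obs1 h) c) i * of_bool (d' # dsig h = d # ds \<and> k = k')))"
    by (rule E_Suc_signal[where \<psi> = "\<lambda>e k i. of_bool (e = d # ds \<and> k = k')"])
  also have "\<dots> = E (length ds) (\<lambda>h. of_bool (dsig h = ds) * pmf (map_pmf state_signal2 (next_state q \<pi> h)) (k', d))"
  proof (rule E_cong)
    fix h :: "('k, 'i, 'j, 'c, 'd) stage list"
    have "(\<lambda>(k, c, d'). \<Sum>i\<in>UNIV. pmf (\<sigma> (obs1 h) c) i * of_bool (d' # dsig h = d # ds \<and> k = k'))
       = (\<lambda>y. of_bool (dsig h = ds) * (of_bool (state_signal2 y = (k', d)) :: real))"
      by (auto simp: fun_eq_iff state_signal2_def simp flip: sum_distrib_right)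
    then show "measure_pmf.expectation (next_state q \<pi> h) (\<lambda>(k, c, d').
        \<Sum>i\<in>UNIV. pmf (\<sigma> (obs1 h) c) i * of_bool (d' # dsig h = d # ds \<and> k = k'))
       = of_bool (dsig h = ds) * pmf (map_pmf state_signal2 (next_state q \<pi> h)) (k', d)"
      by (simp add: pmf_map_eq_expectation)
  qed
  finally show ?thesis .
qed

lemma law_flow: "law dsig \<in> flows 1 (start \<pi>)"
  unfolding flows_def
proof (intro CollectI allI impI conjI)
  fix ds :: "'d list" assume ds: "1 \<le> length ds"
  show "0 \<le> law dsig ds k i" for k i unfolding law_def by simp
  show "(\<Sum>i\<in>UNIV. law dsig ds k i) = start \<pi> ds k" if one: "length ds = 1" for k
  proof -
    obtain d where d: "ds = [d]" using one by (auto simp: length_Suc_conv)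
    show ?thesis unfolding d law_step by (simp add: start_def next_state_def)
  qed
  show "(\<Sum>i\<in>UNIV. law dsig (d # ds) k' i) = (\<Sum>k\<in>UNIV. \<Sum>i\<in>UNIV. law dsig ds k i * Q k i k' d)" for d k'
    unfolding law_step by (rule E_law_next) (use ds in auto)
qed

text \<open>If player 2 uses his signals only, then given \<open>ds\<close> his action is
  independent of the current state and of the action of player 1, so the payoff is linear in the
  flow.\<close>

lemma stage_mean_signal_strategy:
  assumes \<tau>: "\<tau> = (\<lambda>hist d. \<eta> (d # rev (map fst hist)))" and t: "1 \<le> t"
  shows "stage_mean t = (\<Sum>ds\<in>words t. \<Sum>j\<in>UNIV. pmf (\<eta> ds) j * pay (law dsig ds) j)"
proof -
  obtain t' where t': "t = Suc t'" using t by (cases t) auto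
  let ?\<psi> = "\<lambda>ds k i. \<Sum>j\<in>UNIV. pmf (\<eta> ds) j * g k i j"
  have "stage_mean t = E t' (\<lambda>h. measure_pmf.expectation (next_state q \<pi> h) (\<lambda>(k, c, d).
     \<Sum>i\<in>UNIV. pmf (\<sigma> (obs1 h) c) i * ?\<psi> (d # dsig h) k i))"
    unfolding stage_mean_def t' E_Suc by (simp add: \<tau> stage_payoff_def map_fst_obs2)
  also have "\<dots> = E t (\<lambda>h. ?\<psi> (dsig h) (last_k h) (last_i h))"
    unfolding t' by (rule E_Suc_signal[symmetric, where \<psi> = ?\<psi>])
  also have "\<dots> = (\<Sum>ds\<in>words t. \<Sum>k\<in>UNIV. \<Sum>i\<in>UNIV. law dsig ds k i * ?\<psi> ds k i)"
    by (rule E_law[where \<psi> = ?\<psi>]) simp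
  also have "\<dots> = (\<Sum>ds\<in>words t. \<Sum>j\<in>UNIV. pmf (\<eta> ds) j * pay (law dsig ds) j)"
  proof (rule sum.cong[OF refl])
    fix ds
    have "(\<Sum>k\<in>UNIV. \<Sum>i\<in>UNIV. law dsig ds k i * ?\<psi> ds k i)
       = (\<Sum>k\<in>UNIV. \<Sum>i\<in>UNIV. \<Sum>j\<in>UNIV. pmf (\<eta> ds) j * (law dsig ds k i * g k i j))"
      by (simp add: sum_distrib_left mult.left_commute)
    also have "\<dots> = (\<Sum>k\<in>UNIV. \<Sum>j\<in>UNIV. \<Sum>i\<in>UNIV. pmf (\<eta> ds) j * (law dsig ds k i * g k i j))"
      by (intro sum.cong refl) (rule sum.swap)
    also have "\<dots> = (\<Sum>j\<in>UNIV. \<Sum>k\<in>UNIV. \<Sum>i\<in>UNIV. pmf (\<eta> ds) j * (law dsig ds k i * g k i j))"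
      by (rule sum.swap)
    finally show "(\<Sum>k\<in>UNIV. \<Sum>i\<in>UNIV. law dsig ds k i * ?\<psi> ds k i) = (\<Sum>j\<in>UNIV. pmf (\<eta> ds) j * pay (law dsig ds) j)"
      by (simp add: pay_def sum_distrib_left)
  qed
  finally show ?thesis .
qed

text \<open>The contribution of player 2 to the probability of a history of his signals and actions (most
  recent first). The law of (signals and actions of player 2, state, action of player 1) factorises
  into this weight and the flow of player 1, see \<open>joint_eq\<close>.\<close>

primrec wt :: "('d \<times> 'j) list \<Rightarrow> real" where
  "wt [] = 1"
| "wt (x # r) = wt r * pmf (\<tau> (rev r) (fst x)) (snd x)"

lemma wt_nonneg: "0 \<le> wt r"
  by (induction r) auto

text \<open>For each word of signals the weights sum to 1 over the actions of player 2, so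
  remembering his own actions splits a history without changing its total weight.\<close>

lemma sum_wt: "(\<Sum>r\<in>words t. wt r * f (map fst r)) = (\<Sum>ds\<in>words t. f ds)"
proof (induction t arbitrary: f)
  case (Suc t)
  have "(\<Sum>r\<in>words (Suc t). wt r * f (map fst r))
     = (\<Sum>r\<in>words t. \<Sum>d\<in>UNIV. \<Sum>j\<in>UNIV. wt r * pmf (\<tau> (rev r) d) j * f (d # map fst r))"
    by (simp add: sum_words_Suc sum_UNIV_prod)
  also have "\<dots> = (\<Sum>r\<in>words t. wt r * (\<Sum>d\<in>UNIV. f (d # map fst r)))"
  proof (rule sum.cong[OF refl])
    fix r :: "('d \<times> 'j) list"
    have "(\<Sum>j\<in>UNIV. wt r * pmf (\<tau> (rev r) d) j * f (d # map fst r)) = wt r * f (d # map fst r)" for d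
      by (simp flip: sum_distrib_left sum_distrib_right)
    then show "(\<Sum>d\<in>UNIV. \<Sum>j\<in>UNIV. wt r * pmf (\<tau> (rev r) d) j * f (d # map fst r)) = wt r * (\<Sum>d\<in>UNIV. f (d # map fst r))"
      by (simp add: sum_distrib_left)
  qed
  also have "\<dots> = (\<Sum>ds\<in>words t. \<Sum>d\<in>UNIV. f (d # ds))"
    by (rule Suc[of "\<lambda>ds. \<Sum>d\<in>UNIV. f (d # ds)"])
  finally show ?case by (simp add: sum_words_Suc)
qed simp

context
  fixes \<rho> :: "'d list \<Rightarrow> 'k \<Rightarrow> 'i pmf"
  assumes \<pi>: "\<pi> \<in> Delta_E khat dhat"
    and \<sigma>: "\<sigma> = (\<lambda>hist c. \<rho> (dhat c # rev (map (\<lambda>x. dhat (fst x)) hist)) (khat c))"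
begin

lemma next_informed:
  assumes "(k, c, d) \<in> set_pmf (next_state q \<pi> h)"
  shows "khat c = k" "dhat c = d"
proof -
  have sub: "set_pmf p \<subseteq> info_set khat dhat" if "measure_pmf.prob p (info_set khat dhat) = 1" for p
    using that by (subst (asm) measure_pmf.prob_eq_1) (auto simp: AE_measure_pmf_iff)
  have "set_pmf (next_state q \<pi> h) \<subseteq> info_set khat dhat"
    using sub \<pi> informed by (auto simp: next_state_def Delta_E_def split_beta)
  then show "khat c = k" "dhat c = d" using assms by (auto simp: info_set_def)
qed

text \<open>On the support of the play, what player 1 reconstructs through \<open>dhat\<close> is
  the true signal record of player 2, so \<sigma> really plays \<rho> at that record.\<close>

lemma play_informed:
  "h \<in> set_pmf (play_law q \<pi> \<sigma> \<tau> t) \<Longrightarrow> rev (map (\<lambda>x. dhat (fst x)) (obs1 h)) = dsig h"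
proof (induction t arbitrary: h)
  case (Suc t)
  then obtain h' k c d i j where "h' \<in> set_pmf (play_law q \<pi> \<sigma> \<tau> t)" "(k, c, d) \<in> set_pmf (next_state q \<pi> h')"
      "h = h' @ [(k, c, d, i, j)]" by (auto simp: split_beta)
  then show ?case using Suc.IH[of h'] next_informed(2)[of k c d h'] by simp
qed simp

abbreviation "key2 \<equiv> (\<lambda>h. rev (obs2 h))"

text \<open>Given the record \<open>r\<close> and the new state and signal, the two actions are
  drawn independently, from \<rho> and from \<tau>; \<open>next_informed\<close> and
  \<open>play_informed\<close> replace \<sigma> by \<rho> on the support.\<close>

lemma joint_step:
  "law key2 (x # r) k i = pmf (\<rho> (fst x # map fst r) k) i * pmf (\<tau> (rev r) (fst x)) (snd x) *
     E (length r) (\<lambda>h. of_bool (key2 h = r) * pmf (map_pmf state_signal2 (next_state q \<pi> h)) (k, fst x))"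
proof -
  obtain d j where x: "x = (d, j)" by (cases x)
  let ?c = "pmf (\<rho> (d # map fst r) k) i * pmf (\<tau> (rev r) d) j"
  have "law key2 (x # r) k i = E (length r) (\<lambda>h. measure_pmf.expectation (next_state q \<pi> h) (\<lambda>(k', c, d').
     \<Sum>i'\<in>UNIV. pmf (\<sigma> (obs1 h) c) i' * (\<Sum>j'\<in>UNIV. pmf (\<tau> (obs2 h) d') j' *
        of_bool ((d', j') # key2 h = (d, j) # r \<and> k' = k \<and> i' = i))))"
    unfolding law_def x list.size(4) add_Suc_right add_0_right E_Suc by simp
  also have "\<dots> = E (length r) (\<lambda>h. ?c * (of_bool (key2 h = r) * pmf (map_pmf state_signal2 (next_state q \<pi> h)) (k, d)))"
  proof (rule E_cong)
    fix h assume h: "h \<in> set_pmf (play_law q \<pi> \<sigma> \<tau> (length r))"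
    have "(\<Sum>i'\<in>UNIV. pmf (\<sigma> (obs1 h) c) i' * (\<Sum>j'\<in>UNIV. pmf (\<tau> (obs2 h) d') j' *
        of_bool ((d', j') # key2 h = (d, j) # r \<and> k' = k \<and> i' = i)))
       = ?c * (of_bool (key2 h = r) * of_bool (state_signal2 (k', c, d') = (k, d)))"
      if "(k', c, d') \<in> set_pmf (next_state q \<pi> h)" for k' c d'
    proof (cases "key2 h = r \<and> d' = d \<and> k' = k")
      case True
      then have r: "obs2 h = rev r" "map fst r = dsig h" using map_fst_obs2[of h] by (auto simp flip: rev_map)
      have "\<sigma> (obs1 h) c = \<rho> (d # map fst r) k"
        using next_informed[OF that] play_informed[OF h] True r(2) by (simp add: \<sigma>)
      then have "(\<Sum>i'\<in>UNIV. pmf (\<sigma> (obs1 h) c) i' * (\<Sum>j'\<in>UNIV. pmf (\<tau> (obs2 h) d') j' *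
          of_bool ((d', j') # key2 h = (d, j) # r \<and> k' = k \<and> i' = i)))
        = (\<Sum>i'\<in>UNIV. of_bool (i = i') * (\<Sum>j'\<in>UNIV. of_bool (j = j') * (pmf (\<rho> (d # map fst r) k) i' * pmf (\<tau> (rev r) d) j')))"
        using True r(1) by (auto simp: sum_distrib_left of_bool_def intro!: sum.cong)
      also have "\<dots> = ?c" unfolding sum_of_bool_eq[OF finite_class.finite_UNIV UNIV_I] by (rule refl)
      finally show ?thesis using True by (simp add: state_signal2_def)
    qed (auto simp: state_signal2_def)
    then have "measure_pmf.expectation (next_state q \<pi> h) (\<lambda>(k', c, d').
         \<Sum>i'\<in>UNIV. pmf (\<sigma> (obs1 h) c) i' * (\<Sum>j'\<in>UNIV. pmf (\<tau> (obs2 h) d') j' *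
            of_bool ((d', j') # key2 h = (d, j) # r \<and> k' = k \<and> i' = i)))
       = measure_pmf.expectation (next_state q \<pi> h)
           (\<lambda>y. ?c * (of_bool (key2 h = r) * of_bool (state_signal2 y = (k, d))))"
      by (intro integral_cong_AE) (auto simp: AE_measure_pmf_iff)
    then show "measure_pmf.expectation (next_state q \<pi> h) (\<lambda>(k', c, d').
         \<Sum>i'\<in>UNIV. pmf (\<sigma> (obs1 h) c) i' * (\<Sum>j'\<in>UNIV. pmf (\<tau> (obs2 h) d') j' *
            of_bool ((d', j') # key2 h = (d, j) # r \<and> k' = k \<and> i' = i)))
       = ?c * (of_bool (key2 h = r) * pmf (map_pmf state_signal2 (next_state q \<pi> h)) (k, d))"
      by (simp add: pmf_map_eq_expectation)
  qed
  finally show ?thesis by (simp add: x)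
qed

lemma joint_next:
  "E (length r) (\<lambda>h. of_bool (key2 h = r) * pmf (map_pmf state_signal2 (next_state q \<pi> h)) (k, d))
     = wt r * bel \<rho> 1 (start \<pi>) (d # map fst r) k"
proof (induction r arbitrary: k d)
  case Nil
  show ?case by (simp add: start_def next_state_def)
next
  case (Cons x r)
  have "law key2 (x # r) k' i' = wt (x # r) * occ \<rho> 1 (start \<pi>) (fst x # map fst r) k' i'" for k' i'
    unfolding joint_step Cons.IH by (simp add: occ_def)
  then show ?case
    by (subst E_law_next) (simp_all add: occ_def sum_distrib_left mult.assoc obs2_def)
qed

lemma joint_eq:
  "law key2 (x # r) k i = wt (x # r) * occ \<rho> 1 (start \<pi>) (fst x # map fst r) k i"
  unfolding joint_step joint_next by (simp add: occ_def)

text \<open>By the factorisation, the belief of player 2 given his signals and his actions is the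
  one given his signals alone. At each history an average over his actions is at least
  \<open>best\<close>, and \<open>sum_wt\<close> removes the weights.\<close>

lemma stage_mean_ge:
  assumes t: "1 \<le> t"
  shows "R (occ \<rho> 1 (start \<pi>)) t \<le> stage_mean t"
proof -
  obtain t' where t': "t = Suc t'" using t by (cases t) auto
  let ?O = "occ \<rho> 1 (start \<pi>)"
  have "stage_mean t = E t (\<lambda>h. (\<lambda>xs k i. g k i (snd (hd xs))) (key2 h) (last_k h) (last_i h))"
    unfolding stage_mean_def
  proof (rule E_cong)
    fix h assume "h \<in> set_pmf (play_law q \<pi> \<sigma> \<tau> t)"
    then have "h \<noteq> []" using t length_play by fastforce
    then obtain h' k c d i j where "h = h' @ [(k, c, d, i, j)]" by (cases h rule: rev_cases) auto
    then show "stage_payoff g (last h) = (\<lambda>xs k i. g k i (snd (hd xs))) (key2 h) (last_k h) (last_i h)"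
      by (simp add: stage_payoff_def)
  qed
  also have "\<dots> = (\<Sum>xs\<in>words t. \<Sum>k\<in>UNIV. \<Sum>i\<in>UNIV. law key2 xs k i * (\<lambda>xs k i. g k i (snd (hd xs))) xs k i)"
    by (rule E_law) (simp add: obs2_def)
  also have "\<dots> = (\<Sum>r\<in>words t'. \<Sum>x\<in>UNIV. \<Sum>k\<in>UNIV. \<Sum>i\<in>UNIV. law key2 (x # r) k i * g k i (snd x))"
    unfolding t' sum_words_Suc by simp
  also have "\<dots> = (\<Sum>r\<in>words t'. \<Sum>x\<in>UNIV. wt (x # r) * pay (?O (fst x # map fst r)) (snd x))"
    by (simp only: joint_eq pay_def sum_distrib_left mult.assoc)
  also have "\<dots> = (\<Sum>r\<in>words t'. wt r * (\<Sum>d\<in>UNIV. \<Sum>j\<in>UNIV. pmf (\<tau> (rev r) d) j * pay (?O (d # map fst r)) j))"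
    by (simp add: sum_UNIV_prod sum_distrib_left mult.assoc)
  finally have eq: "stage_mean t = (\<Sum>r\<in>words t'. wt r * (\<Sum>d\<in>UNIV. \<Sum>j\<in>UNIV. pmf (\<tau> (rev r) d) j * pay (?O (d # map fst r)) j))" .
  have "R ?O t = (\<Sum>ds\<in>words t'. \<Sum>d\<in>UNIV. best (?O (d # ds)))" unfolding t' R_def sum_words_Suc ..
  also have "\<dots> = (\<Sum>r\<in>words t'. wt r * (\<Sum>d\<in>UNIV. best (?O (d # map fst r))))"
    by (rule sum_wt[symmetric])
  also have "\<dots> \<le> stage_mean t"
    unfolding eq
  proof (intro sum_mono mult_left_mono wt_nonneg)
    fix r :: "('d \<times> 'j) list" and d
    let ?m = "?O (d # map fst r)"
    have "best ?m = (\<Sum>j\<in>UNIV. pmf (\<tau> (rev r) d) j * best ?m)" by (simp flip: sum_distrib_right)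
    also have "\<dots> \<le> (\<Sum>j\<in>UNIV. pmf (\<tau> (rev r) d) j * pay ?m j)"
      by (intro sum_mono mult_left_mono best_le) auto
    finally show "best ?m \<le> (\<Sum>j\<in>UNIV. pmf (\<tau> (rev r) d) j * pay ?m j)" .
  qed
  finally show ?thesis .
qed

end

end

end

section \<open>The values of the game\<close>

lemma sum_le_of_low_blocks:
  fixes a :: "nat \<Rightarrow> real"
  assumes a1: "\<And>s. a s \<le> 1" and "0 \<le> \<alpha>" and n: "1 \<le> n"
    and blocks: "\<And>b. (\<Sum>u<n. a (b * n + u)) \<le> real n * \<alpha>"
  shows "(\<Sum>s<N. a s) \<le> real N * \<alpha> + real n"
proof -
  have full: "(\<Sum>s<b * n. a s) \<le> real (b * n) * \<alpha>" for b
  proof (induction b)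
    case (Suc b)
    have "(\<Sum>s<Suc b * n. a s) = (\<Sum>s<b * n. a s) + (\<Sum>u<n. a (b * n + u))"
      using sum_lessThan_add[of a "b * n" n] by (simp add: add.commute)
    then show ?case using Suc blocks[of b] by (simp add: algebra_simps)
  qed simp
  have "(\<Sum>s<N. a s) = (\<Sum>s<N div n * n. a s) + (\<Sum>u<N mod n. a (N div n * n + u))"
    using sum_lessThan_add[of a "N div n * n" "N mod n"] by simp
  also have "(\<Sum>s<N div n * n. a s) \<le> real (N div n * n) * \<alpha>" by (rule full)
  also have "\<dots> \<le> real N * \<alpha>" by (intro mult_right_mono \<open>0 \<le> \<alpha>\<close>) (simp only: of_nat_le_iff div_times_less_eq_dividend)
  also have "(\<Sum>u<N mod n. a (N div n * n + u)) \<le> (\<Sum>u<N mod n. 1)" by (intro sum_mono a1)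
  also have "\<dots> \<le> real n" using n by (simp add: less_imp_le)
  finally show ?thesis by simp
qed

lemma sum_shifted_window:
  fixes h :: "nat \<Rightarrow> real"
  assumes "\<And>t. t \<le> m \<Longrightarrow> h t = 0"
  shows "(\<Sum>t=1..m + n. h t) = (\<Sum>s<n. h (1 + m + s))"
proof -
  have "(\<Sum>t=1..m + n. h t) = (\<Sum>s<m + n. h (1 + s))"
    by (rule sum.reindex_bij_witness[where i = "\<lambda>s. 1 + s" and j = "\<lambda>t. t - 1"]) auto
  also have "\<dots> = (\<Sum>s<n. h (1 + m + s))"
    using assms by (simp add: sum_lessThan_add add.assoc)
  finally show ?thesis .
qed

lemma sum_up_to_Max_support:
  fixes \<theta> :: "nat \<Rightarrow> real"
  assumes N: "\<And>t. N < t \<Longrightarrow> \<theta> t = 0"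
  shows "(\<Sum>t=1..Max {t. \<theta> t \<noteq> 0}. \<theta> t * a t) = (\<Sum>t=1..N. \<theta> t * a t)"
proof (cases "{t. \<theta> t \<noteq> 0} = {}")
  \<comment> \<open>The maximum of the empty support is unspecified, but then every term of both
    sums is 0.\<close>
  case True
  then have "\<theta> t = 0" for t by blast
  then show ?thesis by simp
next
  case False
  have "{t. \<theta> t \<noteq> 0} \<subseteq> {..N}" using N by (auto simp: not_less[symmetric])
  then have fin: "finite {t. \<theta> t \<noteq> 0}" by (rule finite_subset) simp
  have "Max {t. \<theta> t \<noteq> 0} \<in> {t. \<theta> t \<noteq> 0}" by (rule Max_in[OF fin False])
  then have "Max {t. \<theta> t \<noteq> 0} \<le> N" using N by (force simp: not_less[symmetric])
  then show ?thesis
    using Max_ge[OF fin] by (intro sum.mono_neutral_left) (auto, fastforce)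
qed

lemma is_valueI:
  fixes \<gamma> :: "'s \<Rightarrow> 't \<Rightarrow> real"
  assumes b: "\<And>\<sigma> \<tau>. a \<le> \<gamma> \<sigma> \<tau>" "\<And>\<sigma> \<tau>. \<gamma> \<sigma> \<tau> \<le> b"
    and low: "\<And>e. 0 < e \<Longrightarrow> \<exists>\<sigma>. \<forall>\<tau>. v - e \<le> \<gamma> \<sigma> \<tau>" and up: "\<And>\<sigma>. \<gamma> \<sigma> \<tau>0 \<le> v"
  shows "is_value \<gamma> v"
proof -
  have I: "(INF \<tau>. \<gamma> \<sigma> \<tau>) \<le> \<gamma> \<sigma> \<tau>" for \<sigma> \<tau> by (intro cINF_lower bdd_belowI2[of _ a] b) auto
  have S: "\<gamma> \<sigma> \<tau> \<le> (SUP \<sigma>. \<gamma> \<sigma> \<tau>)" for \<sigma> \<tau> by (intro cSUP_upper bdd_aboveI2[of _ _ b] b) auto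
  have IS: "(INF \<tau>. \<gamma> \<sigma> \<tau>) \<le> (SUP \<sigma>. INF \<tau>. \<gamma> \<sigma> \<tau>)" for \<sigma>
    by (intro cSUP_upper bdd_aboveI2[of _ _ b]) (auto intro: order_trans[OF I b(2)])
  have SI: "(INF \<tau>. SUP \<sigma>. \<gamma> \<sigma> \<tau>) \<le> (SUP \<sigma>. \<gamma> \<sigma> \<tau>)" for \<tau>
    by (intro cINF_lower bdd_belowI2[of _ a]) (auto intro: order_trans[OF b(1) S])
  have "(SUP \<sigma>. INF \<tau>. \<gamma> \<sigma> \<tau>) \<le> v" by (rule cSUP_least) (auto intro: order_trans[OF I up])
  moreover have "(INF \<tau>. SUP \<sigma>. \<gamma> \<sigma> \<tau>) \<le> v"
    by (rule order_trans[OF SI[of \<tau>0]]) (rule cSUP_least, auto intro: up)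
  moreover have "v \<le> (SUP \<sigma>. INF \<tau>. \<gamma> \<sigma> \<tau>)"
  proof (rule field_le_epsilon)
    fix e :: real assume "0 < e"
    then obtain \<sigma> where "\<And>\<tau>. v - e \<le> \<gamma> \<sigma> \<tau>" using low by blast
    then have "v - e \<le> (INF \<tau>. \<gamma> \<sigma> \<tau>)" by (intro cINF_greatest) auto
    then show "v \<le> (SUP \<sigma>. INF \<tau>. \<gamma> \<sigma> \<tau>) + e" using IS[of \<sigma>] by linarith
  qed
  moreover have "v \<le> (INF \<tau>. SUP \<sigma>. \<gamma> \<sigma> \<tau>)"
  proof (rule field_le_epsilon)
    fix e :: real assume "0 < e"
    then obtain \<sigma> where \<sigma>: "\<And>\<tau>. v - e \<le> \<gamma> \<sigma> \<tau>" using low by blast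
    have "v - e \<le> (INF \<tau>. SUP \<sigma>. \<gamma> \<sigma> \<tau>)" by (rule cINF_greatest) (auto intro: order_trans[OF \<sigma> S])
    then show "v \<le> (INF \<tau>. SUP \<sigma>. \<gamma> \<sigma> \<tau>) + e" by linarith
  qed
  ultimately show ?thesis unfolding is_value_def by (intro conjI antisym)
qed

lemma the_value_eq: "is_value \<gamma> v \<Longrightarrow> (THE v. is_value \<gamma> v) = v"
  by (rule the_equality) (auto simp: is_value_def)

context informed_controller_game
begin

section \<open>Game values as suprema over flows\<close>

lemma payoff_eq:
  assumes "\<And>t. N < t \<Longrightarrow> \<theta> t = 0"
  shows "payoff g q \<theta> \<pi> \<sigma> \<tau> = (\<Sum>t=1..N. \<theta> t * stage_mean \<pi> \<sigma> \<tau> t)"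
  unfolding payoff_def Let_def E_weighted by (rule sum_up_to_Max_support[OF assms])

lemma avg_payoff_eq: "avg_payoff g q n \<pi> \<sigma> \<tau> = (\<Sum>s<n. stage_mean \<pi> \<sigma> \<tau> (1 + s)) / real n"
proof -
  have "avg_payoff g q n \<pi> \<sigma> \<tau> = (\<Sum>t=1..0 + n. 1 / real n * stage_mean \<pi> \<sigma> \<tau> t)"
    unfolding avg_payoff_def using E_weighted[of \<pi> \<sigma> \<tau> n "\<lambda>_. 1 / real n"]
    by (simp only: sum_distrib_left add_0)
  also have "\<dots> = (\<Sum>t=1..0 + n. (if t = 0 then 0 else stage_mean \<pi> \<sigma> \<tau> t)) / real n"
    unfolding sum_divide_distrib by (intro sum.cong) auto
  also have "(\<Sum>t=1..0 + n. (if t = 0 then 0 else stage_mean \<pi> \<sigma> \<tau> t)) = (\<Sum>s<n. stage_mean \<pi> \<sigma> \<tau> (1 + s))"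
    by (subst sum_shifted_window) auto
  finally show ?thesis .
qed

lemma avg_payoff_bounds: "0 \<le> avg_payoff g q n \<pi> \<sigma> \<tau>" "avg_payoff g q n \<pi> \<sigma> \<tau> \<le> 1"
proof -
  show "0 \<le> avg_payoff g q n \<pi> \<sigma> \<tau>"
    unfolding avg_payoff_eq by (intro divide_nonneg_nonneg sum_nonneg stage_mean_bounds) auto
  have "(\<Sum>s<n. stage_mean \<pi> \<sigma> \<tau> (1 + s)) \<le> (\<Sum>s<n. 1)" by (intro sum_mono stage_mean_bounds)
  then show "avg_payoff g q n \<pi> \<sigma> \<tau> \<le> 1" unfolding avg_payoff_eq by (cases "n = 0") auto
qed

lemma flow_strategy:
  assumes \<pi>: "\<pi> \<in> Delta_E khat dhat" and M: "M \<in> flows 1 (start \<pi>)"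
  shows "\<exists>\<sigma>. \<forall>\<tau> t. 1 \<le> t \<longrightarrow> R M t \<le> stage_mean \<pi> \<sigma> \<tau> t"
proof -
  obtain \<rho> where \<rho>: "\<And>ds. 1 \<le> length ds \<Longrightarrow> M ds = occ \<rho> 1 (start \<pi>) ds" using flow_eq_occ[OF M] by blast
  have "R M t = R (occ \<rho> 1 (start \<pi>)) t" if "1 \<le> t" for t
    unfolding R_def using that \<rho> by (intro sum.cong) auto
  then show ?thesis using stage_mean_ge[OF \<pi> refl, of _ \<rho>] by auto
qed

text \<open>Player 1 plays a nearly optimal flow, which secures \<open>R M t\<close> at each stage
  against every \<tau>. Player 2 plays the \<eta> of \<open>minimax_actions\<close>, and every
  \<sigma> against it produces a flow.\<close>

lemma game_value_eq:
  assumes \<pi>: "\<pi> \<in> Delta_E khat dhat" and \<theta>: "\<And>t. 0 \<le> \<theta> t" and N: "\<And>t. N < t \<Longrightarrow> \<theta> t = 0"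
  shows "game_value g q \<theta> \<pi> = (SUP M\<in>flows 1 (start \<pi>). \<Sum>t=1..N. \<theta> t * R M t)"
proof -
  let ?F = "flows 1 (start \<pi>)" and ?f = "\<lambda>M. \<Sum>t=1..N. \<theta> t * R M t"
  define v where "v = (SUP M\<in>?F. ?f M)"
  have ne: "?F \<noteq> {}" by (rule flows_ne[OF valid_start])
  have "?f M \<le> (\<Sum>t=1..N. \<theta> t)" if M: "M \<in> ?F" for M
  proof (rule sum_mono)
    fix t assume "t \<in> {1..N}"
    then have "R M t \<le> 1" using R_le_mass[OF M, of t] valid_start[of \<pi>] by (auto simp: valid_def)
    then show "\<theta> t * R M t \<le> \<theta> t" using \<theta> by (intro mult_left_le) auto
  qed
  then have bdd: "bdd_above (?f ` ?F)" by (rule bdd_aboveI2)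
  have le_v: "?f M \<le> v" if "M \<in> ?F" for M unfolding v_def by (rule cSUP_upper[OF that bdd])
  obtain \<eta> :: "'d list \<Rightarrow> 'j pmf" where \<eta>: "\<And>M. M \<in> ?F \<Longrightarrow>
      (\<Sum>t=1..N. \<theta> t * (\<Sum>ds\<in>words t. \<Sum>j\<in>UNIV. pmf (\<eta> ds) j * pay (M ds) j)) \<le> v"
    using minimax_actions[OF \<theta> le_v] by blast
  have pay: "payoff g q \<theta> \<pi> \<sigma> \<tau> = (\<Sum>t=1..N. \<theta> t * stage_mean \<pi> \<sigma> \<tau> t)" for \<sigma> \<tau>
    by (rule payoff_eq) (rule N)
  have "is_value (payoff g q \<theta> \<pi>) v"
  proof (rule is_valueI)
    fix \<sigma> \<tau>
    show "0 \<le> payoff g q \<theta> \<pi> \<sigma> \<tau>"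
      unfolding pay by (intro sum_nonneg mult_nonneg_nonneg \<theta> stage_mean_bounds)
    show "payoff g q \<theta> \<pi> \<sigma> \<tau> \<le> (\<Sum>t=1..N. \<theta> t)"
      unfolding pay by (intro sum_mono mult_left_le \<theta> stage_mean_bounds)
  next
    fix e :: real assume e: "0 < e"
    have "\<exists>M\<in>?F. v - e < ?f M" unfolding v_def by (subst less_cSUP_iff[symmetric]) (use e ne bdd in auto)
    then obtain M where M: "M \<in> ?F" "v - e < ?f M" by blast
    obtain \<sigma> where \<sigma>: "\<And>\<tau> t. 1 \<le> t \<Longrightarrow> R M t \<le> stage_mean \<pi> \<sigma> \<tau> t" using flow_strategy[OF \<pi> M(1)] by blast
    have "?f M \<le> payoff g q \<theta> \<pi> \<sigma> \<tau>" for \<tau>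
      unfolding pay by (intro sum_mono mult_left_mono \<theta> \<sigma>) auto
    then show "\<exists>\<sigma>. \<forall>\<tau>. v - e \<le> payoff g q \<theta> \<pi> \<sigma> \<tau>" using M(2) by (intro exI[of _ \<sigma>]) (auto intro: less_imp_le less_le_trans)
  next
    fix \<sigma>
    let ?\<tau> = "\<lambda>hist d. \<eta> (d # rev (map fst hist))"
    have "payoff g q \<theta> \<pi> \<sigma> ?\<tau> = (\<Sum>t=1..N. \<theta> t * (\<Sum>ds\<in>words t. \<Sum>j\<in>UNIV. pmf (\<eta> ds) j * pay (law \<pi> \<sigma> ?\<tau> dsig ds) j))"
      unfolding pay
      by (intro sum.cong refl arg_cong2[where f = "(*)"] stage_mean_signal_strategy[OF refl]) auto
    also have "\<dots> \<le> v" by (rule \<eta>[OF law_flow])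
    finally show "payoff g q \<theta> \<pi> \<sigma> ?\<tau> \<le> v" .
  qed
  then show ?thesis unfolding game_value_def v_def by (rule the_value_eq)
qed

lemma unif_weights_sum:
  "(\<Sum>t=1..m + n. unif_weights m n t * f t) = (\<Sum>s<n. f (1 + m + s)) / real n"
  by (subst sum_shifted_window) (auto simp: unif_weights_def sum_divide_distrib)

lemma v_mn_eq:
  assumes "\<pi> \<in> Delta_E khat dhat"
  shows "v_mn g q m n \<pi> = v_flow m n 1 (start \<pi>)"
  unfolding v_mn_def
  by (subst game_value_eq[OF assms, where N = "m + n"])
     (simp_all only: unif_weights_sum v_flow_def A_def, auto simp: unif_weights_def)

text \<open>For each \<theta> the game value is the supremum of a \<theta>-mixture of averages,
  hence at least that of the minimal average; the dual weights of \<open>minimax_averages\<close>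
  give equality.\<close>

lemma w_mn_eq:
  assumes \<pi>: "\<pi> \<in> Delta_E khat dhat" and n: "1 \<le> n"
  shows "w_mn g q m n \<pi> = w_flow m n 1 (start \<pi>)"
proof -
  let ?F = "flows 1 (start \<pi>)"
  have ne: "?F \<noteq> {}" by (rule flows_ne[OF valid_start])
  have gv: "game_value g q (shift_weights m n \<theta>) \<pi> = (SUP M\<in>?F. \<Sum>t=1..n. \<theta> t * A M (1 + m) t)"
    if \<theta>: "\<theta> \<in> prob_weights n" for \<theta>
  proof -
    have "game_value g q (shift_weights m n \<theta>) \<pi> = (SUP M\<in>?F. \<Sum>t=1..m + n. shift_weights m n \<theta> t * R M t)"
      using \<theta> by (intro game_value_eq \<pi>) (auto simp: shift_weights_def prob_weights_def intro!: sum_nonneg)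
    moreover have "(\<Sum>t=1..m + n. shift_weights m n \<theta> t * R M t) = (\<Sum>t=1..n. \<theta> t * A M (1 + m) t)" for M
    proof -
      have "(\<Sum>t=1..m + n. shift_weights m n \<theta> t * R M t) = (\<Sum>s<n. shift_weights m n \<theta> (1 + m + s) * R M (1 + m + s))"
        by (rule sum_shifted_window) (simp add: shift_weights_def)
      also have "\<dots> = (\<Sum>s<n. (\<Sum>t=Suc s..n. \<theta> t / real t) * R M (1 + m + s))"
        by (rule sum.cong) (auto simp: shift_weights_def)
      finally show ?thesis unfolding weighted_average_eq .
    qed
    ultimately show ?thesis by (simp only:)
  qed
  have bdd: "bdd_above ((\<lambda>M. \<Sum>t=1..n. \<theta> t * A M (1 + m) t) ` ?F)" if \<theta>: "\<theta> \<in> prob_weights n" for \<theta>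
  proof (rule bdd_aboveI2)
    fix M assume M: "M \<in> ?F"
    show "(\<Sum>t=1..n. \<theta> t * A M (1 + m) t) \<le> (\<Sum>t=1..n. \<theta> t)"
      using \<theta> A_bounds[OF M valid_start] by (intro sum_mono mult_left_le) (auto simp: prob_weights_def)
  qed
  have ge: "w_flow m n 1 (start \<pi>) \<le> game_value g q (shift_weights m n \<theta>) \<pi>" if \<theta>: "\<theta> \<in> prob_weights n" for \<theta>
    unfolding gv[OF \<theta>] w_flow_def
  proof (rule cSUP_mono[OF ne bdd[OF \<theta>]], rule bexI)
    fix M assume "M \<in> ?F"
    then show "M \<in> ?F" .
    have "minavg M (1 + m) n = (\<Sum>t=1..n. \<theta> t * minavg M (1 + m) n)"
      using \<theta> by (simp add: prob_weights_def flip: sum_distrib_right)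
    also have "\<dots> \<le> (\<Sum>t=1..n. \<theta> t * A M (1 + m) t)"
      using \<theta> by (intro sum_mono mult_left_mono minavg_le) (auto simp: prob_weights_def)
    finally show "minavg M (1 + m) n \<le> (\<Sum>t=1..n. \<theta> t * A M (1 + m) t)" .
  qed
  obtain \<theta> where \<theta>: "\<theta> \<in> prob_weights n"
      "\<And>M. M \<in> ?F \<Longrightarrow> (\<Sum>t=1..n. \<theta> t * A M (1 + m) t) \<le> w_flow m n 1 (start \<pi>)"
    using minimax_averages[OF n minavg_le_w_flow[OF valid_start n]] by blast
  show ?thesis unfolding w_mn_def
  proof (rule antisym)
    have "(INF \<theta>\<in>prob_weights n. game_value g q (shift_weights m n \<theta>) \<pi>) \<le> game_value g q (shift_weights m n \<theta>) \<pi>"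
      by (intro cINF_lower bdd_belowI2 \<theta>(1)) (rule ge)
    also have "\<dots> \<le> w_flow m n 1 (start \<pi>)" unfolding gv[OF \<theta>(1)] by (rule cSUP_least[OF ne \<theta>(2)])
    finally show "(INF \<theta>\<in>prob_weights n. game_value g q (shift_weights m n \<theta>) \<pi>) \<le> w_flow m n 1 (start \<pi>)" .
    show "w_flow m n 1 (start \<pi>) \<le> (INF \<theta>\<in>prob_weights n. game_value g q (shift_weights m n \<theta>) \<pi>)"
      by (rule cINF_greatest) (use \<theta>(1) ge in auto)
  qed
qed

section \<open>Guarantees of both players in the long game\<close>

lemma lower_unif_value_ge:
  assumes \<pi>: "\<pi> \<in> Delta_E khat dhat"
  shows "ereal (v_star 1 (start \<pi>)) \<le> lower_unif_value g q \<pi>"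
proof (rule ereal_le_epsilon2)
  fix e :: real assume e: "0 < e"
  let ?v = "v_star 1 (start \<pi>)"
  obtain m M where M: "M \<in> flows 1 (start \<pi>)" "\<And>t. 1 \<le> t \<Longrightarrow> ?v - e \<le> A M (1 + m) t"
    using flow_near_v_star[OF valid_start e] by blast
  obtain \<sigma> where \<sigma>: "\<And>\<tau> t. 1 \<le> t \<Longrightarrow> R M t \<le> stage_mean \<pi> \<sigma> \<tau> t" using flow_strategy[OF \<pi> M(1)] by blast
  have c: "?v - e \<le> 1" using v_star_le_1[OF valid_start, of \<pi>] e by linarith
  have start_ge: "?v - e - real m / real N \<le> A M 1 N" if "1 \<le> N" for N
    by (rule average_from_start_ge[OF M(1) valid_start c _ that]) (rule M(2))
  have "?v - e - real m / real N \<le> (INF \<tau>. avg_payoff g q N \<pi> \<sigma> \<tau>)" if N: "1 \<le> N" for N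
  proof (rule cINF_greatest)
    fix \<tau>
    have "A M 1 N \<le> avg_payoff g q N \<pi> \<sigma> \<tau>"
      unfolding avg_payoff_eq A_def by (intro divide_right_mono sum_mono \<sigma>) auto
    then show "?v - e - real m / real N \<le> avg_payoff g q N \<pi> \<sigma> \<tau>" using start_ge[OF N] by linarith
  qed simp
  then have ev: "\<forall>\<^sub>F N in sequentially. ereal (?v - e - real m / real N) \<le> ereal (INF \<tau>. avg_payoff g q N \<pi> \<sigma> \<tau>)"
    by (intro eventually_sequentiallyI[of 1]) simp
  have "(\<lambda>N. ereal (?v - e - real m / real N)) \<longlonglongrightarrow> ereal (?v - e - 0)"
    by (intro tendsto_ereal tendsto_diff tendsto_const lim_const_over_n)
  from lim_imp_Liminf[OF trivial_limit_sequentially this]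
  have "ereal (?v - e) = liminf (\<lambda>N. ereal (?v - e - real m / real N))" by simp
  also have "\<dots> \<le> liminf (\<lambda>N. ereal (INF \<tau>. avg_payoff g q N \<pi> \<sigma> \<tau>))" by (rule Liminf_mono[OF ev])
  also have "\<dots> \<le> lower_unif_value g q \<pi>" unfolding lower_unif_value_def by (rule SUP_upper) simp
  finally have "ereal (?v - e) + ereal e \<le> lower_unif_value g q \<pi> + ereal e" by (rule add_right_mono)
  then show "ereal ?v \<le> lower_unif_value g q \<pi> + ereal e" by simp
qed

text \<open>On each block of \<open>n\<close> stages player 2 plays an optimal strategy of the game whose payoff is the
  average over this block. Such a strategy only uses his signals, so it does not matter that he
  played differently before the block.\<close>

lemma block_strategy:
  assumes n: "1 \<le> n"
  shows "\<exists>\<tau>. \<forall>\<sigma> N. 1 \<le> N \<longrightarrow>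
    avg_payoff g q N \<pi> \<sigma> \<tau> \<le> (SUP m. v_flow m n 1 (start \<pi>)) + real n / real N"
proof -
  let ?F = "flows 1 (start \<pi>)" and ?\<alpha> = "SUP m. v_flow m n 1 (start \<pi>)"
  have "\<exists>\<eta> :: 'd list \<Rightarrow> 'j pmf. \<forall>M\<in>?F. (\<Sum>t=1..m + n. unif_weights m n t *
      (\<Sum>ds\<in>words t. \<Sum>j\<in>UNIV. pmf (\<eta> ds) j * pay (M ds) j)) \<le> v_flow m n 1 (start \<pi>)" for m
  proof (rule minimax_actions)
    show "0 \<le> unif_weights m n t" for t by (simp add: unif_weights_def)
    show "(\<Sum>t=1..m + n. unif_weights m n t * R M t) \<le> v_flow m n 1 (start \<pi>)" if "M \<in> ?F" for M
      using A_le_v_flow[OF valid_start that] unfolding unif_weights_sum A_def .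
  qed
  then have "\<forall>m. \<exists>\<eta> :: 'd list \<Rightarrow> 'j pmf. \<forall>M\<in>?F. (\<Sum>s<n. \<Sum>ds\<in>words (1 + m + s).
      \<Sum>j\<in>UNIV. pmf (\<eta> ds) j * pay (M ds) j) / real n \<le> v_flow m n 1 (start \<pi>)"
    unfolding unif_weights_sum by blast
  then obtain \<eta> :: "nat \<Rightarrow> 'd list \<Rightarrow> 'j pmf" where \<eta>: "\<And>m M. M \<in> ?F \<Longrightarrow> (\<Sum>s<n. \<Sum>ds\<in>words (1 + m + s).
      \<Sum>j\<in>UNIV. pmf (\<eta> m ds) j * pay (M ds) j) / real n \<le> v_flow m n 1 (start \<pi>)"
    unfolding choice_iff by blast
  have le_\<alpha>: "v_flow m n 1 (start \<pi>) \<le> ?\<alpha>" for m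
    by (intro cSUP_upper bdd_aboveI2[of _ _ 1] v_flow_le_1 valid_start) auto
  have \<alpha>0: "0 \<le> ?\<alpha>"
    using w_flow_nonneg[OF valid_start n, of 0 \<pi>] w_flow_le_v_flow[OF valid_start n, of 0 \<pi>] le_\<alpha>[of 0] by linarith
  \<comment> \<open>A history of length \<open>t\<close> includes the current signal, so
    \<open>t - 1\<close> stages precede it; the rounding gives the number of stages before its
    block, which is the index of the plan for that block.\<close>
  define \<eta>' where "\<eta>' ds = \<eta> ((length ds - 1) div n * n) ds" for ds
  define \<tau> :: "('d, 'j) strategy" where "\<tau> = (\<lambda>hist d. \<eta>' (d # rev (map fst hist)))"
  show ?thesis
  proof (intro exI[of _ \<tau>] allI impI)
    fix \<sigma> and N :: nat assume N: "1 \<le> N"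
    have "(\<Sum>s<N. stage_mean \<pi> \<sigma> \<tau> (1 + s)) \<le> real N * ?\<alpha> + real n"
    proof (rule sum_le_of_low_blocks[OF _ \<alpha>0 n])
      fix b
      have "(\<Sum>u<n. stage_mean \<pi> \<sigma> \<tau> (1 + (b * n + u))) = (\<Sum>u<n. \<Sum>ds\<in>words (1 + b * n + u).
          \<Sum>j\<in>UNIV. pmf (\<eta> (b * n) ds) j * pay (law \<pi> \<sigma> \<tau> dsig ds) j)"
      proof (rule sum.cong[OF refl])
        fix u assume u: "u \<in> {..<n}"
        have "stage_mean \<pi> \<sigma> \<tau> (1 + b * n + u) = (\<Sum>ds\<in>words (1 + b * n + u).
            \<Sum>j\<in>UNIV. pmf (\<eta>' ds) j * pay (law \<pi> \<sigma> \<tau> dsig ds) j)"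
          by (rule stage_mean_signal_strategy[OF \<tau>_def]) simp
        also have "\<dots> = (\<Sum>ds\<in>words (1 + b * n + u). \<Sum>j\<in>UNIV. pmf (\<eta> (b * n) ds) j * pay (law \<pi> \<sigma> \<tau> dsig ds) j)"
        proof (rule sum.cong[OF refl])
          fix ds :: "'d list" assume "ds \<in> words (1 + b * n + u)"
          then have "\<eta>' ds = \<eta> (b * n) ds" using u n by (simp add: \<eta>'_def)
          then show "(\<Sum>j\<in>UNIV. pmf (\<eta>' ds) j * pay (law \<pi> \<sigma> \<tau> dsig ds) j)
             = (\<Sum>j\<in>UNIV. pmf (\<eta> (b * n) ds) j * pay (law \<pi> \<sigma> \<tau> dsig ds) j)" by simp
        qed
        finally show "stage_mean \<pi> \<sigma> \<tau> (1 + (b * n + u)) = (\<Sum>ds\<in>words (1 + b * n + u).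
          \<Sum>j\<in>UNIV. pmf (\<eta> (b * n) ds) j * pay (law \<pi> \<sigma> \<tau> dsig ds) j)" by (simp only: add.assoc)
      qed
      also have "\<dots> \<le> real n * ?\<alpha>"
        using order_trans[OF \<eta>[OF law_flow, of "b * n" \<sigma> \<tau>] le_\<alpha>] n by (simp add: field_simps)
      finally show "(\<Sum>u<n. stage_mean \<pi> \<sigma> \<tau> (1 + (b * n + u))) \<le> real n * ?\<alpha>" .
    qed (rule stage_mean_bounds)
    then show "avg_payoff g q N \<pi> \<sigma> \<tau> \<le> ?\<alpha> + real n / real N"
      using N unfolding avg_payoff_eq by (simp add: field_simps)
  qed
qed

lemma upper_unif_value_le_SUP:
  assumes n: "1 \<le> n"
  shows "upper_unif_value g q \<pi> \<le> ereal (SUP m. v_flow m n 1 (start \<pi>))"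
proof -
  let ?\<alpha> = "SUP m. v_flow m n 1 (start \<pi>)"
  obtain \<tau> where \<tau>: "\<And>\<sigma> N. 1 \<le> N \<Longrightarrow> avg_payoff g q N \<pi> \<sigma> \<tau> \<le> ?\<alpha> + real n / real N"
    using block_strategy[OF n] by blast
  have "ereal (SUP \<sigma>. avg_payoff g q N \<pi> \<sigma> \<tau>) \<le> ereal (?\<alpha> + real n / real N)" if "1 \<le> N" for N
    unfolding ereal_less_eq(3) by (rule cSUP_least) (use \<tau>[OF that] in auto)
  then have ev: "\<forall>\<^sub>F N in sequentially. ereal (SUP \<sigma>. avg_payoff g q N \<pi> \<sigma> \<tau>) \<le> ereal (?\<alpha> + real n / real N)"
    by (rule eventually_sequentiallyI)
  have "upper_unif_value g q \<pi> \<le> limsup (\<lambda>N. ereal (SUP \<sigma>. avg_payoff g q N \<pi> \<sigma> \<tau>))"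
    unfolding upper_unif_value_def by (rule INF_lower) simp
  also have "\<dots> \<le> limsup (\<lambda>N. ereal (?\<alpha> + real n / real N))" by (rule Limsup_mono[OF ev])
  also have "\<dots> = ereal (?\<alpha> + 0)"
    by (intro lim_imp_Limsup tendsto_ereal tendsto_add tendsto_const lim_const_over_n) simp
  finally show ?thesis by simp
qed

lemma upper_unif_value_le: "upper_unif_value g q \<pi> \<le> ereal (v_star 1 (start \<pi>))"
proof (rule ereal_le_epsilon2)
  fix e :: real assume e: "0 < e"
  have "\<exists>n\<ge>1. (SUP m. v_flow m n 1 (start \<pi>)) < v_star 1 (start \<pi>) + e"
  proof (rule ccontr)
    assume "\<not> ?thesis"
    then have "v_star 1 (start \<pi>) + e \<le> (INF n\<in>{1..}. SUP m. v_flow m n 1 (start \<pi>))"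
      by (intro cINF_greatest) (auto simp: not_less)
    then show False using e unfolding v_star_eqs(1)[OF valid_start, symmetric] by simp
  qed
  then obtain n where "1 \<le> n" "(SUP m. v_flow m n 1 (start \<pi>)) < v_star 1 (start \<pi>) + e" by blast
  then show "upper_unif_value g q \<pi> \<le> ereal (v_star 1 (start \<pi>)) + ereal e"
    using upper_unif_value_le_SUP[of n \<pi>] by (auto intro: order_trans)
qed

lemma lower_le_upper_unif_value: "lower_unif_value g q \<pi> \<le> upper_unif_value g q \<pi>"
  unfolding lower_unif_value_def upper_unif_value_def
proof (intro SUP_least INF_greatest)
  fix \<sigma> \<tau>
  have "(INF \<tau>. avg_payoff g q n \<pi> \<sigma> \<tau>) \<le> (SUP \<sigma>. avg_payoff g q n \<pi> \<sigma> \<tau>)" for n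
  proof (rule order_trans)
    show "(INF \<tau>. avg_payoff g q n \<pi> \<sigma> \<tau>) \<le> avg_payoff g q n \<pi> \<sigma> \<tau>"
      by (intro cINF_lower bdd_belowI2[of _ 0] avg_payoff_bounds) auto
    show "avg_payoff g q n \<pi> \<sigma> \<tau> \<le> (SUP \<sigma>. avg_payoff g q n \<pi> \<sigma> \<tau>)"
      by (intro cSUP_upper bdd_aboveI2[of _ _ 1] avg_payoff_bounds) auto
  qed
  then have "liminf (\<lambda>n. ereal (INF \<tau>. avg_payoff g q n \<pi> \<sigma> \<tau>)) \<le> liminf (\<lambda>n. ereal (SUP \<sigma>. avg_payoff g q n \<pi> \<sigma> \<tau>))"
    by (intro Liminf_mono) simp
  also have "\<dots> \<le> limsup (\<lambda>n. ereal (SUP \<sigma>. avg_payoff g q n \<pi> \<sigma> \<tau>))" by (rule Liminf_le_Limsup) simp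
  finally show "liminf (\<lambda>n. ereal (INF \<tau>. avg_payoff g q n \<pi> \<sigma> \<tau>)) \<le> limsup (\<lambda>n. ereal (SUP \<sigma>. avg_payoff g q n \<pi> \<sigma> \<tau>))" .
qed

lemma uniform_value:
  assumes "\<pi> \<in> Delta_E khat dhat"
  shows "has_uniform_value g q \<pi> (v_star 1 (start \<pi>))"
  using lower_unif_value_ge[OF assms] upper_unif_value_le[of \<pi>] lower_le_upper_unif_value[of \<pi>]
  unfolding has_uniform_value_def by (auto intro!: antisym intro: order_trans)

lemma v_mn_uniform_limit:
  "uniform_limit (Delta_E khat dhat) (\<lambda>n \<pi>. v_mn g q 0 n \<pi>) (\<lambda>\<pi>. v_star 1 (start \<pi>)) sequentially"
proof (rule uniform_limitI)
  fix e :: real assume e: "0 < e"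
  then obtain N where N: "\<And>n z. N \<le> n \<Longrightarrow> valid 1 z \<Longrightarrow> \<bar>v_flow 0 n 1 z - v_star 1 z\<bar> \<le> e / 2"
    using v_flow_uniform[of "e / 2" 1] by auto
  show "\<forall>\<^sub>F n in sequentially. \<forall>\<pi>\<in>Delta_E khat dhat. dist (v_mn g q 0 n \<pi>) (v_star 1 (start \<pi>)) < e"
  proof (rule eventually_sequentiallyI[of N], intro ballI)
    fix n \<pi> assume "N \<le> n" "\<pi> \<in> Delta_E khat dhat"
    then show "dist (v_mn g q 0 n \<pi>) (v_star 1 (start \<pi>)) < e"
      using N[OF _ valid_start, of n \<pi>] e by (simp add: v_mn_eq dist_real_def)
  qed
qed

end

theorem mainTheorem3:
  fixes g :: "'k::finite \<Rightarrow> 'i::finite \<Rightarrow> 'j::finite \<Rightarrow> real"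
    and q :: "'k \<Rightarrow> 'i \<Rightarrow> 'j \<Rightarrow> ('k \<times> 'c::finite \<times> 'd::finite) pmf"
    and khat :: "'c \<Rightarrow> 'k" and dhat :: "'c \<Rightarrow> 'd"
  assumes g_range: "\<And>k i j. 0 \<le> g k i j \<and> g k i j \<le> 1"
    and informed: "\<And>k i j. measure_pmf.prob (q k i j) (info_set khat dhat) = 1"
    and control: "\<And>k i j j'. map_pmf (\<lambda>(k', c, d). (k', d)) (q k i j)
                             = map_pmf (\<lambda>(k', c, d). (k', d)) (q k i j')"
  shows "\<exists>vstar :: ('k \<times> 'c \<times> 'd) pmf \<Rightarrow> real.
    (\<forall>\<pi> \<in> Delta_E khat dhat.
        has_uniform_value g q \<pi> (vstar \<pi>)
      \<and> vstar \<pi> = (INF n\<in>{1..}. SUP m. v_mn g q m n \<pi>)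
      \<and> vstar \<pi> = (SUP m. INF n\<in>{1..}. v_mn g q m n \<pi>)
      \<and> vstar \<pi> = (INF n\<in>{1..}. SUP m. w_mn g q m n \<pi>)
      \<and> vstar \<pi> = (SUP m. INF n\<in>{1..}. w_mn g q m n \<pi>))
    \<and> uniform_limit (Delta_E khat dhat) (\<lambda>n \<pi>. v_mn g q 0 n \<pi>) vstar sequentially"
proof -
  interpret G: informed_controller_game g q khat dhat
    by unfold_locales (fact g_range informed control)+
  let ?v = "\<lambda>\<pi>. G.v_star 1 (G.start \<pi>)"
  \<comment> \<open>\<open>w_mn_eq\<close> requires \<open>1 \<le> n\<close>, so the rewriting must
    take place under the infimum over \<open>{1..}\<close>.\<close>
  have w: "(INF n\<in>{1..}. SUP m. w_mn g q m n \<pi>) = (INF n\<in>{1..}. SUP m. G.w_flow m n 1 (G.start \<pi>))"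
      "(SUP m. INF n\<in>{1..}. w_mn g q m n \<pi>) = (SUP m. INF n\<in>{1..}. G.w_flow m n 1 (G.start \<pi>))"
    if "\<pi> \<in> Delta_E khat dhat" for \<pi>
    by (rule INF_cong[OF refl], rule SUP_cong[OF refl], rule G.w_mn_eq[OF that], simp)
       (rule SUP_cong[OF refl], rule INF_cong[OF refl], rule G.w_mn_eq[OF that], simp)
  show ?thesis
  proof (intro exI[of _ ?v] conjI ballI)
    fix \<pi> assume \<pi>: "\<pi> \<in> Delta_E khat dhat"
    show "has_uniform_value g q \<pi> (?v \<pi>)" by (rule G.uniform_value[OF \<pi>])
    show "?v \<pi> = (INF n\<in>{1..}. SUP m. v_mn g q m n \<pi>)" "?v \<pi> = (SUP m. INF n\<in>{1..}. v_mn g q m n \<pi>)"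
      unfolding G.v_mn_eq[OF \<pi>] by (fact G.v_star_eqs(1,2)[OF G.valid_start])+
    show "?v \<pi> = (INF n\<in>{1..}. SUP m. w_mn g q m n \<pi>)" unfolding w[OF \<pi>] by (rule G.v_star_def)
    show "?v \<pi> = (SUP m. INF n\<in>{1..}. w_mn g q m n \<pi>)"
      unfolding w[OF \<pi>] by (rule G.v_star_eqs(3)[OF G.valid_start])
  next
    show "uniform_limit (Delta_E khat dhat) (\<lambda>n \<pi>. v_mn g q 0 n \<pi>) ?v sequentially"
      by (rule G.v_mn_uniform_limit)
  qed
qed

end
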